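(* Let $q$ be a power of a prime $p$, let $k$ be a positive integer with $\gcd(p,2k)=1$, and let $n=2k$. Let $g=(q-1)q^k/2$ be the genus of (the nonsingular projective model of) the affine curve $B_{q,H_k}: y^q-y=H_k(x)=x^{q^k+1}+x$, considered over $\mathbb{F}_{q^n}$. Let $m$ be a nonnegative integer with $2g-2<m<q^n+q^k$ and $$2(m+1)\le q^n.$$ Then there exists (obtained from the AG code $C(D,mP_\infty)$ over $\mathbb{F}_{q^n}$ of this curve) a quantum code with parameters $$[[q^n+q^k,\;q^n+q^k-2m+2g-2,\;\ge m-(q-1)q^k+2]]_{q^n}.$$
   Context: The curve $B_{q,H_k}$ over $\mathbb{F}_{q^n}$ is smooth, geometrically irreducible and has exactly one place at infinity: the normalization of its projective closure in $\mathbb{P}^2$ is $B_{q,H_k}$ together with a single further $\mathbb{F}_{q^n}$-rational point $P_\infty$. $D=P_1+\cdots+P_N$ is the sum of all $\mathbb{F}_{q^n}$-rational points of the affine curve, and $C(D,mP_\infty)$ is the image of $\mathcal{L}(mP_\infty)$ (functions over $\mathbb{F}_{q^n}$) under $h\mapsto(h(P_1),\dots,h(P_N))$. For a prime power $Q$, an $[[N,K,\ge d]]_{Q}$ quantum code here is a stabilizer quantum code: a $Q^K$-dimensional subspace of $(\mathbb{C}^{Q})^{\otimes N}$ that is the joint $+1$-eigenspace of an abelian subgroup of the generalized Pauli (error) group, with minimum distance at least $d$. It is a standard known fact that a linear $[N,k']$ code $\mathcal C$ over $\mathbb{F}_Q$ with $\mathcal C\subseteq\mathcal C^\perp$ (Euclidean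 dual) yields an $[[N,N-2k',\ge d^\perp]]_Q$ stabilizer code, where $d^\perp$ is the minimum distance of $\mathcal C^\perp$. *)

theory Defs
  imports
    Complex_Main
    "HOL-Library.Cardinality"
    "HOL-Library.Function_Algebras"
    "HOL-Algebra.Algebraic_Closure_Type"
    "Jordan_Normal_Form.Matrix"
begin

section \<open>The curve and its function field\<close>

text \<open>The equation \<open>y\<^sup>q - y = H\<^sub>k(x) = x\<^bsup>q^k+1\<^esup> + x\<close> makes sense over every commutative ring. It is
  used for the rational points (over the finite field) and for the generic point (over
  an algebraically closed overfield of the rational function field).\<close>

definition H_poly :: "nat \<Rightarrow> nat \<Rightarrow> 'b::comm_ring_1 \<Rightarrow> 'b" where
  "H_poly q k x = x ^ (q ^ k + 1) + x"

definition on_B :: "nat \<Rightarrow> nat \<Rightarrow> 'b::comm_ring_1 \<Rightarrow> 'b \<Rightarrow> bool" where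
  "on_B q k x y \<longleftrightarrow> y ^ q - y = H_poly q k x"

definition affine_points :: "nat \<Rightarrow> nat \<Rightarrow> ('a::field \<times> 'a) set" where
  "affine_points q k = {(a, b). on_B q k a b}"

text \<open>With \<open>F = 'a\<close>, the function field is realised as the subfield \<open>F(x, y)\<close> of the algebraic
  closure of the rational function field \<open>F(x)\<close>, where \<open>y\<close> is a root of the equation of the
  curve. As the curve is irreducible, this is the fraction field of its coordinate ring,
  whichever root \<open>y\<close> is taken.\<close>

type_synonym 'a ff = "'a poly fract alg_closure"

definition const :: "'a::field \<Rightarrow> 'a ff" where
  "const c = to_ac (to_fract [:c:])"

definition x_gen :: "'a::field ff" where
  "x_gen = to_ac (to_fract [:0, 1:])"

text \<open>A bivariate polynomial over \<open>'a\<close> is a polynomial in the second variable whose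
  coefficients are polynomials in the first one; \<open>\<phi>\<close> maps its coefficients to another field.\<close>

definition eval2 :: "('a::field \<Rightarrow> 'b::field) \<Rightarrow> 'a poly poly \<Rightarrow> 'b \<Rightarrow> 'b \<Rightarrow> 'b" where
  "eval2 \<phi> A a b = poly (map_poly (\<lambda>r. poly (map_poly \<phi> r) a) A) b"

definition function_field :: "'a::field ff \<Rightarrow> 'a ff set" where
  "function_field y =
     {eval2 const A x_gen y / eval2 const B x_gen y | A B. eval2 const B x_gen y \<noteq> 0}"

text \<open>The value at the point \<open>(a, b)\<close> of a function that is regular there.\<close>

definition value_at :: "'a::field ff \<Rightarrow> 'a ff \<Rightarrow> 'a \<times> 'a \<Rightarrow> 'a" where
  "value_at y h = (\<lambda>(a, b). THE c. \<exists>A B.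
     eval2 const B x_gen y \<noteq> 0 \<and> h = eval2 const A x_gen y / eval2 const B x_gen y \<and>
     eval2 id B a b \<noteq> 0 \<and> c = eval2 id A a b / eval2 id B a b)"


section \<open>Places, Riemann-Roch spaces and AG codes\<close>

text \<open>A place (of any degree) is given by its valuation ring \<open>R\<close>, with \<open>F \<subset> R \<subset> F(x, y)\<close>.\<close>

definition is_place :: "'a::field ff \<Rightarrow> 'a ff set \<Rightarrow> bool" where
  "is_place y R \<longleftrightarrow>
     range const \<subset> R \<and> R \<subset> function_field y \<and>
     (\<forall>u\<in>R. \<forall>v\<in>R. u - v \<in> R \<and> u * v \<in> R) \<and>
     (\<forall>z\<in>function_field y. z \<in> R \<or> inverse z \<in> R)"

definition place_units :: "'f::field set \<Rightarrow> 'f set" where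
  "place_units R = {u \<in> R. u \<noteq> 0 \<and> inverse u \<in> R}"

definition uniformizer :: "'f::field set \<Rightarrow> 'f \<Rightarrow> bool" where
  "uniformizer R t \<longleftrightarrow> R - place_units R = {t * w | w. w \<in> R}"

text \<open>The normalised discrete valuation of a nonzero element.\<close>

definition place_val :: "'f::field set \<Rightarrow> 'f \<Rightarrow> int" where
  "place_val R z =
     (THE e. \<exists>t u. uniformizer R t \<and> u \<in> place_units R \<and> z = t powi e * u)"

text \<open>\<open>P\<^sub>\<infinity>\<close> is the only place at which the affine coordinates are not both regular.\<close>

definition P_inf :: "'a::field ff \<Rightarrow> 'a ff set" where
  "P_inf y = (THE R. is_place y R \<and> \<not> (x_gen \<in> R \<and> y \<in> R))"

text \<open>\<open>\<L>(m P\<^sub>\<infinity>)\<close>. Being regular at a place (valuation \<open>\<ge> 0\<close>) is membership in its valuation ring.\<close>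

definition RR_space :: "'a::field ff \<Rightarrow> nat \<Rightarrow> 'a ff set" where
  "RR_space y m = {h \<in> function_field y.
     (\<forall>R. is_place y R \<and> R \<noteq> P_inf y \<longrightarrow> h \<in> R) \<and>
     (h = 0 \<or> place_val (P_inf y) h \<ge> - int m)}"

text \<open>The divisor \<open>D = P\<^sub>1 + \<dots> + P\<^sub>N\<close> is given by the list of its points.\<close>

definition AG_code :: "'a::field ff \<Rightarrow> ('a \<times> 'a) list \<Rightarrow> nat \<Rightarrow> 'a vec set" where
  "AG_code y D m = {vec_of_list (map (value_at y h) D) | h. h \<in> RR_space y m}"

definition euclidean_dual :: "nat \<Rightarrow> 'a::field vec set \<Rightarrow> 'a vec set" where
  "euclidean_dual N C = {v \<in> carrier_vec N. \<forall>c\<in>C. v \<bullet> c = 0}"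


section \<open>Stabilizer quantum codes over a finite field\<close>

text \<open>\<open>(\<complex>\<^sup>Q)\<^bsup>\<otimes>N\<^esup>\<close> with \<open>Q = CARD('a)\<close>: its standard basis is indexed by the words of length \<open>N\<close> over
  \<open>'a\<close>, and a vector is represented by its coordinate function.\<close>

type_synonym 'a state = "'a vec \<Rightarrow> complex"

definition states :: "nat \<Rightarrow> 'a state set" where
  "states N = {\<psi>. \<forall>w. w \<notin> carrier_vec N \<longrightarrow> \<psi> w = 0}"

definition state_scale :: "complex \<Rightarrow> 'a state \<Rightarrow> 'a state" where
  "state_scale c \<psi> = (\<lambda>w. c * \<psi> w)"

lemma vector_space_state: "vector_space (state_scale :: complex \<Rightarrow> 'a state \<Rightarrow> 'a state)"
  by unfold_locales (auto simp: state_scale_def fun_eq_iff algebra_simps)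

definition state_inner :: "nat \<Rightarrow> 'a state \<Rightarrow> 'a state \<Rightarrow> complex" where
  "state_inner N \<phi> \<psi> = (\<Sum>w\<in>carrier_vec N. cnj (\<phi> w) * \<psi> w)"

text \<open>The trace to the prime field, and the additive character \<open>z \<mapsto> exp (2 \<pi> i tr(z) / p)\<close>.\<close>

definition abs_trace :: "'a::{field,finite} \<Rightarrow> 'a" where
  "abs_trace z = (\<Sum>i<multiplicity CHAR('a) CARD('a). z ^ (CHAR('a) ^ i))"

definition add_char :: "'a::{field,finite} \<Rightarrow> complex" where
  "add_char z = cis (2 * pi * real (LEAST j. of_nat j = abs_trace z) / real CHAR('a))"

text \<open>\<open>X(a) Z(b)\<close>, which maps the basis vector \<open>|v\<rangle>\<close> to \<open>add_char (b \<bullet> v) |v + a\<rangle>\<close>.\<close>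

definition pauli :: "nat \<Rightarrow> 'a::{field,finite} vec \<Rightarrow> 'a vec \<Rightarrow> 'a state \<Rightarrow> 'a state" where
  "pauli N a b \<psi> =
     (\<lambda>w. if w \<in> carrier_vec N then add_char (b \<bullet> (w - a)) * \<psi> (w - a) else 0)"

definition pauli_phased :: "nat \<Rightarrow> nat \<Rightarrow> 'a::{field,finite} vec \<Rightarrow> 'a vec \<Rightarrow> 'a state \<Rightarrow> 'a state" where
  "pauli_phased N c a b \<psi> =
     state_scale (cis (2 * pi * real c / real CHAR('a))) (pauli N a b \<psi>)"

text \<open>The unit is \<open>X(0) Z(0)\<close>: it is the identity on \<open>states N\<close> and, as do all these operators,
  ignores the values of a function outside \<open>carrier_vec N\<close>.\<close>

definition pauli_group :: "nat \<Rightarrow> ('a::{field,finite} state \<Rightarrow> 'a state) monoid" where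
  "pauli_group N =
     \<lparr>carrier = {pauli_phased N c a b | c a b. a \<in> carrier_vec N \<and> b \<in> carrier_vec N},
      monoid.mult = (\<circ>),
      monoid.one = pauli N (0\<^sub>v N) (0\<^sub>v N)\<rparr>"

definition joint_fixed_space :: "nat \<Rightarrow> ('a state \<Rightarrow> 'a state) set \<Rightarrow> 'a state set" where
  "joint_fixed_space N S = {\<psi> \<in> states N. \<forall>E\<in>S. E \<psi> = \<psi>}"

definition is_stabilizer_code :: "nat \<Rightarrow> 'a::{field,finite} state set \<Rightarrow> bool" where
  "is_stabilizer_code N V \<longleftrightarrow> (\<exists>S.
     subgroup S (pauli_group N) \<and> comm_group ((pauli_group N)\<lparr>carrier := S\<rparr>) \<and>
     V = joint_fixed_space N S)"

definition pauli_weight :: "nat \<Rightarrow> 'a::zero vec \<Rightarrow> 'a vec \<Rightarrow> nat" where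
  "pauli_weight N a b = card {i. i < N \<and> (a $ i \<noteq> 0 \<or> b $ i \<noteq> 0)}"

text \<open>Minimum distance \<open>\<ge> d\<close>: every error of weight less than \<open>d\<close> is detectable, that is, its
  compression to the code space is a scalar. A phase does not matter here.\<close>

definition min_distance_ge :: "nat \<Rightarrow> 'a::{field,finite} state set \<Rightarrow> nat \<Rightarrow> bool" where
  "min_distance_ge N V d \<longleftrightarrow>
     (\<forall>a\<in>carrier_vec N. \<forall>b\<in>carrier_vec N. pauli_weight N a b < d \<longrightarrow>
        (\<exists>s. \<forall>\<phi>\<in>V. \<forall>\<psi>\<in>V. state_inner N \<phi> (pauli N a b \<psi>) = s * state_inner N \<phi> \<psi>))"

text \<open>\<open>V\<close> is an \<open>[[N, K, \<ge> d]]\<close> code over the alphabet \<open>'a\<close>.\<close>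

definition quantum_code :: "'a::{field,finite} state set \<Rightarrow> nat \<Rightarrow> nat \<Rightarrow> nat \<Rightarrow> bool" where
  "quantum_code V N K d \<longleftrightarrow>
     is_stabilizer_code N V \<and>
     vector_space.dim state_scale V = CARD('a) ^ K \<and>
     min_distance_ge N V d"

text \<open>The standard construction from a Euclidean self-orthogonal code \<open>C\<close> of length \<open>N\<close>: the
  stabilizer consists of all \<open>X(a) Z(b)\<close> with \<open>a, b \<in> C\<close>.\<close>

definition obtained_from :: "'a::{field,finite} state set \<Rightarrow> nat \<Rightarrow> 'a vec set \<Rightarrow> bool" where
  "obtained_from V N C \<longleftrightarrow>
     C \<subseteq> euclidean_dual N C \<and>
     V = joint_fixed_space N {pauli N a b | a b. a \<in> C \<and> b \<in> C}"

end

theory Submission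
  imports Defs "HOL-Number_Theory.Cong"
begin

text \<open>
  Two independent arguments meet here: a general construction of quantum codes, and the
  determination of the parameters of the code \<open>C(D, mP\<^sub>\<infinity>)\<close>.

  \<^bold>\<open>Quantum codes.\<close> Let \<open>C \<subseteq> C\<^sup>\<bottom>\<close> be a linear code of length \<open>N\<close> and dimension \<open>k'\<close> over a field
  of \<open>Q\<close> elements. A state is fixed by all \<open>Z(b)\<close>, \<open>b \<in> C\<close>, if and only if it is supported on
  \<open>C\<^sup>\<bottom>\<close>, and by all \<open>X(a)\<close>, \<open>a \<in> C\<close>, if and only if it is constant on the cosets of \<open>C\<close>. So the
  dimension of the code space is the index of \<open>C\<close> in \<open>C\<^sup>\<bottom>\<close>, which is \<open>Q\<^bsup>N - 2k'\<^esup>\<close>, and an error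
  \<open>X(a) Z(b)\<close> is undetectable only if \<open>a\<close> and \<open>b\<close> lie in \<open>C\<^sup>\<bottom>\<close> and are not both zero, so that its
  weight is at least the minimum distance of \<open>C\<^sup>\<bottom>\<close> (\<open>quantum_code_from_self_orthogonal\<close>).

  \<^bold>\<open>Functions on the curve.\<close> At a place where \<open>x\<close> has a pole, the equation forces the pole orders
  of \<open>x\<close> and \<open>y\<close> to be proportional to \<open>q\<close> and \<open>q^k + 1\<close>, and \<open>t = x^(q^(k-1)) / y\<close> is a
  uniformizer. The monomials \<open>x^i y^j\<close> with \<open>j < q\<close> then have pairwise distinct pole orders \<open>q i +
  (q^k + 1) j\<close>, so the order of any polynomial can be read off from its monomials (\<open>ev_t\<close>). This
  gives the irreducibility of the equation and the uniqueness of the place at infinity at one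
  stroke; its existence is Chevalley's extension theorem (\<open>ex_valuation_ring_avoiding\<close>). A
  function that is regular at all other places is a polynomial in \<open>x\<close> and \<open>y\<close>
  (\<open>regular_imp_polynomial\<close>): otherwise it has, up to a polynomial in \<open>x\<close>, the form \<open>f / \<pi>\<close>, where
  the prime polynomial \<open>\<pi>\<close> in \<open>x\<close> does not divide \<open>f\<close>; since the coordinate ring modulo \<open>\<pi>\<close> has no
  nilpotents, Chevalley's theorem again provides a place in the affine plane where \<open>f / \<pi>\<close> has a
  pole. Hence the monomials of weight at most \<open>m\<close> are a basis of \<open>\<L>(mP\<^sub>\<infinity>)\<close>. The semigroup
  generated by \<open>q\<close> and \<open>q^k + 1\<close> is symmetric with \<open>g\<close> gaps, whence the dimension \<open>m + 1 - g\<close>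
  (\<open>card_L_space\<close>).

  \<^bold>\<open>Self-orthogonality.\<close> The abscissas of the rational points are the zeros of the polynomial
  \<open>tau\<close> representing the trace of \<open>H(x)\<close> to the field of \<open>q\<close> elements. It has only simple roots,
  all of them rational; here \<open>gcd(p, 2k) = 1\<close> is used (\<open>card_Z\<close>). The sum of a function over the
  points of a fibre only sees the coefficient of \<open>y^(q-1)\<close>, and the sum of a polynomial over the
  zeros of \<open>tau\<close> is its sum against \<open>1 - tau^(q-1)\<close> over the whole field, which vanishes for
  reasons of degree. In this way the sum over all points vanishes on \<open>\<L>((q^n - 2) P\<^sub>\<infinity>)\<close>
  (\<open>sum_points_eq_0\<close>), and this space contains the product of any two functions in \<open>\<L>(mP\<^sub>\<infinity>)\<close>
  because \<open>2 (m + 1) \<le> q^n\<close>.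

  \<^bold>\<open>Dual distance.\<close> The bound \<open>m + 2 - 2g\<close> is obtained from the semigroup of pole orders alone, by
  the order bound of Feng and Rao (\<open>dual_weight\<close>).
\<close>

(* The symbol $ denotes the entries of vectors. *)
no_notation fps_nth (infixl "$" 75)

section \<open>Characters of a finite field\<close>

lemma prime_CHAR_finite: "prime CHAR('a::{field,finite})"
  by (rule prime_CHAR_semidom) (simp add: finite_imp_CHAR_pos)

lemma of_nat_card_eq_0: "of_nat CARD('a) = (0 :: 'a::{field,finite})"
proof -
  have "(\<Sum>x\<in>UNIV. x + 1) = (\<Sum>x\<in>UNIV. x :: 'a)"
    by (rule sum.reindex_bij_witness[of _ "\<lambda>x. x - 1" "\<lambda>x. x + 1"]) auto
  then show ?thesis by (simp add: sum.distrib)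
qed

lemma card_gt_1: "CARD('a::{field,finite}) > 1"
proof -
  have "card {0, 1 :: 'a} \<le> CARD('a)" by (rule card_mono) auto
  then show ?thesis by simp
qed

lemma CHAR_eq_prime:
  assumes "prime p" and card: "CARD('a::{field,finite}) = p ^ r"
  shows "CHAR('a) = p"
proof -
  have "CHAR('a) dvd p ^ r"
    using of_nat_card_eq_0[where 'a='a] by (simp only: card of_nat_eq_0_iff_char_dvd)
  then show ?thesis
    using prime_CHAR_finite[where 'a='a] assms(1) by (meson prime_dvd_power primes_dvd_imp_eq)
qed

lemma finite_field_power_card:
  fixes a :: "'a::{field,finite}"
  shows "a ^ CARD('a) = a"
proof (cases "a = 0")
  case False
  define U where "U = UNIV - {0 :: 'a}"
  have fin: "finite U" and nz: "\<And>x. x \<in> U \<Longrightarrow> x \<noteq> 0" by (auto simp: U_def)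
  have "(\<Prod>x\<in>U. a * x) = (\<Prod>x\<in>U. x)"
    by (rule prod.reindex_bij_witness[of _ "\<lambda>x. x / a" "\<lambda>x. a * x"]) (use False in \<open>auto simp: U_def\<close>)
  moreover have "(\<Prod>x\<in>U. a * x) = a ^ card U * (\<Prod>x\<in>U. x)"
    by (simp only: prod.distrib prod_constant)
  moreover have "(\<Prod>x\<in>U. x) \<noteq> 0" using fin nz by (metis prod_zero_iff)
  ultimately have "a ^ card U = 1" by (metis mult_cancel_right1)
  moreover have "CARD('a) = Suc (card U)"
    unfolding U_def by (rule card_Suc_Diff1[symmetric]) simp_all
  ultimately show ?thesis by (simp only: power_Suc mult_1_right)
next
  case True
  have "CARD('a) > 0" by (rule finite_UNIV_card_ge_0) simp
  then show ?thesis unfolding True by (rule zero_power)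
qed

text \<open>The polynomial \<open>t^p - t\<close> has the \<open>p\<close> elements of the prime field as roots, hence no others.\<close>

lemma frobenius_fixed_of_nat:
  fixes t :: "'a::{field,finite}"
  assumes "t ^ CHAR('a) = t"
  shows "\<exists>j. of_nat j = t"
proof -
  let ?p = "CHAR('a)"
  let ?P = "monom 1 ?p - monom 1 1 :: 'a poly"
  have p: "prime ?p" by (rule prime_CHAR_finite)
  then have p1: "?p > 1" by (rule prime_gt_1_nat)
  have fr: "of_nat j ^ ?p = (of_nat j :: 'a)" for j
    by (induction j) (use p p1 in \<open>auto simp: freshmans_dream\<close>)
  have "coeff ?P ?p = 1" using p1 by simp
  then have nz: "?P \<noteq> 0" by (metis coeff_0 zero_neq_one)
  have "degree ?P \<le> ?p"
    using p1 by (intro degree_diff_le) (auto simp: degree_monom_eq)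
  then have le: "card {x. poly ?P x = 0} \<le> ?p"
    using card_poly_roots_bound[OF nz] by linarith
  have inj: "inj_on (of_nat :: nat \<Rightarrow> 'a) {..<?p}"
    by (rule inj_onI) (simp add: of_nat_eq_iff_cong_CHAR cong_def)
  have sub: "of_nat ` {..<?p} \<subseteq> {x. poly ?P x = 0}"
    using fr by (auto simp: poly_monom)
  have "of_nat ` {..<?p} = {x. poly ?P x = 0}"
    by (rule card_seteq) (use sub le card_image[OF inj] in auto)
  moreover have "t \<in> {x. poly ?P x = 0}" using assms by (simp add: poly_monom)
  ultimately have "t \<in> of_nat ` {..<?p}" by blast
  then show ?thesis by auto
qed

context
  fixes r :: nat
  assumes card: "CARD('a::{field,finite}) = CHAR('a) ^ r"
begin

lemma card_exponent: "multiplicity CHAR('a) CARD('a) = r"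
  unfolding card using prime_CHAR_finite[where 'a='a]
  by (simp add: multiplicity_same_power prime_gt_0_nat prime_nat_iff)

lemma abs_trace_add: "abs_trace (x + y) = abs_trace x + abs_trace (y :: 'a)"
  unfolding abs_trace_def
  by (simp add: freshmans_dream'[OF prime_CHAR_finite refl] sum.distrib)

lemma abs_trace_prime_field: "\<exists>j. of_nat j = abs_trace (z :: 'a)"
proof (rule frobenius_fixed_of_nat)
  let ?p = "CHAR('a)"
  have "abs_trace z ^ ?p = (\<Sum>i<r. z ^ (?p ^ Suc i))"
    unfolding abs_trace_def card_exponent
    by (subst freshmans_dream_sum[OF prime_CHAR_finite refl])
       (simp add: power_mult[symmetric] mult.commute)
  also have "\<dots> + z = (\<Sum>i<Suc r. z ^ (?p ^ i))"
    by (subst sum.lessThan_Suc_shift) simp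
  also have "\<dots> = abs_trace z + z"
    unfolding abs_trace_def card_exponent
    using finite_field_power_card[of z] by (simp add: card[symmetric])
  finally show "abs_trace z ^ ?p = abs_trace z" by simp
qed

text \<open>The exponent in the definition of the character matters only modulo the characteristic, so that
  the least natural number representing the trace can be replaced by any other one.\<close>

lemma add_char_of_nat:
  assumes "of_nat j = abs_trace (z :: 'a)"
  shows "add_char z = cis (2 * pi * real j / real CHAR('a))"
proof -
  let ?p = "CHAR('a)"
  define l where "l = (LEAST j. of_nat j = abs_trace z)"
  have p: "?p > 0" using prime_CHAR_finite[where 'a='a] prime_gt_0_nat by blast
  have "of_nat l = abs_trace z" unfolding l_def using assms by (rule LeastI)
  then have "[j = l] (mod ?p)" using assms of_nat_eq_iff_cong_CHAR by metis
  then have "[int j = int l] (mod int ?p)" by (simp add: cong_int_iff)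
  then obtain c where c: "int j = int l + int ?p * c"
    by (metis cong_iff_lin cong_sym)
  have "real j = real l + real ?p * of_int c"
    by (metis c of_int_add of_int_mult of_int_of_nat_eq)
  then have "2 * pi * real j / real ?p = 2 * pi * real l / real ?p + 2 * pi * of_int c"
    using p by (simp add: field_simps)
  then have "cis (2 * pi * real j / real ?p) = cis (2 * pi * real l / real ?p)"
    by (simp flip: cis_mult add: cis_multiple_2pi)
  then show ?thesis unfolding add_char_def l_def by simp
qed

lemma add_char_add: "add_char (x + y) = add_char x * add_char (y :: 'a)"
proof -
  obtain i j where "of_nat i = abs_trace x" and "of_nat j = abs_trace y"
    using abs_trace_prime_field by metis
  moreover from this have "of_nat (i + j) = abs_trace (x + y)"
    by (simp add: abs_trace_add)
  ultimately show ?thesis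
    by (simp only: add_char_of_nat cis_mult) (simp add: algebra_simps add_divide_distrib)
qed

lemma add_char_nonzero: "add_char (x :: 'a) \<noteq> 0"
  by (simp add: add_char_def)

lemma add_char_0: "add_char (0 :: 'a) = 1"
  using add_char_add[of 0 0] add_char_nonzero[of 0] by simp

text \<open>The trace is a polynomial whose degree is less than the size of the field.\<close>

lemma abs_trace_nontrivial: "\<exists>z :: 'a. abs_trace z \<noteq> 0"
proof -
  let ?p = "CHAR('a)"
  have p1: "?p > 1" using prime_CHAR_finite[where 'a='a] by (rule prime_gt_1_nat)
  have r: "r > 0" using card card_gt_1[where 'a='a] by (cases r) auto
  define P :: "'a poly" where "P = (\<Sum>i<r. monom 1 (?p ^ i))"
  have "coeff P (?p ^ (r - 1)) = (\<Sum>i<r. if i = r - 1 then 1 else 0)"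
    unfolding P_def coeff_sum by (rule sum.cong) (use p1 in \<open>auto simp: power_inject_exp\<close>)
  also have "\<dots> = 1" using r by (simp add: sum.delta)
  finally have nz: "P \<noteq> 0" by auto
  have "degree P \<le> ?p ^ (r - 1)"
    unfolding P_def using p1
    by (intro degree_sum_le) (auto simp: degree_monom_eq intro!: power_increasing)
  also have "\<dots> < CARD('a)" unfolding card using r p1 by (intro power_strict_increasing) auto
  finally have "card {x. poly P x = 0} < CARD('a)"
    using card_poly_roots_bound[OF nz] by linarith
  then have "{x. poly P x = 0} \<noteq> UNIV" by auto
  then obtain z where "poly P z \<noteq> 0" by auto
  then show ?thesis
    by (intro exI[of _ z]) (simp add: abs_trace_def card_exponent P_def poly_sum poly_monom)
qed

text \<open>The multiples of a nonzero \<open>z\<close> exhaust the field, and the character is nontrivial wherever the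
  trace does not vanish.\<close>

lemma add_char_nontrivial:
  assumes "z \<noteq> (0 :: 'a)"
  shows "\<exists>c. add_char (c * z) \<noteq> 1"
proof -
  let ?p = "CHAR('a)"
  have p: "?p > 0" using prime_CHAR_finite[where 'a='a] prime_gt_0_nat by blast
  obtain u :: 'a where u: "abs_trace u \<noteq> 0" using abs_trace_nontrivial by blast
  obtain j where j: "of_nat j = abs_trace u" using abs_trace_prime_field by blast
  have "add_char u \<noteq> 1"
  proof
    assume "add_char u = 1"
    then have "cis (2 * pi * real j / real ?p) = 1" by (simp add: add_char_of_nat[OF j])
    then have "cos (2 * pi * real j / real ?p) = 1" by (simp add: complex_eq_iff)
    then obtain n :: int where "2 * pi * real j / real ?p = of_int n * 2 * pi"
      by (auto simp: cos_one_2pi_int)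
    then have "real j = of_int n * real ?p" using p by (simp add: field_simps)
    then have "int j = n * int ?p" by (metis of_int_eq_iff of_int_mult of_int_of_nat_eq)
    then have "?p dvd j" by (metis dvd_triv_right int_dvd_int_iff)
    then show False using u j of_nat_eq_0_iff_char_dvd by metis
  qed
  then show ?thesis using assms by (intro exI[of _ "u / z"]) simp
qed

end

section \<open>Linear codes and their duals\<close>

lemma bij_vec_of_list: "bij_betw vec_of_list {xs :: 'a list. length xs = N} (carrier_vec N)"
proof (rule bij_betwI[of _ _ _ list_of_vec])
  show "vec_of_list \<in> {xs :: 'a list. length xs = N} \<rightarrow> carrier_vec N"
    by (rule Pi_I, rule carrier_vecI) auto
  show "list_of_vec \<in> carrier_vec N \<rightarrow> {xs :: 'a list. length xs = N}"
    by (rule Pi_I) auto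
qed (rule list_vec, rule vec_list)

lemma finite_carrier_vec: "finite (carrier_vec N :: 'a::finite vec set)"
  using bij_betw_finite[OF bij_vec_of_list[where 'a='a and N=N]]
    finite_lists_length_eq[of "UNIV :: 'a set" N] by simp

lemma card_carrier_vec: "card (carrier_vec N :: 'a::finite vec set) = CARD('a) ^ N"
  using bij_betw_same_card[OF bij_vec_of_list[where 'a='a and N=N]]
    card_lists_length_eq[of "UNIV :: 'a set" N] by simp

text \<open>The common reason for the vanishing of character sums and of power sums.\<close>

lemma sum_eq_0_if_rescaled:
  fixes h :: "'b \<Rightarrow> 'c::idom"
  assumes bij: "bij_betw \<tau> A A" and h: "\<And>x. x \<in> A \<Longrightarrow> h (\<tau> x) = \<omega> * h x" and "\<omega> \<noteq> 1"
  shows "sum h A = 0"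
proof -
  have "sum h A = (\<Sum>x\<in>A. h (\<tau> x))" using sum.reindex_bij_betw[OF bij, of h] by simp
  also have "\<dots> = \<omega> * sum h A" using h by (simp add: sum_distrib_left)
  finally have "(\<omega> - 1) * sum h A = 0" by (simp add: algebra_simps)
  then show ?thesis using \<open>\<omega> \<noteq> 1\<close> by simp
qed

locale linear_code =
  fixes N :: nat and C :: "'a::{field,finite} vec set" and r :: nat
  assumes card: "CARD('a) = CHAR('a) ^ r"
    and subset: "C \<subseteq> carrier_vec N"
    and zero: "0\<^sub>v N \<in> C"
    and add: "\<And>u v. u \<in> C \<Longrightarrow> v \<in> C \<Longrightarrow> u + v \<in> C"
    and smult: "\<And>c u. u \<in> C \<Longrightarrow> c \<cdot>\<^sub>v u \<in> C"
begin

lemma finite_code: "finite C"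
  using subset finite_carrier_vec finite_subset by blast

lemma carrier: "u \<in> C \<Longrightarrow> u \<in> carrier_vec N"
  using subset by blast

lemma uminus: "u \<in> C \<Longrightarrow> - u \<in> C"
proof -
  assume "u \<in> C"
  moreover have "- u = (-1) \<cdot>\<^sub>v u" by (rule eq_vecI) auto
  ultimately show "- u \<in> C" using smult[of u "-1"] by simp
qed

lemma minus: "u \<in> C \<Longrightarrow> v \<in> C \<Longrightarrow> u - v \<in> C"
  using add[of u "-v"] uminus[of v] carrier[of u] carrier[of v] by (simp add: minus_add_uminus_vec)

lemma translate_bij:
  assumes "u \<in> C" shows "bij_betw (\<lambda>v. v + u) C C"
proof (rule bij_betwI[of _ _ _ "\<lambda>v. v - u"])
  show "(\<lambda>v. v + u) \<in> C \<rightarrow> C" using add assms by auto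
  show "(\<lambda>v. v - u) \<in> C \<rightarrow> C" using minus assms by auto
  show "v + u - u = v" if "v \<in> C" for v
    using carrier[OF that] carrier[OF assms] by auto
  show "v - u + u = v" if "v \<in> C" for v
    using carrier[OF that] carrier[OF assms] by auto
qed

lemma char_scalar_add:
  fixes u v w :: "'a vec"
  assumes "v \<in> carrier_vec N" "u \<in> carrier_vec N" "w \<in> carrier_vec N"
  shows "add_char (v \<bullet> (u + w)) = add_char (v \<bullet> u) * add_char (v \<bullet> w)"
  using assms by (simp add: scalar_prod_add_distrib add_char_add[OF card])

text \<open>A linear code contains all multiples of its words, and a nonzero linear form takes all values on
  the multiples of a word; so the character detects every failure of orthogonality.\<close>

lemma ex_char_nontrivial:
  assumes "v \<in> carrier_vec N" and "v \<notin> euclidean_dual N C"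
  shows "\<exists>u\<in>C. add_char (v \<bullet> u) \<noteq> 1"
proof -
  obtain u where u: "u \<in> C" "v \<bullet> u \<noteq> 0" using assms by (auto simp: euclidean_dual_def)
  obtain c where "add_char (c * (v \<bullet> u)) \<noteq> 1" using add_char_nontrivial[OF card u(2)] by blast
  then have "add_char (v \<bullet> (c \<cdot>\<^sub>v u)) \<noteq> 1" using assms(1) carrier[OF u(1)] by simp
  then show ?thesis using smult[OF u(1)] by blast
qed

lemma sum_char_code:
  assumes "v \<in> carrier_vec N"
  shows "(\<Sum>u\<in>C. add_char (v \<bullet> u)) = (if v \<in> euclidean_dual N C then of_nat (card C) else 0)"
proof (cases "v \<in> euclidean_dual N C")
  case True
  then show ?thesis by (simp add: euclidean_dual_def add_char_0[OF card])
next
  case False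
  then obtain u where u: "u \<in> C" "add_char (v \<bullet> u) \<noteq> 1"
    using ex_char_nontrivial[OF assms] by blast
  have "(\<Sum>u\<in>C. add_char (v \<bullet> u)) = 0"
    by (rule sum_eq_0_if_rescaled[OF translate_bij[OF u(1)] _ u(2)])
       (simp add: char_scalar_add assms carrier u(1) mult.commute)
  with False show ?thesis by simp
qed

end

lemma linear_code_carrier_vec:
  assumes "CARD('a::{field,finite}) = CHAR('a) ^ r"
  shows "linear_code N (carrier_vec N :: 'a vec set) r"
  using assms by unfold_locales auto

lemma euclidean_dual_carrier_vec: "euclidean_dual N (carrier_vec N) = {0\<^sub>v N :: 'a::field vec}"
proof -
  have "v = 0\<^sub>v N" if v: "v \<in> carrier_vec N" and o: "\<forall>c\<in>carrier_vec N. v \<bullet> c = 0" for v :: "'a vec"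
  proof (rule eq_vecI)
    fix i assume "i < dim_vec (0\<^sub>v N :: 'a vec)"
    then have i: "i < N" by simp
    have "v \<bullet> unit_vec N i = 0" using o by simp
    then show "v $ i = 0\<^sub>v N $ i" using v i by (simp add: scalar_prod_right_unit)
  qed (use v in auto)
  then show ?thesis by (auto simp: euclidean_dual_def)
qed

text \<open>Both orders of summation of \<open>add_char (v \<bullet> u)\<close> over all words \<open>v\<close> and all code words \<open>u\<close> count:
  the words orthogonal to the code, and the code words orthogonal to everything.\<close>

lemma (in linear_code) card_code_times_dual: "card C * card (euclidean_dual N C) = CARD('a) ^ N"
proof -
  interpret V: linear_code N "carrier_vec N :: 'a vec set" r
    by (rule linear_code_carrier_vec[OF card])
  let ?V = "carrier_vec N :: 'a vec set"
  have sub: "euclidean_dual N C \<subseteq> ?V" by (auto simp: euclidean_dual_def)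
  have "(\<Sum>v\<in>?V. \<Sum>u\<in>C. add_char (v \<bullet> u))
      = (\<Sum>v\<in>?V. if v \<in> euclidean_dual N C then of_nat (card C) else 0)"
    by (rule sum.cong) (simp_all add: sum_char_code)
  also have "\<dots> = of_nat (card C * card (euclidean_dual N C))"
    using sub finite_carrier_vec[of N, where 'a='a]
    by (simp add: sum.If_cases Int_absorb1 Collect_conj_eq[symmetric] mult.commute)
  finally have A: "(\<Sum>v\<in>?V. \<Sum>u\<in>C. add_char (v \<bullet> u)) = of_nat (card C * card (euclidean_dual N C))" .
  have "(\<Sum>v\<in>?V. \<Sum>u\<in>C. add_char (v \<bullet> u)) = (\<Sum>u\<in>C. \<Sum>v\<in>?V. add_char (u \<bullet> v))"
    using carrier by (subst sum.swap) (auto intro!: sum.cong simp: comm_scalar_prod[where n=N])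
  also have "\<dots> = (\<Sum>u\<in>C. if u = 0\<^sub>v N then of_nat (CARD('a) ^ N) else 0)"
    using carrier by (intro sum.cong)
      (simp_all add: V.sum_char_code euclidean_dual_carrier_vec card_carrier_vec)
  also have "\<dots> = of_nat (CARD('a) ^ N)"
    using zero finite_code by (simp add: sum.delta)
  finally show ?thesis using A of_nat_eq_iff by metis
qed

section \<open>The stabilizer code of a self-orthogonal linear code\<close>

definition indicator_state :: "'a vec set \<Rightarrow> 'a state" where
  "indicator_state S w = of_bool (w \<in> S)"

lemma inj_indicator_state: "inj indicator_state"
proof (rule injI)
  fix S T :: "'a vec set" assume "indicator_state S = indicator_state T"
  then have "indicator_state S w = indicator_state T w" for w by (rule fun_cong)
  then have "w \<in> S \<longleftrightarrow> w \<in> T" for w by (simp only: indicator_state_def of_bool_eq_iff)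
  then show "S = T" by blast
qed

locale self_orthogonal_code = linear_code +
  assumes self_orthogonal: "C \<subseteq> euclidean_dual N C"
begin

abbreviation "dual \<equiv> euclidean_dual N C"
abbreviation "stabilizer \<equiv> {pauli N a b | a b. a \<in> C \<and> b \<in> C}"
abbreviation "code_space \<equiv> joint_fixed_space N stabilizer"

lemma orthogonal: "a \<in> C \<Longrightarrow> b \<in> C \<Longrightarrow> b \<bullet> a = 0"
  using self_orthogonal by (auto simp: euclidean_dual_def)

lemma dual_carrier: "v \<in> dual \<Longrightarrow> v \<in> carrier_vec N"
  by (simp add: euclidean_dual_def)

lemma dual_minus: "v \<in> dual \<Longrightarrow> u \<in> dual \<Longrightarrow> v - u \<in> dual"
  using carrier by (auto simp: euclidean_dual_def minus_scalar_prod_distrib[where n=N])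

lemma dual_add: "v \<in> dual \<Longrightarrow> u \<in> dual \<Longrightarrow> v + u \<in> dual"
  using carrier by (auto simp: euclidean_dual_def add_scalar_prod_distrib[where n=N])

text \<open>Moving \<open>Z(b)\<close> past \<open>X(a')\<close> costs the phase \<open>add_char (b \<bullet> a')\<close>, which for code words is trivial
  by self-orthogonality.\<close>

lemma pauli_comp:
  fixes a a' b b' :: "'a vec"
  assumes a: "a \<in> carrier_vec N" "a' \<in> carrier_vec N" and b: "b \<in> carrier_vec N" "b' \<in> carrier_vec N"
    and o: "b \<bullet> a' = 0"
  shows "pauli N a b \<circ> pauli N a' b' = pauli N (a + a') (b + b')"
proof (rule ext, rule ext)
  fix \<psi> :: "'a state" and w :: "'a vec"
  show "(pauli N a b \<circ> pauli N a' b') \<psi> w = pauli N (a + a') (b + b') \<psi> w"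
  proof (cases "w \<in> carrier_vec N")
    case w: True
    have e1: "w - a - a' = w - (a + a')" using a w by auto
    have e2: "b \<bullet> (w - a) = b \<bullet> (w - (a + a'))"
      using a b w o by (simp add: scalar_prod_minus_distrib[where n=N] scalar_prod_add_distrib[where n=N])
    have e3: "(b + b') \<bullet> (w - (a + a')) = b \<bullet> (w - (a + a')) + b' \<bullet> (w - (a + a'))"
      using a b w by (intro add_scalar_prod_distrib[where n=N]) auto
    show ?thesis using a w
      by (simp add: pauli_def e1 e2 e3 add_char_add[OF card])
  qed (simp add: pauli_def)
qed

lemma stabilizer_is_stabilizer_code: "is_stabilizer_code N code_space"
proof -
  let ?G = "pauli_group N :: ('a state \<Rightarrow> 'a state) monoid"
  have ph: "pauli N a b = pauli_phased N 0 a b" for a b :: "'a vec"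
    by (simp add: pauli_phased_def state_scale_def fun_eq_iff)
  have sub: "stabilizer \<subseteq> carrier ?G"
    using carrier by (auto simp: pauli_group_def ph)
  have one: "\<one>\<^bsub>?G\<^esub> = pauli N (0\<^sub>v N) (0\<^sub>v N)" by (simp add: pauli_group_def)
  have mult: "x \<otimes>\<^bsub>?G\<^esub> y = x \<circ> y" for x y by (simp add: pauli_group_def)
  have comp: "pauli N a b \<circ> pauli N a' b' = pauli N (a + a') (b + b')"
    if "a \<in> C" "b \<in> C" "a' \<in> C" "b' \<in> C" for a b a' b'
    using that orthogonal carrier by (intro pauli_comp) auto
  have one_left: "\<one>\<^bsub>?G\<^esub> \<circ> x = x" if x: "x \<in> carrier ?G" for x
  proof -
    obtain c a b where x: "x = pauli_phased N c a b" "a \<in> carrier_vec N" "b \<in> carrier_vec N"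
      using x by (auto simp: pauli_group_def)
    show ?thesis unfolding one x(1) using x(2,3)
      by (auto simp: fun_eq_iff pauli_def pauli_phased_def state_scale_def add_char_0[OF card])
  qed
  have one_right: "x \<circ> \<one>\<^bsub>?G\<^esub> = x" if x: "x \<in> carrier ?G" for x
  proof -
    obtain c a b where x: "x = pauli_phased N c a b" "a \<in> carrier_vec N" "b \<in> carrier_vec N"
      using x by (auto simp: pauli_group_def)
    show ?thesis unfolding one x(1) using x(2,3)
      by (auto simp: fun_eq_iff pauli_def pauli_phased_def state_scale_def add_char_0[OF card])
  qed
  have inv_comp: "pauli N a b \<circ> pauli N (- a) (- b) = \<one>\<^bsub>?G\<^esub>"
    "pauli N (- a) (- b) \<circ> pauli N a b = \<one>\<^bsub>?G\<^esub>" if ab: "a \<in> C" "b \<in> C" for a b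
    using comp[of a b "-a" "-b"] comp[of "-a" "-b" a b] uminus ab carrier[OF ab(1)] carrier[OF ab(2)]
    by (simp_all add: one)
  have inv: "inv\<^bsub>?G\<^esub> (pauli N a b) = pauli N (- a) (- b)" if ab: "a \<in> C" "b \<in> C" for a b
    unfolding m_inv_def
  proof (rule the_equality)
    have "pauli N (- a) (- b) \<in> carrier ?G" using sub ab uminus by blast
    then show "pauli N (- a) (- b) \<in> carrier ?G \<and> pauli N a b \<otimes>\<^bsub>?G\<^esub> pauli N (- a) (- b) = \<one>\<^bsub>?G\<^esub> \<and>
        pauli N (- a) (- b) \<otimes>\<^bsub>?G\<^esub> pauli N a b = \<one>\<^bsub>?G\<^esub>"
      using inv_comp[OF ab] by (simp add: mult)
    fix y assume y: "y \<in> carrier ?G \<and> pauli N a b \<otimes>\<^bsub>?G\<^esub> y = \<one>\<^bsub>?G\<^esub> \<and> y \<otimes>\<^bsub>?G\<^esub> pauli N a b = \<one>\<^bsub>?G\<^esub>"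
    have "y = (pauli N (- a) (- b) \<circ> pauli N a b) \<circ> y" using y one_left inv_comp[OF ab] by simp
    also have "\<dots> = pauli N (- a) (- b) \<circ> \<one>\<^bsub>?G\<^esub>" using y by (simp add: mult comp_assoc)
    also have "\<dots> = pauli N (- a) (- b)" by (rule one_right) fact
    finally show "y = pauli N (- a) (- b)" .
  qed
  have subgroup: "subgroup stabilizer ?G"
  proof
    show "stabilizer \<subseteq> carrier ?G" by (rule sub)
    show "x \<otimes>\<^bsub>?G\<^esub> y \<in> stabilizer" if xy: "x \<in> stabilizer" "y \<in> stabilizer" for x y
    proof -
      obtain a b a' b' where *: "x = pauli N a b" "y = pauli N a' b'" "a \<in> C" "b \<in> C" "a' \<in> C" "b' \<in> C"
        using xy by blast
      show ?thesis unfolding mult *(1,2) comp[OF *(3-6)] using * add by blast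
    qed
    show "\<one>\<^bsub>?G\<^esub> \<in> stabilizer" unfolding one using zero by blast
    show "inv\<^bsub>?G\<^esub> x \<in> stabilizer" if x: "x \<in> stabilizer" for x
    proof -
      obtain a b where *: "x = pauli N a b" "a \<in> C" "b \<in> C" using x by blast
      show ?thesis unfolding *(1) inv[OF *(2,3)] using * uminus by blast
    qed
  qed
  let ?S = "?G\<lparr>carrier := stabilizer\<rparr>"
  have "comm_group ?S"
  proof (rule comm_groupI)
    show "x \<otimes>\<^bsub>?S\<^esub> y \<in> carrier ?S"
      if "x \<in> carrier ?S" "y \<in> carrier ?S" for x y
      using that subgroup.m_closed[OF subgroup] by simp
    show "\<one>\<^bsub>?S\<^esub> \<in> carrier ?S"
      using subgroup.one_closed[OF subgroup] by simp
    show "x \<otimes>\<^bsub>?S\<^esub> y \<otimes>\<^bsub>?S\<^esub> z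
        = x \<otimes>\<^bsub>?S\<^esub> (y \<otimes>\<^bsub>?S\<^esub> z)" for x y z
      by (simp add: mult comp_assoc)
    show "x \<otimes>\<^bsub>?S\<^esub> y = y \<otimes>\<^bsub>?S\<^esub> x"
      if xy: "x \<in> carrier ?S" "y \<in> carrier ?S" for x y
    proof -
      obtain a b a' b' where *: "x = pauli N a b" "y = pauli N a' b'" "a \<in> C" "b \<in> C" "a' \<in> C" "b' \<in> C"
        using xy by auto
      have "a + a' = a' + a" "b + b' = b' + b" using * carrier by (auto intro!: comm_add_vec)
      then show ?thesis using comp[of a b a' b'] comp[of a' b' a b] * by (simp add: mult)
    qed
    show "\<one>\<^bsub>?S\<^esub> \<otimes>\<^bsub>?S\<^esub> x = x"
      if "x \<in> carrier ?S" for x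
      using one_left[of x] that sub by (simp add: mult subset_iff)
    show "\<exists>y\<in>carrier ?S.
        y \<otimes>\<^bsub>?S\<^esub> x = \<one>\<^bsub>?S\<^esub>"
      if x: "x \<in> carrier ?S" for x
    proof -
      obtain a b where *: "x = pauli N a b" "a \<in> C" "b \<in> C" using x by auto
      then have "pauli N (- a) (- b) \<in> stabilizer" using uminus by blast
      then show ?thesis using inv_comp(2)[OF *(2,3)] *(1) by (auto simp: mult)
    qed
  qed
  with subgroup show ?thesis unfolding is_stabilizer_code_def by blast
qed

text \<open>The operators \<open>Z(b)\<close> force the support of a fixed state into the dual code, and the operators
  \<open>X(a)\<close> make it constant on the cosets of the code.\<close>

lemma code_space_iff:
  "\<psi> \<in> code_space \<longleftrightarrow>
    (\<forall>w. w \<notin> dual \<longrightarrow> \<psi> w = 0) \<and> (\<forall>w\<in>carrier_vec N. \<forall>a\<in>C. \<psi> (w + a) = \<psi> w)"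
proof
  assume \<psi>: "\<psi> \<in> code_space"
  then have fix_ab: "pauli N a b \<psi> = \<psi>" if "a \<in> C" "b \<in> C" for a b
    using that by (auto simp: joint_fixed_space_def)
  have st: "\<psi> w = 0" if "w \<notin> carrier_vec N" for w
    using \<psi> that by (auto simp: joint_fixed_space_def states_def)
  have "\<psi> w = 0" if w: "w \<notin> dual" "w \<in> carrier_vec N" for w
  proof -
    obtain u where u: "u \<in> C" "add_char (w \<bullet> u) \<noteq> 1" using ex_char_nontrivial w by blast
    have "\<psi> w = add_char (u \<bullet> w) * \<psi> w"
      using fun_cong[OF fix_ab[OF zero u(1)], of w] w(2) by (simp add: pauli_def)
    then have "(add_char (w \<bullet> u) - 1) * \<psi> w = 0"
      using comm_scalar_prod[OF w(2) carrier[OF u(1)]] by (simp add: algebra_simps)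
    then show ?thesis using u(2) by simp
  qed
  moreover have "\<psi> (w + a) = \<psi> w" if "w \<in> carrier_vec N" "a \<in> C" for w a
  proof -
    have c: "w + a \<in> carrier_vec N" "w + a - a = w" using that carrier[OF that(2)] by auto
    show ?thesis using fun_cong[OF fix_ab[OF that(2) zero], of "w + a"] c that(1)
      by (simp add: pauli_def add_char_0[OF card])
  qed
  ultimately show "(\<forall>w. w \<notin> dual \<longrightarrow> \<psi> w = 0) \<and> (\<forall>w\<in>carrier_vec N. \<forall>a\<in>C. \<psi> (w + a) = \<psi> w)"
    using st by blast
next
  assume A: "(\<forall>w. w \<notin> dual \<longrightarrow> \<psi> w = 0) \<and> (\<forall>w\<in>carrier_vec N. \<forall>a\<in>C. \<psi> (w + a) = \<psi> w)"
  have "pauli N a b \<psi> = \<psi>" if ab: "a \<in> C" "b \<in> C" for a b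
  proof
    fix w
    show "pauli N a b \<psi> w = \<psi> w"
    proof (cases "w \<in> carrier_vec N")
      case w: True
      have a: "a \<in> carrier_vec N" using carrier ab by simp
      have wa: "w - a \<in> carrier_vec N" "w - a + a = w" using w a by auto
      have eq: "\<psi> (w - a) = \<psi> w" using A wa ab(1) by metis
      have "add_char (b \<bullet> (w - a)) * \<psi> (w - a) = \<psi> (w - a)"
      proof (cases "w - a \<in> dual")
        case True
        then have "b \<bullet> (w - a) = 0"
          using ab(2) comm_scalar_prod[OF wa(1) carrier[OF ab(2)]] by (simp add: euclidean_dual_def)
        then show ?thesis by (simp add: add_char_0[OF card])
      qed (use A in simp)
      then show ?thesis using w eq by (simp add: pauli_def)
    next
      case False
      then have "w \<notin> dual" using dual_carrier by blast
      then show ?thesis using A False by (simp add: pauli_def)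
    qed
  qed
  moreover have "\<psi> \<in> states N" using A dual_carrier by (auto simp: states_def)
  ultimately show "\<psi> \<in> code_space" by (auto simp: joint_fixed_space_def)
qed

definition coset :: "'a vec \<Rightarrow> 'a vec set" where
  "coset w = (\<lambda>a. w + a) ` C"

lemma coset_eq_iff:
  assumes "v \<in> carrier_vec N" "w \<in> carrier_vec N"
  shows "coset v = coset w \<longleftrightarrow> v \<in> coset w"
proof
  assume "coset v = coset w"
  moreover have "v \<in> coset v" unfolding coset_def using zero assms by (intro image_eqI[of _ _ "0\<^sub>v N"]) auto
  ultimately show "v \<in> coset w" by simp
next
  assume "v \<in> coset w"
  then obtain a where a: "a \<in> C" "v = w + a" by (auto simp: coset_def)
  have ac: "a \<in> carrier_vec N" using carrier a by simp
  have "v + b \<in> coset w" if "b \<in> C" for b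
    unfolding coset_def using add[OF a(1) that] a(2) ac assms carrier[OF that]
    by (intro image_eqI[of _ _ "a + b"]) auto
  moreover have "w + b \<in> coset v" if "b \<in> C" for b
    unfolding coset_def using minus[OF that a(1)] a(2) ac assms carrier[OF that]
    by (intro image_eqI[of _ _ "b - a"]) auto
  ultimately show "coset v = coset w" by (auto simp: coset_def)
qed

lemma card_coset: "w \<in> carrier_vec N \<Longrightarrow> card (coset w) = card C"
proof -
  assume w: "w \<in> carrier_vec N"
  have "inj_on (\<lambda>a. w + a) C"
  proof (rule inj_onI)
    fix a b assume ab: "a \<in> C" "b \<in> C" "w + a = w + b"
    then have c: "a \<in> carrier_vec N" "b \<in> carrier_vec N" using carrier by auto
    have "- w + (w + a) = - w + (w + b)" using ab by simp
    moreover have "- w + (w + a) = a" "- w + (w + b) = b"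
      using w c by (auto simp flip: assoc_add_vec[of "-w" N])
    ultimately show "a = b" by simp
  qed
  then show ?thesis unfolding coset_def by (rule card_image)
qed

lemma finite_dual: "finite dual"
  using finite_carrier_vec dual_carrier by (meson finite_subset subsetI)

lemma coset_subset_dual: "w \<in> dual \<Longrightarrow> coset w \<subseteq> dual"
  using self_orthogonal dual_add by (auto simp: coset_def)

lemma self_in_coset: "w \<in> carrier_vec N \<Longrightarrow> w \<in> coset w"
  using coset_eq_iff by blast

lemma card_cosets: "card C * card (coset ` dual) = card dual"
proof -
  have U: "\<Union>(coset ` dual) = dual"
    using coset_subset_dual self_in_coset dual_carrier by blast
  have "card C * card (coset ` dual) = card (\<Union>(coset ` dual))"
  proof (rule card_partition)
    show "finite (coset ` dual)" "finite (\<Union>(coset ` dual))" unfolding U using finite_dual by auto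
    show "card c = card C" if "c \<in> coset ` dual" for c
      using that card_coset dual_carrier by auto
    show "c1 \<inter> c2 = {}" if c: "c1 \<in> coset ` dual" "c2 \<in> coset ` dual" "c1 \<noteq> c2" for c1 c2
    proof (rule ccontr)
      assume "c1 \<inter> c2 \<noteq> {}"
      then obtain v where v: "v \<in> c1" "v \<in> c2" by blast
      obtain w1 w2 where w: "w1 \<in> dual" "c1 = coset w1" "w2 \<in> dual" "c2 = coset w2" using c by auto
      have "v \<in> carrier_vec N" using v(1) w coset_subset_dual dual_carrier by blast
      then have "coset v = c1" "coset v = c2" using v w coset_eq_iff dual_carrier by auto
      then show False using c(3) by simp
    qed
  qed
  then show ?thesis by (simp add: U)
qed

text \<open>The cosets are disjoint: at the word \<open>w\<close> only the indicator of its own coset contributes.\<close>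

lemma coset_expansion:
  assumes w: "w \<in> dual" and X: "coset w \<in> \<X>" "\<X> \<subseteq> coset ` dual"
  shows "(\<Sum>x\<in>indicator_state ` \<X>. state_scale (f x) x) w = f (indicator_state (coset w))"
proof -
  have fin: "finite \<X>" using X(2) finite_dual finite_surj by blast
  have inj: "inj_on indicator_state \<X>" using inj_indicator_state inj_on_subset by blast
  have mem: "w \<in> Y \<longleftrightarrow> Y = coset w" if "Y \<in> \<X>" for Y
    using that X(2) coset_eq_iff[OF dual_carrier[OF w]] dual_carrier by auto
  have ap: "sum g A w = (\<Sum>x\<in>A. g x w)" for g :: "'a state \<Rightarrow> 'a state" and A
    by (induction A rule: infinite_finite_induct) auto
  have "(\<Sum>x\<in>indicator_state ` \<X>. state_scale (f x) x) w
      = (\<Sum>Y\<in>\<X>. f (indicator_state Y) * indicator_state Y w)"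
    unfolding ap by (simp add: sum.reindex[OF inj] state_scale_def)
  also have "\<dots> = (\<Sum>Y\<in>\<X>. if Y = coset w then f (indicator_state Y) else 0)"
    by (rule sum.cong) (auto simp: indicator_state_def mem)
  also have "\<dots> = f (indicator_state (coset w))" using fin X(1) by (simp add: sum.delta)
  finally show ?thesis .
qed

text \<open>The indicator functions of the cosets of the code in its dual form a basis of the fixed space.\<close>

lemma dim_code_space: "vector_space.dim state_scale code_space = card (coset ` dual)"
proof -
  interpret vs: vector_space "state_scale :: complex \<Rightarrow> 'a state \<Rightarrow> 'a state"
    by (rule vector_space_state)
  let ?B = "indicator_state ` coset ` dual"
  have in_coset: "w + a \<in> coset v \<longleftrightarrow> w \<in> coset v"
    if "w \<in> carrier_vec N" "a \<in> C" "v \<in> carrier_vec N" for w a v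
  proof -
    have "w + a \<in> coset w" using that by (auto simp: coset_def)
    then have "coset (w + a) = coset w" using that carrier coset_eq_iff[of "w + a" w] by simp
    then show ?thesis using that carrier coset_eq_iff[of "w + a" v] coset_eq_iff[of w v] by simp
  qed
  have "vs.dim code_space = card (coset ` dual)"
  proof (rule vs.dim_unique)
    show "?B \<subseteq> code_space"
    proof
      fix \<psi> assume "\<psi> \<in> ?B"
      then obtain v where v: "v \<in> dual" "\<psi> = indicator_state (coset v)" by blast
      show "\<psi> \<in> code_space" unfolding code_space_iff v(2) indicator_state_def
        using coset_subset_dual[OF v(1)] in_coset dual_carrier[OF v(1)] by auto
    qed
    show "code_space \<subseteq> vs.span ?B"
    proof
      fix \<psi> assume \<psi>: "\<psi> \<in> code_space"
      define f where "f x = \<psi> (SOME v. v \<in> dual \<and> x = indicator_state (coset v))" for x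
      have f: "f (indicator_state (coset w)) = \<psi> w" if w: "w \<in> dual" for w
      proof -
        define v where "v = (SOME v. v \<in> dual \<and> indicator_state (coset w) = indicator_state (coset v))"
        have v: "v \<in> dual \<and> indicator_state (coset w) = indicator_state (coset v)"
          unfolding v_def by (rule someI[of _ w]) (use w in simp)
        then have "w \<in> coset v"
          using w coset_eq_iff[of w v] dual_carrier inj_indicator_state by (metis injD)
        then obtain a where "a \<in> C" "w = v + a" by (auto simp: coset_def)
        then have "\<psi> w = \<psi> v" using \<psi> v dual_carrier unfolding code_space_iff by metis
        then show ?thesis by (simp add: f_def v_def)
      qed
      have "\<psi> = (\<Sum>x\<in>?B. state_scale (f x) x)"
      proof
        fix w
        show "\<psi> w = (\<Sum>x\<in>?B. state_scale (f x) x) w"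
        proof (cases "w \<in> dual")
          case True
          then show ?thesis using coset_expansion[OF True, of "coset ` dual" f] f by simp
        next
          case False
          have ap: "sum g A w = (\<Sum>x\<in>A. g x w)" for g :: "'a state \<Rightarrow> 'a state" and A
            by (induction A rule: infinite_finite_induct) auto
          have "state_scale (f x) x w = 0" if x: "x \<in> ?B" for x
          proof -
            obtain v where "v \<in> dual" "x = indicator_state (coset v)" using x by blast
            then show ?thesis using False coset_subset_dual[of v]
              by (auto simp: state_scale_def indicator_state_def)
          qed
          then have "(\<Sum>x\<in>?B. state_scale (f x) x) w = 0" unfolding ap by (intro sum.neutral) auto
          moreover have "\<psi> w = 0" using False \<psi> unfolding code_space_iff by blast
          ultimately show ?thesis by simp
        qed
      qed
      moreover have "(\<Sum>x\<in>?B. state_scale (f x) x) \<in> vs.span ?B"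
        by (intro vs.span_sum vs.span_scale vs.span_base)
      ultimately show "\<psi> \<in> vs.span ?B" by simp
    qed
    show "vs.independent ?B"
    proof (rule vs.independent_if_scalars_zero)
      show "finite ?B" using finite_dual by simp
      fix f x assume 0: "(\<Sum>x\<in>?B. state_scale (f x) x) = 0" and "x \<in> ?B"
      then obtain w where w: "w \<in> dual" "x = indicator_state (coset w)" by blast
      show "f x = 0" using coset_expansion[OF w(1), of "coset ` dual" f] 0 w by simp
    qed
    show "card ?B = card (coset ` dual)"
      by (rule card_image) (use inj_indicator_state inj_on_subset in blast)
  qed
  then show ?thesis .
qed

text \<open>An error \<open>X(a) Z(b)\<close> outside the normaliser of the stabilizer maps the code space to an
  orthogonal one; the only error of small weight in the normaliser is the identity.\<close>

lemma min_distance_code_space: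
  assumes dist: "\<And>v. v \<in> dual \<Longrightarrow> v \<noteq> 0\<^sub>v N \<Longrightarrow> d \<le> card {i. i < N \<and> v $ i \<noteq> 0}"
  shows "min_distance_ge N code_space d"
  unfolding min_distance_ge_def
proof (intro ballI impI)
  fix a b :: "'a vec"
  assume a: "a \<in> carrier_vec N" and b: "b \<in> carrier_vec N" and wt: "pauli_weight N a b < d"
  let ?V = "carrier_vec N :: 'a vec set"
  have zero_if: "v = 0\<^sub>v N" if "v \<in> dual" "{i. i < N \<and> v $ i \<noteq> 0} \<subseteq> {i. i < N \<and> (a $ i \<noteq> 0 \<or> b $ i \<noteq> 0)}"
    for v :: "'a vec"
  proof (rule ccontr)
    assume "v \<noteq> 0\<^sub>v N"
    then have "d \<le> card {i. i < N \<and> v $ i \<noteq> 0}" using dist that(1) by blast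
    also have "\<dots> \<le> pauli_weight N a b" unfolding pauli_weight_def using that(2) by (intro card_mono) auto
    finally show False using wt by simp
  qed
  consider "a \<in> dual" "b \<in> dual" | "a \<notin> dual" | "b \<notin> dual" by blast
  then show "\<exists>s. \<forall>\<phi>\<in>code_space. \<forall>\<psi>\<in>code_space.
      state_inner N \<phi> (pauli N a b \<psi>) = s * state_inner N \<phi> \<psi>"
  proof cases
    case 1
    have a0: "a = 0\<^sub>v N" and b0: "b = 0\<^sub>v N" by (rule zero_if; use 1 in auto)+
    have "state_inner N \<phi> (pauli N a b \<psi>) = 1 * state_inner N \<phi> \<psi>" for \<phi> \<psi>
      unfolding state_inner_def a0 b0 mult_1
      by (rule sum.cong) (auto simp: pauli_def add_char_0[OF card])
    then show ?thesis by blast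
  next
    case 2
    have "state_inner N \<phi> (pauli N a b \<psi>) = 0 * state_inner N \<phi> \<psi>"
      if \<phi>: "\<phi> \<in> code_space" and \<psi>: "\<psi> \<in> code_space" for \<phi> \<psi>
    proof -
      have "cnj (\<phi> w) * pauli N a b \<psi> w = 0" if w: "w \<in> ?V" for w
      proof (cases "w \<in> dual \<and> w - a \<in> dual")
        case True
        then have "w - (w - a) \<in> dual" using dual_minus by blast
        moreover have "w - (w - a) = a" using a w by auto
        ultimately show ?thesis using 2 by simp
      next
        case False
        then show ?thesis using \<phi> \<psi> w unfolding code_space_iff by (auto simp: pauli_def)
      qed
      then have "state_inner N \<phi> (pauli N a b \<psi>) = 0"
        unfolding state_inner_def by (intro sum.neutral) blast
      then show ?thesis by simp
    qed
    then show ?thesis by blast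
  next
    case 3
    obtain u where u: "u \<in> C" "add_char (b \<bullet> u) \<noteq> 1" using ex_char_nontrivial[OF b 3] by blast
    have uc: "u \<in> ?V" using carrier u by simp
    interpret V: linear_code N ?V r by (rule linear_code_carrier_vec[OF card])
    have "state_inner N \<phi> (pauli N a b \<psi>) = 0 * state_inner N \<phi> \<psi>"
      if \<phi>: "\<phi> \<in> code_space" and \<psi>: "\<psi> \<in> code_space" for \<phi> \<psi>
    proof -
      have "(\<Sum>w\<in>?V. cnj (\<phi> w) * pauli N a b \<psi> w) = 0"
      proof (rule sum_eq_0_if_rescaled[OF V.translate_bij[OF uc] _ u(2)])
        fix w assume w: "w \<in> ?V"
        have e: "w + u - a = (w - a) + u" using a uc w by auto
        have "\<phi> (w + u) = \<phi> w" using \<phi> w u(1) unfolding code_space_iff by blast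
        moreover have "\<psi> (w - a + u) = \<psi> (w - a)" using \<psi> a w u(1) unfolding code_space_iff by simp
        moreover have "add_char (b \<bullet> (w - a + u)) = add_char (b \<bullet> (w - a)) * add_char (b \<bullet> u)"
          using a b uc w by (intro char_scalar_add) auto
        ultimately show "cnj (\<phi> (w + u)) * pauli N a b \<psi> (w + u)
            = add_char (b \<bullet> u) * (cnj (\<phi> w) * pauli N a b \<psi> w)"
          using w uc by (simp add: pauli_def e)
      qed
      then show ?thesis by (simp add: state_inner_def)
    qed
    then show ?thesis by blast
  qed
qed

text \<open>By \<open>card_code_times_dual\<close>, a code with \<open>Q^k'\<close> words has index \<open>Q^(N - 2k')\<close> in its dual.\<close>

theorem quantum_code_from_self_orthogonal:
  assumes cardC: "card C = CARD('a) ^ k'"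
    and dist: "\<And>v. v \<in> dual \<Longrightarrow> v \<noteq> 0\<^sub>v N \<Longrightarrow> d \<le> card {i. i < N \<and> v $ i \<noteq> 0}"
  shows "obtained_from code_space N C" and "quantum_code code_space N (N - 2 * k') d"
proof -
  show "obtained_from code_space N C"
    unfolding obtained_from_def using self_orthogonal by simp
  let ?Q = "CARD('a)"
  have Q: "?Q > 1" by (rule card_gt_1)
  have "?Q ^ k' * (?Q ^ k' * card (coset ` dual)) = ?Q ^ N"
    using card_cosets card_code_times_dual cardC by simp
  moreover have "?Q ^ (2 * k') = ?Q ^ k' * ?Q ^ k'" by (simp add: mult_2 power_add)
  ultimately have eq: "?Q ^ (2 * k') * card (coset ` dual) = ?Q ^ N" by (simp add: mult.assoc)
  then have "?Q ^ (2 * k') dvd ?Q ^ N" by (metis dvd_triv_left)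
  then have le: "2 * k' \<le> N" using Q by (simp add: dvd_power_iff_le)
  then have "?Q ^ N = ?Q ^ (2 * k') * ?Q ^ (N - 2 * k')" by (simp flip: power_add)
  then have "card (coset ` dual) = ?Q ^ (N - 2 * k')" using eq Q by simp
  then show "quantum_code code_space N (N - 2 * k') d"
    unfolding quantum_code_def
    using stabilizer_is_stabilizer_code dim_code_space min_distance_code_space[OF dist] by simp
qed

end

section \<open>Valuation rings\<close>

definition subring_set :: "'f::field set \<Rightarrow> bool" where
  "subring_set S \<longleftrightarrow> 1 \<in> S \<and> (\<forall>u\<in>S. \<forall>v\<in>S. u - v \<in> S \<and> u * v \<in> S)"

definition subfield_set :: "'f::field set \<Rightarrow> bool" where
  "subfield_set K \<longleftrightarrow> subring_set K \<and> (\<forall>u\<in>K. inverse u \<in> K)"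

lemma subring_setD:
  fixes S :: "'f::field set"
  assumes "subring_set S"
  shows "1 \<in> S" "0 \<in> S"
    "\<And>u v. u \<in> S \<Longrightarrow> v \<in> S \<Longrightarrow> u - v \<in> S" "\<And>u v. u \<in> S \<Longrightarrow> v \<in> S \<Longrightarrow> u * v \<in> S"
    "\<And>u. u \<in> S \<Longrightarrow> - u \<in> S" "\<And>u v. u \<in> S \<Longrightarrow> v \<in> S \<Longrightarrow> u + v \<in> S"
    "\<And>u n. u \<in> S \<Longrightarrow> u ^ n \<in> S"
    "\<And>f I. (\<And>i. i \<in> I \<Longrightarrow> f i \<in> S) \<Longrightarrow> (\<Sum>i\<in>I. f i) \<in> S"
proof -
  show one: "1 \<in> S" using assms by (simp add: subring_set_def)
  have d: "u - v \<in> S" if "u \<in> S" "v \<in> S" for u v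
    using assms that by (auto simp: subring_set_def)
  have m: "u * v \<in> S" if "u \<in> S" "v \<in> S" for u v
    using assms that by (auto simp: subring_set_def)
  have zero: "0 \<in> S" using d[of 1 1] one by simp
  have n: "- u \<in> S" if "u \<in> S" for u using d[OF zero that] by simp
  have a: "u + v \<in> S" if "u \<in> S" "v \<in> S" for u v using d[OF that(1) n[OF that(2)]] by simp
  show "0 \<in> S" by (rule zero)
  show "u - v \<in> S" "u * v \<in> S" "u + v \<in> S" if "u \<in> S" "v \<in> S" for u v
    using that d m a by blast+
  show "- u \<in> S" if "u \<in> S" for u by (rule n) fact
  show "u ^ n \<in> S" if "u \<in> S" for u n
    using that one m by (induction n) auto
  show "(\<Sum>i\<in>I. f i) \<in> S" if "\<And>i. i \<in> I \<Longrightarrow> f i \<in> S" for f :: "'b \<Rightarrow> 'f" and I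
    using that zero a by (induction I rule: infinite_finite_induct) auto
qed

lemma subring_poly:
  assumes "subring_set S" "\<And>i. coeff P i \<in> S" "z \<in> S"
  shows "poly P z \<in> S"
  unfolding poly_altdef using assms(2,3)
  by (intro subring_setD(8)[OF assms(1)] subring_setD(4)[OF assms(1)] subring_setD(7)[OF assms(1)])

text \<open>The ring \<open>S[z]\<close>, for a subring \<open>S\<close>.\<close>

definition adjoin :: "'f::field set \<Rightarrow> 'f \<Rightarrow> 'f set" where
  "adjoin S z = {poly P z | P. \<forall>i. coeff P i \<in> S}"

lemma adjoin:
  assumes S: "subring_set S"
  shows "subring_set (adjoin S z)" "S \<subseteq> adjoin S z" "z \<in> adjoin S z"
proof -
  note s = subring_setD[OF S]
  show "S \<subseteq> adjoin S z"
  proof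
    fix u assume "u \<in> S"
    then show "u \<in> adjoin S z" unfolding adjoin_def
      using s(2) by (intro CollectI exI[of _ "[:u:]"]) (auto simp: coeff_pCons split: nat.split)
  qed
  then have "1 \<in> adjoin S z" using s(1) by blast
  moreover have "u - v \<in> adjoin S z \<and> u * v \<in> adjoin S z"
    if uv: "u \<in> adjoin S z" "v \<in> adjoin S z" for u v
  proof -
    obtain P Q where P: "u = poly P z" "\<forall>i. coeff P i \<in> S" and Q: "v = poly Q z" "\<forall>i. coeff Q i \<in> S"
      using uv by (auto simp: adjoin_def)
    have "\<forall>i. coeff (P - Q) i \<in> S" using P Q s(3) by simp
    then have "u - v \<in> adjoin S z" unfolding adjoin_def P(1) Q(1)
      by (intro CollectI exI[of _ "P - Q"]) simp
    moreover have "\<forall>i. coeff (P * Q) i \<in> S" using P Q s(4) by (auto simp: coeff_mult intro!: s(8))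
    then have "u * v \<in> adjoin S z" unfolding adjoin_def P(1) Q(1)
      by (intro CollectI exI[of _ "P * Q"]) simp
    ultimately show ?thesis by simp
  qed
  ultimately show "subring_set (adjoin S z)" by (simp add: subring_set_def)
  show "z \<in> adjoin S z" unfolding adjoin_def
    using s(1,2) by (intro CollectI exI[of _ "[:0,1:]"]) (auto simp: coeff_pCons split: nat.split)
qed

lemma adjoin_subset:
  assumes "subring_set K" "S \<subseteq> K" "z \<in> K"
  shows "adjoin S z \<subseteq> K"
  using assms by (auto simp: adjoin_def intro!: subring_poly[OF assms(1)])

text \<open>Multiplication by a sufficiently high power of \<open>s\<close> clears the denominators of an element of
  \<open>S[1/s]\<close>.\<close>

lemma adjoin_inverse_cases:
  fixes s :: "'f::field"
  assumes "h \<in> adjoin S (inverse s)" and "s \<noteq> 0"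
  obtains n c where "\<And>i. c i \<in> S" "s ^ n * h = (\<Sum>i\<le>n. c i * s ^ (n - i))"
proof -
  obtain P where P: "h = poly P (inverse s)" "\<And>i. coeff P i \<in> S" using assms(1) by (auto simp: adjoin_def)
  have "s ^ degree P * h = (\<Sum>i\<le>degree P. coeff P i * (s ^ degree P * inverse s ^ i))"
    unfolding P(1) poly_altdef by (simp add: sum_distrib_left mult_ac)
  also have "\<dots> = (\<Sum>i\<le>degree P. coeff P i * s ^ (degree P - i))"
    using assms(2) by (intro sum.cong) (auto simp: power_diff field_simps)
  finally show thesis using that[of "coeff P" "degree P"] P(2) by blast
qed

text \<open>A subring \<open>R\<close> of a field \<open>K\<close> that is maximal among those avoiding \<open>h\<close>, where \<open>t = 1/h\<close> lies in
  \<open>R\<close>, is a valuation ring. If neither \<open>z\<close> nor \<open>1/z\<close> were in \<open>R\<close>, both \<open>R[z]\<close> and \<open>R[1/z]\<close> would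
  contain \<open>h\<close>, which gives equations expressing \<open>1\<close> as a polynomial in \<open>z\<close> and in \<open>1/z\<close> with
  coefficients in \<open>tR\<close>. As \<open>1 - tR\<close> consists of units, the shorter equation can be used to shorten
  the longer one.\<close>

locale maximal_avoiding =
  fixes R K :: "'f::field set" and h :: 'f
  assumes R: "subring_set R" and K: "subring_set K" "R \<subseteq> K"
    and h: "h \<notin> R" "inverse h \<in> R"
    and maximal: "\<And>S. subring_set S \<Longrightarrow> R \<subseteq> S \<Longrightarrow> S \<subseteq> K \<Longrightarrow> h \<notin> S \<Longrightarrow> S = R"
begin

abbreviation "t \<equiv> inverse h"

lemma h_nonzero: "h \<noteq> 0" using h subring_setD(2)[OF R] by auto

lemma mem_adjoin: "z \<in> K \<Longrightarrow> z \<notin> R \<Longrightarrow> h \<in> adjoin R z"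
  using maximal[of "adjoin R z"] adjoin[OF R, of z] adjoin_subset[OF K] by blast

text \<open>Otherwise the localisation of \<open>R\<close> at \<open>s = 1 - tu\<close> contains \<open>h\<close>, so that \<open>s^n h\<close> lies in \<open>R\<close> for
  some \<open>n\<close>. But \<open>s^n \<in> 1 + tR\<close>, and so \<open>h - s^n h\<close> lies in \<open>R\<close> as well.\<close>

lemma one_minus_unit:
  assumes "u \<in> R" and "inverse (1 - t * u) \<in> K"
  shows "inverse (1 - t * u) \<in> R"
proof (rule ccontr)
  define s where "s = 1 - t * u"
  assume nR: "inverse (1 - t * u) \<notin> R"
  note r = subring_setD[OF R]
  have s: "s \<in> R" unfolding s_def by (intro r(1,3,4) assms(1) h(2))
  have "s \<noteq> 0" using nR r(2) by (auto simp: s_def)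
  have "h \<in> adjoin R (inverse s)" using mem_adjoin[of "inverse s"] assms(2) nR by (simp add: s_def)
  then obtain n c where c: "\<And>i. c i \<in> R" "s ^ n * h = (\<Sum>i\<le>n. c i * s ^ (n - i))"
    using \<open>s \<noteq> 0\<close> by (rule adjoin_inverse_cases) blast
  have 1: "s ^ n * h \<in> R" unfolding c(2) by (intro r(8) r(4) r(7) s c(1))
  have "\<exists>v\<in>R. s ^ i = 1 - t * v" for i
  proof (induction i)
    case (Suc i)
    then obtain v where v: "v \<in> R" "s ^ i = 1 - t * v" by blast
    have "s ^ Suc i = s - t * (s * v)" unfolding power_Suc v(2) by (simp add: algebra_simps)
    also have "\<dots> = 1 - t * (u + s * v)" by (simp add: s_def algebra_simps)
    finally have "s ^ Suc i = 1 - t * (u + s * v)" .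
    moreover have "u + s * v \<in> R" by (intro r(6) r(4) assms(1) v(1) s)
    ultimately show ?case by blast
  qed (use r(2) in \<open>auto intro!: bexI[of _ 0]\<close>)
  then obtain v where v: "v \<in> R" "s ^ n = 1 - t * v" by blast
  have "s ^ n * h = h - v" unfolding v(2) using h_nonzero by (simp add: algebra_simps)
  then have "h = s ^ n * h + v" by simp
  then have "h \<in> R" using r(6)[OF 1 v(1)] by simp
  then show False using h by simp
qed

definition short_eq :: "'f \<Rightarrow> nat \<Rightarrow> bool" where
  "short_eq z n \<longleftrightarrow> (\<exists>c. (\<forall>i. c i \<in> R) \<and> (\<Sum>i\<le>n. t * c i * z ^ i) = 1)"

text \<open>After division by the unit \<open>1 - t d\<^sub>0\<close>, the second equation expresses \<open>z^n\<close> by lower powers of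
  \<open>z\<close>.\<close>

lemma shorten:
  assumes K': "\<And>u. u \<in> K \<Longrightarrow> inverse u \<in> K"
    and z: "z \<noteq> 0" and eqs: "short_eq z n" "short_eq (inverse z) m" and le: "m \<le> n"
  shows "n > 0 \<and> short_eq z (n - 1)"
proof -
  note r = subring_setD[OF R]
  obtain c where c: "\<And>i. c i \<in> R" "(\<Sum>i\<le>n. t * c i * z ^ i) = 1" using eqs(1) by (auto simp: short_eq_def)
  obtain d where d: "\<And>i. d i \<in> R" "(\<Sum>i\<le>m. t * d i * inverse z ^ i) = 1" using eqs(2) by (auto simp: short_eq_def)
  have n: "n > 0"
  proof (rule ccontr)
    assume "\<not> n > 0"
    then have "t * c 0 = 1" using c(2) by simp
    then have "h = c 0" using h_nonzero by (metis mult.commute mult.right_neutral mult.assoc right_inverse)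
    then show False using h c(1)[of 0] by simp
  qed
  define v where "v = inverse (1 - t * d 0)"
  have "1 - t * d 0 \<in> R" by (intro r h d)
  then have v: "v \<in> R" unfolding v_def using K(2) K' by (intro one_minus_unit d(1)) blast
  have nz: "1 - t * d 0 \<noteq> 0"
  proof
    assume "1 - t * d 0 = 0"
    then have "h = d 0" using h_nonzero by (simp add: field_simps)
    then show False using h d(1)[of 0] by simp
  qed
  have "(\<Sum>i\<le>m. t * d i * inverse z ^ i) = t * d 0 + (\<Sum>i=1..m. t * d i * inverse z ^ i)"
    by (simp add: atMost_atLeast0 sum.atLeast_Suc_atMost[of 0])
  then have "(\<Sum>i=1..m. t * d i * inverse z ^ i) = 1 - t * d 0" using d(2) by (metis add_diff_cancel_left')
  then have "z ^ n * (v * (\<Sum>i=1..m. t * d i * inverse z ^ i)) = z ^ n"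
    using nz by (simp add: v_def)
  moreover have "z ^ n * (v * (t * d i * inverse z ^ i)) = t * (v * d i) * z ^ (n - i)" if "i \<le> m" for i
  proof -
    have "z ^ n = z ^ (n - i) * z ^ i" using that le by (simp flip: power_add)
    moreover have "z ^ i * inverse z ^ i = 1" using z by (simp add: power_inverse)
    ultimately show ?thesis by (simp add: mult_ac)
  qed
  ultimately have zn: "z ^ n = (\<Sum>i=1..m. t * (v * d i) * z ^ (n - i))"
    by (simp add: sum_distrib_left)
  \<comment> \<open>Reindexing by \<open>j = n - i\<close>; the range \<open>n - m \<le> j < n\<close> is extended by zeros.\<close>
  define d' where "d' j = (if n - m \<le> j then v * d (n - j) else 0)" for j
  have "(\<Sum>i=1..m. t * (v * d i) * z ^ (n - i)) = (\<Sum>j\<in>{n-m..n-1}. t * d' j * z ^ j)"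
    by (rule sum.reindex_bij_witness[of _ "\<lambda>j. n - j" "\<lambda>i. n - i"]) (use le n in \<open>auto simp: d'_def\<close>)
  also have "\<dots> = (\<Sum>j\<le>n-1. t * d' j * z ^ j)"
    by (rule sum.mono_neutral_left) (auto simp: d'_def)
  finally have zn': "z ^ n = (\<Sum>j\<le>n-1. t * d' j * z ^ j)" using zn by simp
  have d': "d' j \<in> R" for j using v d(1) r by (auto simp: d'_def)
  have "{..n} = insert n {..n - 1}" using n by auto
  then have "1 = (\<Sum>i\<le>n-1. t * c i * z ^ i) + t * c n * z ^ n"
    using c(2) n by (simp add: add.commute)
  also have "\<dots> = (\<Sum>i\<le>n-1. t * (c i + t * c n * d' i) * z ^ i)"
    unfolding zn' by (simp add: sum_distrib_left sum.distrib algebra_simps)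
  finally have "1 = (\<Sum>i\<le>n-1. t * (c i + t * c n * d' i) * z ^ i)" .
  moreover have "c i + t * c n * d' i \<in> R" for i by (intro r(6) r(4) c(1) d' h(2))
  ultimately show ?thesis using n unfolding short_eq_def
    by (intro conjI exI[of _ "\<lambda>i. c i + t * c n * d' i"]) auto
qed

lemma valuation_ring:
  assumes K': "\<And>u. u \<in> K \<Longrightarrow> inverse u \<in> K" and z: "z \<in> K"
  shows "z \<in> R \<or> inverse z \<in> R"
proof (rule ccontr)
  assume neither: "\<not> (z \<in> R \<or> inverse z \<in> R)"
  have ex: "\<exists>n. short_eq w n" if w: "w \<in> K" "w \<notin> R" for w
  proof -
    obtain P where P: "h = poly P w" "\<forall>i. coeff P i \<in> R"
      using mem_adjoin[OF w] by (auto simp: adjoin_def)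
    have "1 = t * poly P w" using P(1) h_nonzero by simp
    also have "\<dots> = (\<Sum>i\<le>degree P. t * coeff P i * w ^ i)"
      by (simp add: poly_altdef sum_distrib_left mult_ac)
    finally have "short_eq w (degree P)" unfolding short_eq_def using P(2) by metis
    then show ?thesis by blast
  qed
  have descent: "short_eq w n \<Longrightarrow> short_eq (inverse w) m \<Longrightarrow> w \<noteq> 0 \<Longrightarrow> False" for w n m
  proof (induction "n + m" arbitrary: w n m rule: less_induct)
    case less
    show False
    proof (cases "m \<le> n")
      case True
      have "n > 0 \<and> short_eq w (n - 1)"
        using shorten[OF K' less.prems(3,1,2) True] by blast
      then show False using less.hyps[of "n - 1" m w] less.prems by simp
    next
      case False
      have "m > 0 \<and> short_eq (inverse w) (m - 1)"
        using shorten[OF K', of "inverse w" m n] less.prems False by simp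
      then show False using less.hyps[of n "m - 1" w] less.prems by simp
    qed
  qed
  have "z \<noteq> 0" using neither subring_setD(2)[OF R] by auto
  then show False using descent ex[OF z] ex[OF K'[OF z]] neither by blast
qed

end

text \<open>Chevalley's extension theorem: an element that is missing from a ring containing its inverse is
  missing from a valuation ring above it.\<close>

lemma ex_valuation_ring_avoiding:
  assumes K: "subfield_set K" and B: "subring_set B" "B \<subseteq> K" and h: "h \<notin> B" "inverse h \<in> B"
  shows "\<exists>R. subring_set R \<and> B \<subseteq> R \<and> R \<subseteq> K \<and> h \<notin> R \<and> (\<forall>z\<in>K. z \<in> R \<or> inverse z \<in> R)"
proof -
  define \<A> where "\<A> = {S. subring_set S \<and> B \<subseteq> S \<and> S \<subseteq> K \<and> h \<notin> S}"
  have "\<exists>M\<in>\<A>. \<forall>S\<in>\<A>. M \<subseteq> S \<longrightarrow> S = M"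
  proof (rule subset_Zorn_nonempty)
    show "\<A> \<noteq> {}" using B h by (auto simp: \<A>_def)
    fix \<C> assume ne: "\<C> \<noteq> {}" and ch: "subset.chain \<A> \<C>"
    have mem: "S \<in> \<A>" if "S \<in> \<C>" for S using ch that by (auto simp: subset.chain_def)
    have two: "\<exists>S\<in>\<C>. u \<in> S \<and> v \<in> S" if "u \<in> \<Union>\<C>" "v \<in> \<Union>\<C>" for u v
      using that ch unfolding subset.chain_def by blast
    have "u - v \<in> \<Union>\<C> \<and> u * v \<in> \<Union>\<C>" if uv: "u \<in> \<Union>\<C>" "v \<in> \<Union>\<C>" for u v
    proof -
      obtain S where S: "S \<in> \<C>" "u \<in> S" "v \<in> S" using two[OF uv] by blast
      then have "subring_set S" using mem by (simp add: \<A>_def)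
      then show ?thesis using S subring_setD(3,4) by blast
    qed
    moreover obtain S0 where S0: "S0 \<in> \<C>" using ne by blast
    then have "1 \<in> \<Union>\<C>" "B \<subseteq> \<Union>\<C>" using mem[OF S0] subring_setD(1) by (auto simp: \<A>_def)
    ultimately have "subring_set (\<Union>\<C>)" by (simp add: subring_set_def)
    then show "\<Union>\<C> \<in> \<A>" using mem \<open>B \<subseteq> \<Union>\<C>\<close> unfolding \<A>_def by blast
  qed
  then obtain R where R0: "R \<in> \<A>" "\<And>S. S \<in> \<A> \<Longrightarrow> R \<subseteq> S \<Longrightarrow> S = R" by blast
  interpret maximal_avoiding R K h
  proof
    show "S = R" if "subring_set S" "R \<subseteq> S" "S \<subseteq> K" "h \<notin> S" for S
      using R0 that by (auto simp: \<A>_def)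
  qed (use R0(1) K h(2) in \<open>auto simp: \<A>_def subfield_set_def\<close>)
  have "\<forall>z\<in>K. z \<in> R \<or> inverse z \<in> R" using valuation_ring assms(1) by (simp add: subfield_set_def)
  then show ?thesis using R0(1) by (auto simp: \<A>_def)
qed

locale valuation_ring =
  fixes K R :: "'f::field set"
  assumes K: "subfield_set K" and R: "subring_set R" "R \<subseteq> K"
    and total: "\<And>z. z \<in> K \<Longrightarrow> z \<in> R \<or> inverse z \<in> R"
begin

abbreviation "units \<equiv> place_units R"

lemmas r = subring_setD[OF R(1)]

lemma K_inverse: "z \<in> K \<Longrightarrow> inverse z \<in> K"
  using K by (simp add: subfield_set_def)

lemma unitD: "u \<in> units \<Longrightarrow> u \<in> R" "u \<in> units \<Longrightarrow> u \<noteq> 0" "u \<in> units \<Longrightarrow> inverse u \<in> R"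
  by (auto simp: place_units_def)

lemma unit_one: "1 \<in> units" using r(1) by (simp add: place_units_def)

lemma unit_mult: "u \<in> units \<Longrightarrow> v \<in> units \<Longrightarrow> u * v \<in> units"
  using r(4) by (auto simp: place_units_def)

lemma unit_inverse: "u \<in> units \<Longrightarrow> inverse u \<in> units"
  by (auto simp: place_units_def)

lemma unit_power: "u \<in> units \<Longrightarrow> u ^ n \<in> units"
  by (induction n) (auto simp: unit_one unit_mult)

lemma unit_uminus: "u \<in> units \<Longrightarrow> - u \<in> units"
  using r(5) by (auto simp: place_units_def)

lemma unit_of_mult: "a \<in> R \<Longrightarrow> b \<in> R \<Longrightarrow> a * b \<in> units \<Longrightarrow> a \<in> units"
proof -
  assume a: "a \<in> R" and b: "b \<in> R" and ab: "a * b \<in> units"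
  then have nz: "a \<noteq> 0" "b \<noteq> 0" by (auto simp: place_units_def)
  then have "inverse a = b * inverse (a * b)" by simp
  also have "\<dots> \<in> R" using b ab r(4) unitD(3) by blast
  finally show "a \<in> units" using a nz by (simp add: place_units_def)
qed

lemma nonunit_mult: "m \<in> R - units \<Longrightarrow> a \<in> R \<Longrightarrow> m * a \<in> R - units"
  using unit_of_mult r(4) by blast

lemma nonunit_zero: "0 \<in> R - units"
  using r(2) by (auto simp: place_units_def)

text \<open>Of two nonzero elements of a valuation ring, one divides the other and hence also their sum.\<close>

lemma nonunit_add:
  assumes "a \<in> R - units" "b \<in> R - units"
  shows "a + b \<in> R - units"
proof -
  have *: "a + b \<in> R - units" if ab: "a \<in> R - units" "b \<in> R - units" "a / b \<in> R" "b \<noteq> 0" for a b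
  proof -
    have "a + b = b * (a / b + 1)" using ab(4) by (simp add: field_simps)
    then show ?thesis using nonunit_mult[OF ab(2)] r(6)[OF ab(3) r(1)] by simp
  qed
  show ?thesis
  proof (cases "a = 0 \<or> b = 0")
    case False
    have "subring_set K" using K by (simp add: subfield_set_def)
    then have "a / b \<in> K" unfolding divide_inverse
      by (rule subring_setD(4)) (use assms R(2) K_inverse in auto)
    then have "a / b \<in> R \<or> b / a \<in> R" using total[of "a / b"] by simp
    then show ?thesis using *[of a b] *[of b a] assms False by (auto simp: add.commute)
  qed (use assms in auto)
qed

lemma nonunit_uminus: "a \<in> R - units \<Longrightarrow> - a \<in> R - units"
  using unit_uminus[of "- a"] r(5)[of a] by auto

lemma nonunit_sum: "(\<And>i. i \<in> I \<Longrightarrow> f i \<in> R - units) \<Longrightarrow> (\<Sum>i\<in>I. f i) \<in> R - units"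
proof (induction I rule: infinite_finite_induct)
  case (insert i I)
  then show ?case using nonunit_add[of "f i" "\<Sum>i\<in>I. f i"] by simp
next
  case (infinite I)
  show ?case unfolding sum.infinite[OF infinite(1)] by (rule nonunit_zero)
next
  case empty
  show ?case unfolding sum.empty by (rule nonunit_zero)
qed

lemma unit_add_nonunit: "u \<in> units \<Longrightarrow> m \<in> R - units \<Longrightarrow> u + m \<in> units"
proof (rule ccontr)
  assume u: "u \<in> units" and m: "m \<in> R - units" and "u + m \<notin> units"
  then have "u + m \<in> R - units" using r(6) unitD(1) by blast
  then have "u + m + - m \<in> R - units" using nonunit_add nonunit_uminus m by blast
  then show False using u by simp
qed

lemma nonunitI: "z \<in> K \<Longrightarrow> inverse z \<notin> R \<Longrightarrow> z \<in> R - units"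
  using total by (auto simp: place_units_def)

lemma root_closed:
  assumes "z \<in> K" "z ^ n \<in> R" "n > 0"
  shows "z \<in> R"
proof (rule ccontr)
  assume z: "z \<notin> R"
  then have "inverse z \<in> R" using total assms(1) by blast
  have "z \<noteq> 0" using z r(2) by auto
  then have "z = z ^ n * inverse z ^ (n - 1)"
    using assms(3) by (cases n) (auto simp: power_inverse)
  also have "\<dots> \<in> R" by (intro r(4) r(7) assms(2) \<open>inverse z \<in> R\<close>)
  finally show False using z by simp
qed

text \<open>Of finitely many elements of pairwise distinct orders, one dominates the sum.\<close>

lemma unit_sum_of_distinct_orders:
  assumes "finite I" "inj_on w I" "i0 \<in> I" and max: "\<And>i. i \<in> I \<Longrightarrow> w i \<le> w i0"
    and t: "t \<in> R - units" and unit: "\<And>i. i \<in> I \<Longrightarrow> f i * t ^ w i \<in> units"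
  shows "(\<Sum>i\<in>I. f i) * t ^ (w i0 :: nat) \<in> units"
proof -
  have "f i * t ^ w i0 \<in> R - units" if i: "i \<in> I - {i0}" for i
  proof -
    have "w i \<noteq> w i0" using assms(2,3) i by (auto dest: inj_onD)
    then have lt: "w i < w i0" using max[of i] i by simp
    define l where "l = w i0 - w i - 1"
    have l: "w i0 = w i + Suc l" using lt by (simp add: l_def)
    have "f i * t ^ w i0 = t * (f i * t ^ w i * t ^ l)" unfolding l by (simp add: power_add mult_ac)
    moreover have "f i * t ^ w i * t ^ l \<in> R"
      by (rule r(4)[OF unitD(1)[OF unit] r(7)]) (use i t in auto)
    ultimately show ?thesis using nonunit_mult[OF t] by (simp only:)
  qed
  then have "(\<Sum>i\<in>I - {i0}. f i * t ^ w i0) \<in> R - units" by (rule nonunit_sum)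
  then have "f i0 * t ^ w i0 + (\<Sum>i\<in>I - {i0}. f i * t ^ w i0) \<in> units"
    using unit_add_nonunit unit[OF assms(3)] by blast
  also have "f i0 * t ^ w i0 + (\<Sum>i\<in>I - {i0}. f i * t ^ w i0) = (\<Sum>i\<in>I. f i) * t ^ w i0"
    using assms(1,3) by (simp add: sum.remove distrib_right sum_distrib_right)
  finally show ?thesis .
qed

end

section \<open>The function field\<close>

text \<open>A bivariate polynomial is evaluated by applying this twice: first to its coefficients, then to
  the polynomial in the second variable.\<close>

lemma poly_map_poly_hom:
  fixes \<phi> :: "'a::comm_ring_1 \<Rightarrow> 'b::comm_ring_1"
  assumes add: "\<And>u v. \<phi> (u + v) = \<phi> u + \<phi> v" and mult: "\<And>u v. \<phi> (u * v) = \<phi> u * \<phi> v"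
  shows poly_map_poly_add: "poly (map_poly \<phi> (P + Q)) a = poly (map_poly \<phi> P) a + poly (map_poly \<phi> Q) a"
    and poly_map_poly_mult: "poly (map_poly \<phi> (P * Q)) a = poly (map_poly \<phi> P) a * poly (map_poly \<phi> Q) a"
proof -
  have 0: "\<phi> 0 = 0" using add[of 0 0] by simp
  have *: "poly (map_poly \<phi> (P + Q)) a = poly (map_poly \<phi> P) a + poly (map_poly \<phi> Q) a" for P Q
  proof -
    have "map_poly \<phi> (P + Q) = map_poly \<phi> P + map_poly \<phi> Q"
      by (rule poly_eqI) (simp add: coeff_map_poly 0 add)
    then show ?thesis by simp
  qed
  then show "poly (map_poly \<phi> (P + Q)) a = poly (map_poly \<phi> P) a + poly (map_poly \<phi> Q) a" .
  have sm: "map_poly \<phi> (smult c P) = smult (\<phi> c) (map_poly \<phi> P)" for c P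
    by (rule poly_eqI) (simp add: coeff_map_poly 0 mult)
  show "poly (map_poly \<phi> (P * Q)) a = poly (map_poly \<phi> P) a * poly (map_poly \<phi> Q) a"
  proof (induction P)
    case (pCons c P)
    then show ?case by (simp add: * sm map_poly_pCons 0 algebra_simps)
  qed simp
qed

text \<open>The embedding of the polynomials in \<open>x\<close> into the function field.\<close>

definition emb :: "'a::field poly \<Rightarrow> 'a ff" where
  "emb r = to_ac (to_fract r)"

lemma emb_simps [simp]:
  "emb 0 = 0" "emb 1 = 1" "emb (r + s) = emb r + emb s" "emb (r - s) = emb r - emb s"
  "emb (- r) = - emb r" "emb (r * s) = emb r * emb s"
  by (simp_all add: emb_def)

lemma emb_eq_iff [simp]: "emb r = emb s \<longleftrightarrow> r = s"
  by (simp add: emb_def)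

lemma emb_eq_0_iff [simp]: "emb r = 0 \<longleftrightarrow> r = 0"
  by (simp add: emb_def)

lemma emb_power [simp]: "emb (r ^ n) = emb r ^ n"
  by (induction n) simp_all

lemma const_eq_emb: "const c = emb [:c:]"
  by (simp add: const_def emb_def)

lemma x_gen_eq_emb: "x_gen = emb [:0, 1:]"
  by (simp add: x_gen_def emb_def)

lemma const_add: "const (u + v) = const u + const v"
  and const_mult: "const (u * v) = const u * const v"
  and const_eq_0_iff: "const u = 0 \<longleftrightarrow> u = 0"
  and const_0: "const 0 = 0" and const_1: "const 1 = 1"
  by (simp_all add: const_eq_emb flip: emb_simps)

lemma const_inverse: "const (inverse c) = inverse (const c)"
proof (cases "c = 0")
  case False
  then have "const c * const (inverse c) = 1" by (simp add: const_1 flip: const_mult)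
  then show ?thesis by (rule inverse_unique[symmetric])
qed (simp add: const_0)

lemma subring_range_const: "subring_set (range (const :: 'a::field \<Rightarrow> 'a ff))"
  unfolding subring_set_def
proof (intro conjI ballI)
  show "1 \<in> range (const :: 'a \<Rightarrow> 'a ff)" using rangeI[of const "1 :: 'a"] by (simp only: const_1)
  fix u v :: "'a ff" assume "u \<in> range const" "v \<in> range const"
  then obtain c d where "u = const c" "v = const d" by blast
  then have "u - v = const (c - d)" "u * v = const (c * d)"
    by (simp_all add: const_mult const_eq_emb flip: emb_simps)
  then show "u - v \<in> range const" "u * v \<in> range const" by blast+
qed

lemma poly_const_x_gen: "poly (map_poly const r) x_gen = emb r"
proof (induction r)
  case (pCons c r)
  have "emb (pCons c r) = emb ([:c:] + [:0, 1:] * r)" by simp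
  also have "\<dots> = const c + x_gen * emb r" unfolding emb_simps const_eq_emb x_gen_eq_emb ..
  finally show ?case using pCons by (simp add: map_poly_pCons const_0)
qed (simp add: const_0)

text \<open>\<open>ev y A\<close> is the value of the bivariate polynomial \<open>A\<close> at the generic point.\<close>

definition ev :: "'a::field ff \<Rightarrow> 'a poly poly \<Rightarrow> 'a ff" where
  "ev y A = poly (map_poly emb A) y"

lemma eval2_generic: "eval2 const A x_gen y = ev y A"
  by (simp add: eval2_def ev_def poly_const_x_gen)

lemma ev_add: "ev y (A + B) = ev y A + ev y B" and ev_mult: "ev y (A * B) = ev y A * ev y B"
  unfolding ev_def by (rule poly_map_poly_hom; simp)+

lemma ev_pCons: "ev y (pCons c A) = emb c + y * ev y A"
  by (simp add: ev_def map_poly_pCons)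

lemma ev_0 [simp]: "ev y 0 = 0" and ev_1 [simp]: "ev y 1 = 1"
  by (simp_all add: ev_def)

lemma ev_const: "ev y [:r:] = emb r" and ev_y: "ev y [:0, 1:] = y"
  by (simp_all add: ev_pCons)

lemma ev_smult: "ev y (smult c A) = emb c * ev y A"
  using ev_mult[of y "[:c:]" A] by (simp add: ev_const)

lemma ev_uminus: "ev y (- A) = - ev y A"
  using ev_smult[of y "-1" A] by simp

lemma ev_diff: "ev y (A - B) = ev y A - ev y B"
  using ev_add[of y A "- B"] by (simp add: ev_uminus)

lemma ev_power: "ev y (A ^ n) = ev y A ^ n"
  by (induction n) (simp_all add: ev_mult)

lemma ev_pcompose: "ev y (pcompose A B) = poly (map_poly emb A) (ev y B)"
  by (induction A) (simp_all add: pcompose_pCons ev_add ev_mult ev_const map_poly_pCons)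

lemma function_field_iff: "h \<in> function_field y \<longleftrightarrow> (\<exists>A B. ev y B \<noteq> 0 \<and> h = ev y A / ev y B)"
  by (auto simp: function_field_def eval2_generic)

lemma ev_in_function_field: "ev y A \<in> function_field y"
  unfolding function_field_iff by (intro exI[of _ A] exI[of _ 1]) simp

lemma emb_in_function_field: "emb r \<in> function_field y"
  using ev_in_function_field[of y "[:r:]"] by (simp add: ev_const)

lemma x_gen_in_function_field: "x_gen \<in> function_field y"
  by (simp add: x_gen_eq_emb emb_in_function_field)

lemma y_in_function_field: "y \<in> function_field y"
  using ev_in_function_field[of y "[:0, 1:]"] by (simp add: ev_y)

lemma subfield_function_field: "subfield_set (function_field y)"
  unfolding subfield_set_def subring_set_def
proof (intro conjI ballI)
  show "1 \<in> function_field y" using ev_in_function_field[of y 1] by simp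
  fix u assume "u \<in> function_field y"
  then obtain A B where u: "ev y B \<noteq> 0" "u = ev y A / ev y B" by (auto simp: function_field_iff)
  show "inverse u \<in> function_field y"
  proof (cases "u = 0")
    case True
    then show ?thesis using ev_in_function_field[of y 0] by simp
  next
    case False
    then show ?thesis unfolding function_field_iff using u
      by (intro exI[of _ B] exI[of _ A]) auto
  qed
  fix v assume "v \<in> function_field y"
  then obtain A' B' where v: "ev y B' \<noteq> 0" "v = ev y A' / ev y B'" by (auto simp: function_field_iff)
  have "u - v = ev y (A * B' - A' * B) / ev y (B * B')"
    unfolding u(2) v(2) diff_frac_eq[OF u(1) v(1)] by (simp add: ev_mult ev_diff)
  then show "u - v \<in> function_field y" unfolding function_field_iff
    using u v by (intro exI[of _ "A * B' - A' * B"] exI[of _ "B * B'"]) (auto simp: ev_mult)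
  show "u * v \<in> function_field y" unfolding function_field_iff
    using u v by (intro exI[of _ "A * A'"] exI[of _ "B * B'"]) (auto simp: ev_mult)
qed

lemma place_valuation_ring:
  assumes "is_place y R"
  shows "valuation_ring (function_field y) R"
proof
  have "const 1 \<in> R" using assms by (auto simp: is_place_def)
  then show "subring_set R" using assms by (simp add: is_place_def subring_set_def const_1)
qed (use assms subfield_function_field in \<open>auto simp: is_place_def\<close>)

lemma ex_place_avoiding:
  assumes A: "subring_set A" "A \<subseteq> function_field y" "range const \<subseteq> A"
    and w: "w \<in> function_field y" "w \<notin> adjoin A (inverse w)"
  shows "\<exists>R. is_place y R \<and> A \<subseteq> R \<and> w \<notin> R"
proof -
  let ?B = "adjoin A (inverse w)" and ?K = "function_field y"
  have K: "subring_set ?K" "inverse w \<in> ?K"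
    using subfield_function_field[of y] w(1) by (auto simp: subfield_set_def)
  obtain R where R: "subring_set R" "?B \<subseteq> R" "R \<subseteq> ?K" "w \<notin> R" "\<forall>z\<in>?K. z \<in> R \<or> inverse z \<in> R"
    using ex_valuation_ring_avoiding[OF subfield_function_field adjoin(1)[OF A(1)]
        adjoin_subset[OF K(1) A(2) K(2)] w(2) adjoin(3)[OF A(1)]] by blast
  have AR: "A \<subseteq> R" and wR: "inverse w \<in> R"
    using adjoin(2,3)[OF A(1), of "inverse w"] R(2) by blast+
  have "inverse w \<notin> range const"
  proof
    assume "inverse w \<in> range const"
    then obtain c where "inverse w = const c" by blast
    then have "w = const (inverse c)" unfolding const_inverse by (metis inverse_inverse_eq)
    then show False using A(3) AR R(4) by blast
  qed
  then have "range const \<subset> R" "R \<subset> ?K" using A(3) AR wR w(1) R(3,4) by blast+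
  then have "is_place y R" unfolding is_place_def
    using R(5) subring_setD(3,4)[OF R(1)] by (intro conjI ballI) simp_all
  then show ?thesis using AR R(4) by blast
qed

section \<open>The place at infinity\<close>

text \<open>As a vector space over the constants, the coordinate ring is spanned by the monomials \<open>x^i y^j\<close>
  with \<open>j < q\<close>; \<open>weight\<close> will turn out to be their pole order at infinity.\<close>

definition monomials :: "'a::zero poly poly \<Rightarrow> (nat \<times> nat) set" where
  "monomials F = {(i, j). coeff (coeff F j) i \<noteq> 0}"

lemma finite_monomials: "finite (monomials F)"
proof (rule finite_subset)
  show "monomials F \<subseteq> (\<lambda>(j, i). (i, j)) ` (SIGMA j:{..degree F}. {..degree (coeff F j)})"
  proof
    fix m assume "m \<in> monomials F"
    then obtain i j where m: "m = (i, j)" "coeff (coeff F j) i \<noteq> 0" by (auto simp: monomials_def)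
    then have "coeff F j \<noteq> 0" by auto
    then have "j \<le> degree F" "i \<le> degree (coeff F j)" using m(2) by (auto intro: le_degree)
    then show "m \<in> (\<lambda>(j, i). (i, j)) ` (SIGMA j:{..degree F}. {..degree (coeff F j)})"
      using m(1) by force
  qed
qed auto

lemma monomials_empty_iff: "monomials F = {} \<longleftrightarrow> F = 0"
  by (auto simp: monomials_def poly_eq_iff)

lemma sum_monomials:
  fixes f :: "nat \<Rightarrow> nat \<Rightarrow> 'b::comm_monoid_add"
  assumes "\<And>i j. coeff (coeff F j) i = 0 \<Longrightarrow> f i j = 0"
  shows "(\<Sum>j\<le>degree F. \<Sum>i\<le>degree (coeff F j). f i j) = (\<Sum>(i, j)\<in>monomials F. f i j)"
proof -
  let ?S = "SIGMA j:{..degree F}. {..degree (coeff F j)}"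
  have "(\<Sum>j\<le>degree F. \<Sum>i\<le>degree (coeff F j). f i j) = (\<Sum>(j, i)\<in>?S. f i j)"
    by (rule sum.Sigma) auto
  also have "\<dots> = (\<Sum>(j, i)\<in>{(j, i). (i, j) \<in> monomials F}. f i j)"
  proof (rule sum.mono_neutral_right)
    show "{(j, i). (i, j) \<in> monomials F} \<subseteq> ?S"
      by (auto simp: monomials_def intro!: le_degree)
    show "\<forall>m\<in>?S - {(j, i). (i, j) \<in> monomials F}. (case m of (j, i) \<Rightarrow> f i j) = 0"
      using assms by (auto simp: monomials_def)
  qed auto
  also have "\<dots> = (\<Sum>(i, j)\<in>monomials F. f i j)"
    by (rule sum.reindex_bij_witness[of _ "\<lambda>(i, j). (j, i)" "\<lambda>(j, i). (i, j)"]) auto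
  finally show ?thesis .
qed

lemma ev_monomials:
  "ev y F = (\<Sum>(i, j)\<in>monomials F. const (coeff (coeff F j) i) * x_gen ^ i * y ^ j)"
proof -
  have e: "emb r = (\<Sum>i\<le>degree r. const (coeff r i) * x_gen ^ i)" for r :: "'a poly"
    unfolding poly_const_x_gen[symmetric] poly_altdef
    by (simp add: degree_map_poly const_eq_0_iff coeff_map_poly const_0)
  have "ev y F = (\<Sum>j\<le>degree F. emb (coeff F j) * y ^ j)"
    unfolding ev_def poly_altdef by (simp add: degree_map_poly coeff_map_poly)
  also have "\<dots> = (\<Sum>j\<le>degree F. \<Sum>i\<le>degree (coeff F j).
      const (coeff (coeff F j) i) * x_gen ^ i * y ^ j)"
    by (simp add: e[of "coeff F _"] sum_distrib_right)
  also have "\<dots> = (\<Sum>(i, j)\<in>monomials F. const (coeff (coeff F j) i) * x_gen ^ i * y ^ j)"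
    by (rule sum_monomials) (simp add: const_0)
  finally show ?thesis .
qed

locale curve =
  fixes q k s :: nat and y :: "'a::field ff"
  assumes prime_char: "prime CHAR('a)" and q_power: "q = CHAR('a) ^ s" and s_pos: "s > 0" and k_pos: "k > 0"
    and on_curve: "on_B q k x_gen y"
begin

abbreviation "K \<equiv> function_field y"

lemma q_gt_1: "q > 1"
  unfolding q_power using prime_char s_pos prime_gt_1_nat by (intro one_less_power) auto

definition Hx :: "'a poly" where
  "Hx = H_poly q k [:0, 1:]"

lemma y_power_q: "y ^ q = y + emb Hx"
proof -
  have "emb Hx = H_poly q k x_gen" by (simp only: Hx_def H_poly_def x_gen_eq_emb emb_simps emb_power)
  then show ?thesis using on_curve by (simp add: on_B_def algebra_simps)
qed

lemma emb_Hx: "emb Hx = x_gen ^ (q ^ k + 1) + x_gen"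
  by (simp only: Hx_def H_poly_def x_gen_eq_emb emb_simps emb_power)

definition weight :: "nat \<times> nat \<Rightarrow> nat" where
  "weight = (\<lambda>(i, j). q * i + (q ^ k + 1) * j)"

definition reduced :: "'a poly poly \<Rightarrow> bool" where
  "reduced F \<longleftrightarrow> degree F < q"

definition pole_order :: "'a poly poly \<Rightarrow> nat" where
  "pole_order F = Max (weight ` monomials F)"

text \<open>Modulo \<open>q\<close> the weight of \<open>(i, j)\<close> is \<open>j\<close>.\<close>

lemma weight_inj: "inj_on weight {(i, j). j < q}"
proof (rule inj_onI, clarify)
  fix i j i' j' assume j: "j < q" "j' < q" and eq: "weight (i, j) = weight (i', j')"
  have qk: "q ^ k = q * q ^ (k - 1)" using k_pos by (cases k) auto
  have m: "weight (i, j) mod q = j mod q" for i j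
  proof -
    have "weight (i, j) = j + q * (i + q ^ (k - 1) * j)" by (simp add: weight_def qk algebra_simps)
    then show ?thesis by simp
  qed
  have "j = j'" using m[of i j] m[of i' j'] eq j by simp
  then show "i = i' \<and> j = j'" using eq q_gt_1 by (simp add: weight_def)
qed

lemma reduced_monomials: "reduced F \<Longrightarrow> monomials F \<subseteq> {(i, j). j < q}"
proof
  fix m assume F: "reduced F" and "m \<in> monomials F"
  then obtain i j where m: "m = (i, j)" "coeff (coeff F j) i \<noteq> 0" by (auto simp: monomials_def)
  then have "coeff F j \<noteq> 0" by auto
  then show "m \<in> {(i, j). j < q}" using m(1) F le_degree by (fastforce simp: reduced_def)
qed

lemma pole_order_le_iff:
  "F \<noteq> 0 \<Longrightarrow> pole_order F \<le> m \<longleftrightarrow> (\<forall>i j. coeff (coeff F j) i \<noteq> 0 \<longrightarrow> weight (i, j) \<le> m)"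
  unfolding pole_order_def using monomials_empty_iff[of F] finite_monomials[of F]
  by (subst Max_le_iff) (auto simp: monomials_def)

end

locale infinite_place = curve +
  fixes R
  assumes place: "is_place y R" and x_notin: "x_gen \<notin> R"
begin

sublocale valuation_ring K R
  using place by (rule place_valuation_ring)

lemma const_in: "const c \<in> R"
  using place by (auto simp: is_place_def)

lemma const_unit: "c \<noteq> 0 \<Longrightarrow> const c \<in> units"
  using const_in by (simp add: place_units_def const_eq_0_iff flip: const_inverse)

lemma K_mult: "u \<in> K \<Longrightarrow> v \<in> K \<Longrightarrow> u * v \<in> K" and K_power: "u \<in> K \<Longrightarrow> u ^ n \<in> K"
  using subring_setD(4,7)[of K] K by (auto simp: subfield_set_def)

lemma x_in_K: "x_gen \<in> K" and y_in_K: "y \<in> K"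
  by (rule x_gen_in_function_field y_in_function_field)+

lemma x_nonzero: "(x_gen :: 'a ff) \<noteq> 0"
  using x_notin r(2) by auto

lemma inverse_x_nonunit: "inverse x_gen \<in> R - units"
  using x_in_K K_inverse x_notin by (intro nonunitI) auto

lemma inverse_x_power_nonunit: "n > 0 \<Longrightarrow> inverse x_gen ^ n \<in> R - units"
  using nonunit_mult[OF inverse_x_nonunit, of "inverse x_gen ^ (n - 1)"] r(7)[of "inverse x_gen"] inverse_x_nonunit
  by (cases n) auto

lemma x_power_notin: "n > 0 \<Longrightarrow> x_gen ^ n \<notin> R"
  using root_closed[OF x_in_K] x_notin by blast

lemma qk_pos: "q ^ k > 0" using q_gt_1 by simp

lemma y_nonzero: "y \<noteq> 0"
proof
  assume y: "y = 0"
  then have "y ^ q = 0" using q_gt_1 by (simp add: zero_power)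
  then have "emb Hx = 0" using y_power_q y by (metis add_0)
  then have "(x_gen :: 'a ff) * (x_gen ^ (q ^ k) + 1) = 0" by (simp add: emb_Hx algebra_simps)
  then have "(x_gen :: 'a ff) ^ (q ^ k) = - 1" using x_nonzero by (simp add: eq_neg_iff_add_eq_0)
  then show False using x_power_notin[OF qk_pos] r(1,5) by simp
qed

text \<open>In the equation of the curve, \<open>y^q\<close> and \<open>x^(q^k+1)\<close> dominate at infinity: if \<open>w = x^(q^k+1) / y\<close>
  were regular, then so would be \<open>y^(q-1)\<close>, hence \<open>y\<close>, hence \<open>x\<close>.\<close>

lemma y_small: "y / x_gen ^ (q ^ k + 1) \<in> R - units"
proof (rule nonunitI)
  show "y / x_gen ^ (q ^ k + 1) \<in> K"
    unfolding divide_inverse by (intro K_mult K_inverse K_power x_in_K y_in_K)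
  show "inverse (y / x_gen ^ (q ^ k + 1)) \<notin> R"
  proof
    define w where "w = inverse (y / x_gen ^ (q ^ k + 1))"
    assume "inverse (y / x_gen ^ (q ^ k + 1)) \<in> R"
    then have w: "w \<in> R" by (simp add: w_def)
    have wy: "w * y = x_gen ^ (q ^ k + 1)" using y_nonzero x_nonzero by (simp add: w_def field_simps)
    have "y * (1 + w + w * inverse x_gen ^ (q ^ k)) = y + w * y + w * y * inverse x_gen ^ (q ^ k)"
      by (simp add: algebra_simps)
    also have "w * y * inverse x_gen ^ (q ^ k) = x_gen"
      unfolding wy using x_nonzero by (simp add: field_simps power_inverse)
    also have "y + w * y + x_gen = y * y ^ (q - 1)"
    proof -
      have "y * y ^ (q - 1) = y ^ q" using q_gt_1 power_minus_mult[of q y] by (simp add: mult.commute)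
      then show ?thesis unfolding wy y_power_q emb_Hx by (simp add: add.assoc)
    qed
    finally have "y ^ (q - 1) = 1 + w + w * inverse x_gen ^ (q ^ k)" using y_nonzero by simp
    also have "\<dots> \<in> R" using inverse_x_nonunit w by (intro r(6) r(1) r(4) r(7)) auto
    finally have "y \<in> R" using root_closed[OF y_in_K, of "q - 1"] q_gt_1 by simp
    then have "w * y \<in> R" using r(4)[OF w] by blast
    then show False unfolding wy using x_power_notin[of "q ^ k + 1"] by simp
  qed
qed

text \<open>As \<open>x\<close> and \<open>y\<close> have pole orders in the ratio \<open>q : q^k + 1\<close>, their pole orders are \<open>q\<close> and \<open>q^k +
  1\<close> times the order of vanishing of this quotient.\<close>

definition t :: "'a ff" where
  "t = x_gen ^ (q ^ (k - 1)) / y"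

lemma qk: "q ^ k = q * q ^ (k - 1)" using k_pos by (cases k) auto

lemma x_t: "x_gen * t ^ q \<in> units"
proof -
  \<comment> \<open>This quotient is \<open>1\<close> plus nonunits, and \<open>t ^ q\<close> is its inverse divided by \<open>x\<close>.\<close>
  define u where "u = y ^ q / x_gen ^ (q ^ k + 1)"
  have "u = 1 + (inverse x_gen ^ (q ^ k) + y / x_gen ^ (q ^ k + 1))"
    unfolding u_def y_power_q emb_Hx using x_nonzero by (simp add: field_simps power_inverse)
  also have "\<dots> \<in> units"
    by (intro unit_add_nonunit unit_one nonunit_add inverse_x_power_nonunit y_small qk_pos)
  finally have u: "u \<in> units" .
  have "x_gen * t ^ q = inverse u"
    unfolding u_def t_def qk using x_nonzero y_nonzero
    by (simp add: power_divide field_simps flip: power_mult)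
  then show ?thesis using unit_inverse[OF u] by simp
qed

lemma t_nonzero: "t \<noteq> 0"
  using x_nonzero y_nonzero by (simp add: t_def)

lemma t_in_K: "t \<in> K"
  unfolding t_def divide_inverse by (intro K_mult K_power K_inverse x_in_K y_in_K)

lemma t_nonunit: "t \<in> R - units"
proof -
  have "t ^ q = inverse x_gen * (x_gen * t ^ q)" using x_nonzero by simp
  also have "\<dots> \<in> R - units" using nonunit_mult[OF inverse_x_nonunit] unitD(1)[OF x_t] by blast
  finally have tq: "t ^ q \<in> R - units" .
  then have "t \<in> R" using root_closed[OF t_in_K, of q] q_gt_1 by simp
  moreover have "t \<notin> units" using unit_power[of t q] tq by blast
  ultimately show ?thesis by simp
qed

lemma y_t: "y * t ^ (q ^ k + 1) \<in> units"
proof -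
  have "y * t ^ (q ^ k + 1) = x_gen ^ (q ^ (k - 1)) * t ^ (q ^ k)"
    using y_nonzero by (simp add: t_def)
  also have "\<dots> = (x_gen * t ^ q) ^ (q ^ (k - 1))"
    unfolding qk by (simp add: power_mult_distrib flip: power_mult)
  also have "\<dots> \<in> units" by (rule unit_power[OF x_t])
  finally show ?thesis .
qed

lemma monomial_t:
  assumes "c \<noteq> 0"
  shows "const c * x_gen ^ i * y ^ j * t ^ weight (i, j) \<in> units"
proof -
  have "const c * x_gen ^ i * y ^ j * t ^ weight (i, j)
      = const c * (x_gen * t ^ q) ^ i * (y * t ^ (q ^ k + 1)) ^ j"
  proof -
    have "t ^ weight (i, j) = (t ^ q) ^ i * (t ^ (q ^ k + 1)) ^ j"
      by (simp only: weight_def prod.case power_add[of t "q * i"] power_mult)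
    then show ?thesis by (simp only: power_mult_distrib mult_ac)
  qed
  also have "\<dots> \<in> units"
    by (intro unit_mult const_unit unit_power x_t y_t assms)
  finally show ?thesis .
qed

text \<open>A reduced polynomial is dominated by its monomial of largest weight. In particular it does not
  vanish at the generic point, so that the equation of the curve is irreducible.\<close>

lemma ev_t:
  assumes F: "reduced F" "F \<noteq> 0"
  shows "ev y F * t ^ pole_order F \<in> units"
proof -
  have "Max (weight ` monomials F) \<in> weight ` monomials F"
    using finite_monomials monomials_empty_iff F(2) by (intro Max_in) auto
  then obtain m where m: "m \<in> monomials F" "pole_order F = weight m" by (auto simp: pole_order_def)
  show ?thesis unfolding ev_monomials m(2)
  proof (rule unit_sum_of_distinct_orders[OF finite_monomials _ m(1) _ t_nonunit])
    show "inj_on weight (monomials F)" using weight_inj reduced_monomials[OF F(1)] inj_on_subset by blast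
    show "weight i \<le> weight m" if "i \<in> monomials F" for i
      unfolding m(2)[symmetric] pole_order_def using that finite_monomials by (intro Max_ge) auto
    show "(case i of (i, j) \<Rightarrow> const (coeff (coeff F j) i) * x_gen ^ i * y ^ j) * t ^ weight i \<in> units"
      if "i \<in> monomials F" for i
      using that monomial_t by (auto simp: monomials_def)
  qed
qed

lemma ev_nonzero: "reduced F \<Longrightarrow> F \<noteq> 0 \<Longrightarrow> ev y F \<noteq> 0"
  using ev_t[of F] by (auto simp: place_units_def)

end

context curve
begin

definition curve_poly :: "'a poly poly" where
  "curve_poly = monom 1 q - [:Hx, 1:]"

lemma curve_poly_degree: "degree curve_poly = q" "coeff curve_poly q = 1"
proof -
  have "degree [:Hx, 1:] < q" using q_gt_1 by simp
  then show "degree curve_poly = q"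
    unfolding curve_poly_def diff_conv_add_uminus
    by (subst degree_add_eq_left) (simp_all add: degree_monom_eq)
  show "coeff curve_poly q = 1"
    unfolding curve_poly_def using q_gt_1 by (simp add: coeff_pCons split: nat.split)
qed

lemma ev_curve_poly: "ev y curve_poly = 0"
proof -
  have "ev y (monom 1 q) = y ^ q" by (simp add: ev_def map_poly_monom poly_monom)
  then show ?thesis by (simp add: curve_poly_def ev_diff ev_pCons y_power_q)
qed

text \<open>The polynomial is monic in \<open>y\<close>, so division with remainder is possible.\<close>

lemma ex_reduced: "\<exists>F G. reduced F \<and> A = curve_poly * G + F"
proof -
  have nz: "curve_poly \<noteq> 0" using curve_poly_degree(2) by auto
  obtain G F where GF: "pseudo_divmod A curve_poly = (G, F)" by fastforce
  have "A = curve_poly * G + F" using pseudo_divmod(1)[OF nz GF] by (simp add: curve_poly_degree)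
  moreover have "reduced F"
    using pseudo_divmod(2)[OF nz GF] q_gt_1 by (auto simp: reduced_def curve_poly_degree)
  ultimately show ?thesis by blast
qed

lemma ex_reduced_ev: "\<exists>F. reduced F \<and> ev y A = ev y F"
  using ex_reduced[of A] by (auto simp: ev_add ev_mult ev_curve_poly)

end

context infinite_place
begin

lemma K_cases:
  assumes "h \<in> K" "h \<noteq> 0"
  obtains F G u where "reduced F" "F \<noteq> 0" "reduced G" "G \<noteq> 0" "h = ev y F / ev y G"
    "u \<in> units" "h * t ^ pole_order F = u * t ^ pole_order G"
proof -
  obtain A B where AB: "ev y B \<noteq> 0" "h = ev y A / ev y B" using assms(1) by (auto simp: function_field_iff)
  obtain F where F: "reduced F" "ev y A = ev y F" using ex_reduced_ev by blast
  obtain G where G: "reduced G" "ev y B = ev y G" using ex_reduced_ev by blast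
  have nz: "F \<noteq> 0" "G \<noteq> 0" using assms(2) AB F G by auto
  define u where "u = ev y F * t ^ pole_order F * inverse (ev y G * t ^ pole_order G)"
  have "u \<in> units" unfolding u_def by (intro unit_mult unit_inverse ev_t F G nz)
  moreover have "h * t ^ pole_order F = u * t ^ pole_order G"
    using AB t_nonzero F G by (simp add: u_def field_simps)
  ultimately show thesis using that[of F G u] F G nz AB by simp
qed

text \<open>The right-hand side does not mention the place. Since every nonzero function is such a quotient,
  there is only one place at infinity.\<close>

lemma quotient_in_iff:
  assumes "reduced F" "F \<noteq> 0" "reduced G" "G \<noteq> 0"
  shows "ev y F / ev y G \<in> R \<longleftrightarrow> pole_order F \<le> pole_order G"
proof -
  let ?f = "ev y F" and ?g = "ev y G"
  have uF: "?f * t ^ pole_order F \<in> units" and uG: "?g * t ^ pole_order G \<in> units"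
    using ev_t assms by blast+
  have nz: "?f \<noteq> 0" "?g \<noteq> 0" using ev_nonzero assms by blast+
  have in_R: "f / g \<in> R" if "f * t ^ a \<in> units" "g * t ^ b \<in> units" "a \<le> b" "f \<noteq> 0" "g \<noteq> 0" for f g a b
  proof -
    have "f / g = f * t ^ a * inverse (g * t ^ b) * t ^ (b - a)"
      using that(3-5) t_nonzero by (simp add: field_simps flip: power_add)
    also have "\<dots> \<in> R"
      by (intro r(4) unitD(1)[OF that(1)] unitD(3)[OF that(2)] r(7)) (use t_nonunit in simp)
    finally show ?thesis .
  qed
  show ?thesis
  proof
    assume "pole_order F \<le> pole_order G"
    then show "?f / ?g \<in> R" using in_R[OF uF uG] nz by blast
  next
    assume fg: "?f / ?g \<in> R"
    show "pole_order F \<le> pole_order G"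
    proof (rule ccontr)
      assume "\<not> pole_order F \<le> pole_order G"
      then have lt: "pole_order G < pole_order F" by simp
      define d where "d = pole_order F - pole_order G - 1"
      have d: "pole_order F = pole_order G + Suc d" using lt by (simp add: d_def)
      have "?f * t ^ pole_order F = t * (?f / ?g * (?g * t ^ pole_order G) * t ^ d)"
        unfolding d using nz by (simp add: power_add mult_ac)
      also have "\<dots> \<in> R - units"
        by (intro nonunit_mult[OF t_nonunit] r(4) fg unitD(1)[OF uG] r(7)) (use t_nonunit in simp)
      finally show False using uF by simp
    qed
  qed
qed

lemma t_power_unit_iff: "t powi e \<in> units \<longleftrightarrow> e = 0"
proof
  assume e: "t powi e \<in> units"
  have *: "t ^ n \<notin> units" if "n > 0" for n
    using nonunit_mult[OF t_nonunit, of "t ^ (n - 1)"] r(7)[of t "n - 1"] t_nonunit that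
    by (cases n) auto
  show "e = 0"
  proof (rule ccontr)
    assume "e \<noteq> 0"
    then consider "e > 0" | "e < 0" by linarith
    then show False
    proof cases
      case 1
      then show False using *[of "nat e"] e by (simp add: power_int_def)
    next
      case 2
      have "inverse (t powi e) \<in> units" using unit_inverse[OF e] .
      then show False using *[of "nat (- e)"] 2 by (simp add: power_int_def power_inverse)
    qed
  qed
qed (simp add: unit_one)

lemma unit_power_int: "u \<in> units \<Longrightarrow> u powi e \<in> units"
  by (simp add: power_int_def unit_power unit_inverse)

lemma uniformizer_t: "uniformizer R t"
  unfolding uniformizer_def
proof (intro equalityI subsetI)
  fix z assume z: "z \<in> R - units"
  show "z \<in> {t * w |w. w \<in> R}"
  proof (cases "z = 0")
    case True
    then show ?thesis using r(2) by auto
  next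
    case False
    obtain F G u where FG: "reduced F" "F \<noteq> 0" "reduced G" "G \<noteq> 0" "z = ev y F / ev y G"
      "u \<in> units" "z * t ^ pole_order F = u * t ^ pole_order G"
      using K_cases[of z] z R(2) False by blast
    have le: "pole_order F \<le> pole_order G" using quotient_in_iff[OF FG(1-4)] FG(5) z by blast
    have "pole_order F \<noteq> pole_order G" using FG(6,7) z t_nonzero by auto
    then have lt: "pole_order F < pole_order G" using le by simp
    define d where "d = pole_order G - pole_order F - 1"
    have d: "pole_order G = pole_order F + Suc d" using lt by (simp add: d_def)
    have "z * t ^ pole_order F = t * (u * t ^ d) * t ^ pole_order F"
      using FG(7) unfolding d by (simp add: power_add mult_ac)
    then have "z = t * (u * t ^ d)" using t_nonzero by simp
    moreover have "u * t ^ d \<in> R"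
      by (intro r(4) r(7) unitD(1)[OF FG(6)]) (use t_nonunit in simp)
    ultimately show ?thesis by blast
  qed
next
  fix z assume "z \<in> {t * w |w. w \<in> R}"
  then show "z \<in> R - units" using nonunit_mult[OF t_nonunit] by blast
qed

text \<open>Any other uniformizer is the product of \<open>t\<close> and a unit, and so gives the same valuation.\<close>

lemma place_val_eq:
  assumes u: "u \<in> units" and z: "z = t powi e * u"
  shows "place_val R z = e"
  unfolding place_val_def
proof (rule the_equality)
  show "\<exists>t u. uniformizer R t \<and> u \<in> units \<and> z = t powi e * u"
    using uniformizer_t u z by blast
next
  fix e' assume "\<exists>t u. uniformizer R t \<and> u \<in> units \<and> z = t powi e' * u"
  then obtain t' u' where t': "uniformizer R t'" and u': "u' \<in> units" and z': "z = t' powi e' * u'" by blast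
  have "t' \<in> R - units" using t' r(1) by (auto simp: uniformizer_def)
  then obtain w where w: "w \<in> R" "t' = t * w" using uniformizer_t by (auto simp: uniformizer_def)
  obtain w' where w': "w' \<in> R" "t = t' * w'" using t' t_nonunit by (auto simp: uniformizer_def)
  have "t * (w * w') = t" using w(2) w'(2) by (metis mult.assoc)
  then have "w * w' = 1" using t_nonzero by simp
  then have "w \<in> units" using unit_of_mult[OF w(1) w'(1)] unit_one by simp
  have "t powi e * u = t powi e' * (w powi e' * u')"
    using z z' w(2) by (simp add: power_int_mult_distrib mult.assoc)
  then have "t powi (e - e') = (w powi e' * u') * inverse u"
    using t_nonzero unitD(2)[OF u] by (simp add: power_int_diff field_simps)
  also have "\<dots> \<in> units" by (intro unit_mult unit_power_int unit_inverse u u' \<open>w \<in> units\<close>)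
  finally show "e' = e" using t_power_unit_iff by simp
qed

lemma place_val_ev:
  assumes "reduced F" "F \<noteq> 0"
  shows "place_val R (ev y F) = - int (pole_order F)"
proof (rule place_val_eq)
  show "ev y F * t ^ pole_order F \<in> units" by (rule ev_t) fact+
  show "ev y F = t powi - int (pole_order F) * (ev y F * t ^ pole_order F)"
    using t_nonzero by (simp add: power_int_minus)
qed

end

text \<open>By its equation, \<open>y\<close> is integral over the polynomials in \<open>x\<close>.\<close>

lemma place_x_imp_y:
  assumes "curve q k s y" and "is_place y R" and "x_gen \<in> R"
  shows "y \<in> R"
proof -
  interpret curve q k s y by fact
  interpret valuation_ring K R by (rule place_valuation_ring) fact
  show ?thesis
  proof (rule ccontr)
    assume y: "y \<notin> R"
    then have iy: "inverse y \<in> R" using total y_in_function_field by blast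
    have "y \<noteq> 0" using y r(2) by auto
    have q: "q = Suc (Suc (q - 2))" using q_gt_1 by simp
    have "y = y ^ q * inverse y ^ (q - 1)"
      using \<open>y \<noteq> 0\<close> q_gt_1 by (cases q) (auto simp: power_inverse)
    also have "\<dots> = y * inverse y ^ (q - 1) + emb Hx * inverse y ^ (q - 1)"
      unfolding y_power_q by (simp add: algebra_simps)
    also have "y * inverse y ^ (q - 1) = inverse y ^ (q - 2)"
      using \<open>y \<noteq> 0\<close> by (subst (1 2) q) simp
    also have "inverse y ^ (q - 2) + emb Hx * inverse y ^ (q - 1) \<in> R"
      unfolding emb_Hx by (intro r(4,6,7) iy assms(3))
    finally show False using y by simp
  qed
qed

context curve
begin

text \<open>Chevalley's theorem yields a place at infinity, as \<open>x\<close> is not a polynomial in \<open>1/x\<close>.\<close>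

lemma ex_infinite_place: "\<exists>R. is_place y R \<and> x_gen \<notin> R"
proof -
  let ?x = "x_gen :: 'a ff"
  have "?x \<notin> adjoin (range const) (inverse ?x)"
  proof
    assume x: "?x \<in> adjoin (range const) (inverse ?x)"
    have x0: "?x \<noteq> 0" by (simp add: x_gen_eq_emb)
    obtain n d where d: "\<And>i. d i \<in> range const" "?x ^ n * ?x = (\<Sum>i\<le>n. d i * ?x ^ (n - i))"
      using x x0 by (rule adjoin_inverse_cases) blast
    have "\<forall>i. \<exists>c. d i = const c" using d(1) by blast
    then obtain c where c: "\<And>i. d i = const (c i)" using choice[of "\<lambda>i c. d i = const c"] by blast
    have "emb (sum f A) = (\<Sum>i\<in>A. emb (f i))" for f :: "nat \<Rightarrow> 'a poly" and A
      by (induction A rule: infinite_finite_induct) simp_all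
    then have "emb ([:0, 1:] ^ n * [:0, 1:]) = emb (\<Sum>i\<le>n. [:c i:] * [:0, 1:] ^ (n - i))"
      using d(2) by (simp only: c emb_simps emb_power const_eq_emb x_gen_eq_emb)
    then have eq: "[:0, 1:] ^ n * [:0, 1:] = (\<Sum>i\<le>n. [:c i:] * [:0, 1:] ^ (n - i))"
      by (simp only: emb_eq_iff)
    have "degree (\<Sum>i\<le>n. [:c i:] * [:0, 1:] ^ (n - i)) \<le> n"
    proof (rule degree_sum_le)
      fix i assume "i \<in> {..n}"
      have "degree ([:c i:] * [:0, 1:] ^ (n - i)) \<le> 0 + (n - i)"
        by (rule order_trans[OF degree_mult_le]) (simp add: degree_power_eq)
      then show "degree ([:c i:] * [:0, 1:] ^ (n - i)) \<le> n" by simp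
    qed simp
    moreover have "degree ([:0, 1 :: 'a:] ^ n * [:0, 1:]) = Suc n"
      by (subst degree_mult_eq) (auto simp: degree_power_eq)
    ultimately show False unfolding eq by linarith
  qed
  moreover have "range const \<subseteq> K" using emb_in_function_field by (auto simp: const_eq_emb)
  ultimately show ?thesis
    using ex_place_avoiding[OF subring_range_const _ order_refl x_gen_in_function_field] by blast
qed

lemma infinite_place_unique:
  assumes "is_place y R" "x_gen \<notin> R" "is_place y R'" "x_gen \<notin> R'"
  shows "R = R'"
proof -
  have sub: "R \<subseteq> R'" if places: "is_place y R" "x_gen \<notin> R" "is_place y R'" "x_gen \<notin> R'" for R R'
  proof
    interpret infinite_place q k s y R by unfold_locales fact+
    interpret R': infinite_place q k s y R' by unfold_locales fact+
    fix h assume h: "h \<in> R"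
    show "h \<in> R'"
    proof (cases "h = 0")
      case True
      then show ?thesis using R'.r(2) by simp
    next
      case False
      obtain F G where FG: "reduced F" "F \<noteq> 0" "reduced G" "G \<noteq> 0" "h = ev y F / ev y G"
        using K_cases[of h] h False R(2) by blast
      then show ?thesis using h quotient_in_iff[OF FG(1-4)] R'.quotient_in_iff[OF FG(1-4)] by simp
    qed
  qed
  show ?thesis using sub[OF assms] sub[OF assms(3,4,1,2)] by blast
qed

lemma P_inf: "is_place y (P_inf y)" "x_gen \<notin> P_inf y"
  and P_inf_unique: "is_place y R \<Longrightarrow> R \<noteq> P_inf y \<Longrightarrow> x_gen \<in> R \<and> y \<in> R"
proof -
  have y: "y \<in> R" if "is_place y R" "x_gen \<in> R" for R
    by (rule place_x_imp_y[OF curve_axioms that])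
  obtain R0 where R0: "is_place y R0" "x_gen \<notin> R0" using ex_infinite_place by blast
  have eq: "P_inf y = R0"
    unfolding P_inf_def by (rule the_equality) (use R0 y infinite_place_unique in blast)+
  show "is_place y (P_inf y)" "x_gen \<notin> P_inf y" using R0 eq by auto
  show "is_place y R \<Longrightarrow> R \<noteq> P_inf y \<Longrightarrow> x_gen \<in> R \<and> y \<in> R"
    using y R0 eq infinite_place_unique by blast
qed

sublocale P: infinite_place q k s y "P_inf y"
  by unfold_locales (rule P_inf)+

lemma ev_eq_0_iff: "reduced F \<Longrightarrow> ev y F = 0 \<longleftrightarrow> F = 0"
  using P.ev_nonzero[of F] by auto

lemma reduced_diff: "reduced F \<Longrightarrow> reduced G \<Longrightarrow> reduced (F - G)"
  by (simp add: reduced_def degree_diff_less)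

lemma reduced_smult: "reduced F \<Longrightarrow> reduced (smult c F)"
  using degree_smult_le[of c F] by (simp add: reduced_def)

lemma ev_inj: "reduced F \<Longrightarrow> reduced G \<Longrightarrow> ev y F = ev y G \<Longrightarrow> F = G"
  using ev_eq_0_iff[OF reduced_diff, of F G] by (simp add: ev_diff)

section \<open>Functions without poles in the affine plane\<close>

text \<open>Elements of the algebraic closure satisfy equations over the rational functions; the next two
  lemmas turn them into equations over the polynomials in \<open>x\<close>.\<close>

lemma common_denominator:
  fixes P :: "'a poly fract poly"
  shows "\<exists>d Q. d \<noteq> 0 \<and> smult (to_fract d) P = map_poly to_fract Q"
proof (induction P)
  case 0
  show ?case by (intro exI[of _ 1] exI[of _ 0]) simp
next
  case (pCons c P)
  obtain d Q where dQ: "d \<noteq> 0" "smult (to_fract d) P = map_poly to_fract Q" using pCons by blast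
  obtain a b where ab: "c = Fraction_Field.Fract a b" "b \<noteq> 0" by (cases c) auto
  have c: "to_fract b * c = to_fract a" using ab by (simp add: Fract_conv_to_fract)
  have "smult (to_fract (d * b)) (pCons c P)
      = pCons (to_fract d * (to_fract b * c)) (smult (to_fract b) (smult (to_fract d) P))"
    by (simp add: mult_ac)
  also have "\<dots> = map_poly to_fract (pCons (d * a) (smult b Q))"
    unfolding c dQ(2) by (simp add: map_poly_pCons map_poly_smult)
  finally show ?case using dQ(1) ab(2) by (intro exI[of _ "d * b"]) auto
qed

text \<open>The denominator of a function can be taken to depend on \<open>x\<close> only: the lowest nonzero coefficient
  of an equation for \<open>ev y B\<close> over the polynomials in \<open>x\<close> is a multiple of \<open>ev y B\<close>.\<close>

lemma ex_multiple_in_x: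
  assumes B: "ev y B \<noteq> 0"
  shows "\<exists>G b. b \<noteq> 0 \<and> ev y B * ev y G = emb b"
proof -
  obtain P :: "'a poly fract poly" where P: "P \<noteq> 0" "poly (map_poly to_ac P) (ev y B) = 0"
    using alg_closure_algebraic by blast
  obtain d Q where dQ: "d \<noteq> 0" "smult (to_fract d) P = map_poly to_fract Q"
    using common_denominator by blast
  have "map_poly to_fract Q \<noteq> 0" using P(1) dQ by (metis smult_eq_0_iff to_fract_eq_0_iff)
  then have Q0: "Q \<noteq> 0" by auto
  have "map_poly emb Q = map_poly to_ac (map_poly to_fract Q)"
    by (rule poly_eqI) (simp add: coeff_map_poly emb_def)
  also have "\<dots> = smult (to_ac (to_fract d)) (map_poly to_ac P)"
    unfolding dQ(2)[symmetric] by (rule poly_eqI) (simp add: coeff_map_poly)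
  finally have root: "poly (map_poly emb Q) (ev y B) = 0" using P(2) by simp
  show ?thesis using Q0 root
  proof (induction Q)
    case (pCons c Q)
    show ?case
    proof (cases "c = 0")
      case True
      then have "poly (map_poly emb Q) (ev y B) = 0" using pCons.prems B by (simp add: map_poly_pCons)
      moreover have "Q \<noteq> 0" using True pCons.hyps by auto
      ultimately show ?thesis using pCons.IH by blast
    next
      case False
      have "ev y B * poly (map_poly emb Q) (ev y B) = - emb c"
        using pCons.prems by (simp add: map_poly_pCons add_eq_0_iff)
      then have "ev y B * ev y (- pcompose Q B) = emb c" by (simp add: ev_uminus ev_pcompose)
      then show ?thesis using False by blast
    qed
  qed simp
qed

lemma ex_denominator_in_x:
  assumes "h \<in> K"
  shows "\<exists>F b. reduced F \<and> b \<noteq> 0 \<and> h = ev y F / emb b"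
proof -
  obtain A B where AB: "ev y B \<noteq> 0" "h = ev y A / ev y B" using assms by (auto simp: function_field_iff)
  obtain G b where G: "b \<noteq> 0" "ev y B * ev y G = emb b" using ex_multiple_in_x[OF AB(1)] by blast
  obtain F where F: "reduced F" "ev y (A * G) = ev y F" using ex_reduced_ev by blast
  have "ev y G \<noteq> 0" using G by auto
  then have "h = ev y (A * G) / (ev y B * ev y G)" using AB by (simp add: ev_mult)
  then show ?thesis using F G by auto
qed

text \<open>A divisor of least positive degree is irreducible.\<close>

lemma ex_irreducible_factor:
  fixes b :: "'a poly"
  assumes "degree b > 0"
  shows "\<exists>\<pi>. prime_elem \<pi> \<and> \<pi> dvd b"
proof -
  define P where "P d \<longleftrightarrow> d dvd b \<and> degree d > 0" for d
  have "P b" using assms by (simp add: P_def)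
  then obtain \<pi> where \<pi>: "P \<pi>" and min: "\<And>d. P d \<Longrightarrow> degree \<pi> \<le> degree d"
    using ex_has_least_nat[of P b degree] by blast
  have "Factorial_Ring.irreducible \<pi>"
  proof (rule Factorial_Ring.irreducibleI)
    show nz: "\<pi> \<noteq> 0" using \<pi> by (auto simp: P_def)
    show "\<not> \<pi> dvd 1" using \<pi> unfolding P_def is_unit_iff_degree[OF nz] by simp
    fix u v assume uv: "\<pi> = u * v"
    show "u dvd 1 \<or> v dvd 1"
    proof (rule ccontr)
      assume "\<not> (u dvd 1 \<or> v dvd 1)"
      moreover have nz: "u \<noteq> 0" "v \<noteq> 0" using \<open>\<pi> \<noteq> 0\<close> uv by auto
      ultimately have d: "degree u > 0" "degree v > 0" by (auto simp: is_unit_iff_degree)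
      have "u dvd b" using \<pi> uv by (auto simp: P_def dest: dvd_mult_left)
      then have "degree \<pi> \<le> degree u" using min[of u] d by (simp add: P_def)
      then show False using d nz by (simp add: uv degree_mult_eq)
    qed
  qed
  then show ?thesis using \<pi> field_poly_irreducible_imp_prime by (auto simp: P_def)
qed

text \<open>The function field has the characteristic of its constants.\<close>

lemma frobenius: "(u + v :: 'a ff) ^ (q ^ i) = u ^ (q ^ i) + v ^ (q ^ i)"
proof -
  have C: "CHAR('a ff) = CHAR('a)"
  proof (rule CHAR_eqI)
    show "of_nat CHAR('a) = (0 :: 'a ff)"
    proof -
      have "of_nat n = const (of_nat n :: 'a)" for n
        by (induction n) (simp_all add: const_0 const_1 const_add)
      then show ?thesis by (simp add: const_0)
    qed
    fix x assume x: "of_nat x = (0 :: 'a ff)"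
    have "of_nat n = const (of_nat n :: 'a)" for n
      by (induction n) (simp_all add: const_0 const_1 const_add)
    then show "CHAR('a) dvd x" using x by (simp add: const_eq_0_iff of_nat_eq_0_iff_char_dvd)
  qed
  show ?thesis
    by (rule freshmans_dream'[of _ "s * i"]) (use prime_char in \<open>simp_all only: C q_power power_mult\<close>)
qed

text \<open>The coordinate ring modulo a prime element \<open>\<pi>\<close> of the polynomials in \<open>x\<close> has no nilpotents,
  which is where the smoothness of the affine curve enters. Taking \<open>q\<close>-th powers in the coordinate
  ring amounts to raising the coefficients to the power \<open>q\<close> and substituting \<open>y + H(x)\<close> for \<open>y\<close>;
  the substitution is invertible, so \<open>\<pi>\<close> divides \<open>F\<^sup>q\<close> only if it divides the powers of the
  coefficients.\<close>

lemma prime_dvd_of_q_power: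
  assumes \<pi>: "prime_elem \<pi>" and F: "reduced F" and dvd: "ev y F ^ q = emb \<pi> * ev y G"
  shows "\<exists>F'. reduced F' \<and> ev y F = emb \<pi> * ev y F'"
proof -
  obtain G' where G': "reduced G'" "ev y G = ev y G'" using ex_reduced_ev by blast
  define E where "E = map_poly (\<lambda>a. a ^ q) F"
  have q0: "q > 0" using q_gt_1 by simp
  have fr: "(\<Sum>i\<in>A. f i) ^ q = (\<Sum>i\<in>A. f i ^ q)" for f :: "nat \<Rightarrow> 'a ff" and A
    using q0 by (induction A rule: infinite_finite_induct) (simp_all add: frobenius[of _ _ 1, simplified])
  have degE: "degree E = degree F"
    unfolding E_def by (rule degree_map_poly) (simp add: q0)
  have "ev y F ^ q = (\<Sum>j\<le>degree F. emb (coeff F j ^ q) * (y ^ q) ^ j)"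
    unfolding ev_def poly_altdef fr
    by (simp add: degree_map_poly coeff_map_poly power_mult_distrib power_mult[symmetric] mult.commute)
  also have "\<dots> = poly (map_poly emb E) (y ^ q)"
    unfolding poly_altdef using q0 by (simp add: degree_map_poly coeff_map_poly degE E_def)
  also have "\<dots> = ev y (pcompose E [:Hx, 1:])"
    by (simp add: ev_pcompose ev_pCons y_power_q add.commute)
  finally have "ev y (pcompose E [:Hx, 1:]) = ev y (smult \<pi> G')"
    using dvd G' by (simp add: ev_smult)
  moreover have "reduced (pcompose E [:Hx, 1:])"
    using F degE by (simp add: reduced_def degree_pcompose)
  ultimately have "pcompose E [:Hx, 1:] = smult \<pi> G'"
    using ev_inj reduced_smult[OF G'(1)] by blast
  then have "pcompose (pcompose E [:Hx, 1:]) [:- Hx, 1:] = smult \<pi> (pcompose G' [:- Hx, 1:])"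
    by (simp add: pcompose_smult)
  moreover have "pcompose (pcompose E [:Hx, 1:]) [:- Hx, 1:] = E"
    by (simp add: pcompose_assoc[symmetric] pcompose_pCons)
  ultimately have E: "E = smult \<pi> (pcompose G' [:- Hx, 1:])" by simp
  have "\<pi> dvd coeff F j" for j
  proof -
    have "coeff F j ^ q = coeff E j" using q0 by (simp add: E_def coeff_map_poly)
    also have "\<pi> dvd \<dots>" unfolding E by simp
    finally show ?thesis by (rule prime_elem_dvd_power[OF \<pi>])
  qed
  then have "[:\<pi>:] dvd F" by (simp add: const_poly_dvd_iff)
  then obtain F' where F': "F = smult \<pi> F'" by auto
  moreover have "reduced F'" using F F' \<pi> by (simp add: reduced_def prime_elem_def)
  ultimately show ?thesis by (intro exI[of _ F']) (simp add: ev_smult)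
qed

lemma prime_dvd_of_power:
  assumes \<pi>: "prime_elem \<pi>" and dvd: "ev y F ^ (q ^ i) = emb \<pi> * ev y G"
  shows "\<exists>F'. reduced F' \<and> ev y F = emb \<pi> * ev y F'"
  using dvd
proof (induction i arbitrary: G)
  case 0
  then show ?case using ex_reduced_ev[of G] by auto
next
  case (Suc i)
  obtain F1 where F1: "reduced F1" "ev y (F ^ (q ^ i)) = ev y F1" using ex_reduced_ev by blast
  have e: "ev y F1 = ev y F ^ (q ^ i)" using F1(2) by (simp add: ev_power)
  have "ev y F1 ^ q = ev y F ^ (q ^ Suc i)"
    unfolding e by (simp add: mult.commute flip: power_mult)
  then obtain F' where "ev y F1 = emb \<pi> * ev y F'"
    using prime_dvd_of_q_power[OF \<pi> F1(1)] Suc.prems by metis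
  then show ?case using Suc.IH[of F'] F1(2) by (simp add: ev_power)
qed

text \<open>Write \<open>h\<close> as a polynomial divided by \<open>b(x)\<close> of least degree. If \<open>b\<close> has a prime factor \<open>\<pi>\<close>, then
  \<open>w = f / \<pi>\<close>, a polynomial multiple of \<open>h\<close>, is not a polynomial by minimality. It does not lie in
  the ring \<open>B\<close> obtained by adjoining \<open>1/w\<close> to the coordinate ring either, since otherwise \<open>\<pi>\<close>
  would divide a power of \<open>f\<close>. A valuation ring above \<open>B\<close> that avoids \<open>w\<close> is then a place in the
  affine plane where \<open>h\<close> is not regular.\<close>

lemma regular_imp_polynomial:
  assumes h: "h \<in> K" and regular: "\<And>R. is_place y R \<Longrightarrow> x_gen \<in> R \<Longrightarrow> h \<in> R"
  shows "\<exists>F. reduced F \<and> h = ev y F"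
proof -
  define P where "P b \<longleftrightarrow> b \<noteq> 0 \<and> (\<exists>F. reduced F \<and> h = ev y F / emb b)" for b
  obtain b0 where "P b0" using ex_denominator_in_x[OF h] by (auto simp: P_def)
  then obtain b where b: "P b" and min: "\<And>d. P d \<Longrightarrow> degree b \<le> degree d"
    using ex_has_least_nat[of P b0 degree] by blast
  obtain F where F: "reduced F" "h = ev y F / emb b" and b0: "b \<noteq> 0" using b by (auto simp: P_def)
  show ?thesis
  proof (cases "degree b = 0")
    case True
    then obtain c where c: "b = [:c:]" by (rule degree_eq_zeroE)
    then have "c \<noteq> 0" using b0 by auto
    then have "emb [:inverse c:] * emb b = 1" by (simp add: c flip: emb_simps(6)) (simp add: one_pCons[symmetric])
    moreover have "ev y F = h * emb b" using F(2) b0 by simp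
    ultimately have "emb [:inverse c:] * ev y F = h" by (simp add: mult_ac)
    then have "h = emb [:inverse c:] * ev y F" by simp
    then show ?thesis using reduced_smult[OF F(1)] by (auto simp flip: ev_smult)
  next
    case False
    then obtain \<pi> where \<pi>: "prime_elem \<pi>" "\<pi> dvd b" using ex_irreducible_factor[of b] by blast
    obtain b' where b': "b = \<pi> * b'" using \<pi>(2) by (rule dvdE)
    have nz: "\<pi> \<noteq> 0" "b' \<noteq> 0" using b' b0 by auto
    have deg: "degree b' < degree b"
    proof -
      have "\<not> \<pi> dvd 1" using \<pi>(1) by (simp add: prime_elem_def)
      then have "degree \<pi> > 0" using nz by (simp add: is_unit_iff_degree)
      then show ?thesis using nz by (simp add: b' degree_mult_eq)
    qed
    define f where "f = ev y F"
    have no: "\<nexists>F'. reduced F' \<and> f = emb \<pi> * ev y F'"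
    proof
      assume "\<exists>F'. reduced F' \<and> f = emb \<pi> * ev y F'"
      then obtain F' where "reduced F'" "f = emb \<pi> * ev y F'" by blast
      then have "P b'" unfolding P_def F(2) using nz by (auto simp: b' f_def intro!: exI[of _ F'])
      then show False using min[of b'] deg by simp
    qed
    have f0: "f \<noteq> 0"
    proof
      assume "f = 0"
      moreover have "reduced 0" using q_gt_1 by (simp add: reduced_def)
      ultimately show False using no by (metis ev_0 mult_zero_right)
    qed
    define w where "w = f / emb \<pi>"
    have hw: "h * emb b' = w" unfolding w_def F(2) f_def b' using nz by simp
    let ?A = "range (ev y)"
    have A: "subring_set ?A" unfolding subring_set_def
    proof (intro conjI ballI)
      show "1 \<in> ?A" using ev_1 by (metis rangeI)
      fix u v assume "u \<in> ?A" "v \<in> ?A"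
      then obtain A B where "u = ev y A" "v = ev y B" by blast
      then have "u - v = ev y (A - B)" "u * v = ev y (A * B)" by (simp_all add: ev_diff ev_mult)
      then show "u - v \<in> ?A" "u * v \<in> ?A" by blast+
    qed
    have EA: "emb r \<in> ?A" for r using rangeI[of "ev y" "[:r:]"] by (simp only: ev_const)
    have AK: "?A \<subseteq> K" using ev_in_function_field by blast
    have K: "subring_set K" using subfield_function_field[of y] by (simp add: subfield_set_def)
    have wK: "w \<in> K" unfolding hw[symmetric] by (intro subring_setD(4)[OF K] h emb_in_function_field)
    have wA: "w \<notin> adjoin ?A (inverse w)"
    proof
      assume w: "w \<in> adjoin ?A (inverse w)"
      have w0: "w \<noteq> 0" using f0 nz by (simp add: w_def)
      obtain n c' where c': "\<And>i. c' i \<in> ?A" "w ^ n * w = (\<Sum>i\<le>n. c' i * w ^ (n - i))"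
        using w w0 by (rule adjoin_inverse_cases) blast
      have "\<forall>i. \<exists>c. c' i = ev y c" using c'(1) by blast
      then obtain c where c: "\<And>i. c' i = ev y (c i)" using choice[of "\<lambda>i c. c' i = ev y c"] by blast
      have "w ^ Suc n = (\<Sum>i\<le>n. ev y (c i) * w ^ (n - i))" using c'(2) by (simp only: c power_Suc2)
      then have "emb \<pi> ^ Suc n * w ^ Suc n = (\<Sum>i\<le>n. emb \<pi> ^ Suc n * (ev y (c i) * w ^ (n - i)))"
        by (simp add: sum_distrib_left)
      also have "\<dots> = (\<Sum>i\<le>n. emb \<pi> * (ev y (c i) * emb \<pi> ^ i * f ^ (n - i)))"
      proof (rule sum.cong)
        fix i assume "i \<in> {..n}"
        then have "emb \<pi> ^ Suc n = emb \<pi> * emb \<pi> ^ i * emb \<pi> ^ (n - i)" by (simp flip: power_add)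
        then show "emb \<pi> ^ Suc n * (ev y (c i) * w ^ (n - i)) = emb \<pi> * (ev y (c i) * emb \<pi> ^ i * f ^ (n - i))"
          using nz by (simp add: w_def power_divide)
      qed simp
      finally have "f ^ Suc n = emb \<pi> * (\<Sum>i\<le>n. ev y (c i) * emb \<pi> ^ i * f ^ (n - i))"
        using nz by (simp add: w_def power_divide sum_distrib_left)
      moreover have "(\<Sum>i\<le>n. ev y (c i) * emb \<pi> ^ i * f ^ (n - i)) \<in> ?A"
        by (intro subring_setD(8)[OF A] subring_setD(4)[OF A] subring_setD(7)[OF A] EA)
           (simp_all add: f_def)
      ultimately obtain G where G: "f ^ Suc n = emb \<pi> * ev y G" by auto
      have "Suc n \<le> q ^ Suc n" by (intro less_imp_le power_gt_expt) (use q_gt_1 in simp)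
      then have "f ^ (q ^ Suc n) = f ^ Suc n * f ^ (q ^ Suc n - Suc n)"
        by (simp only: power_add[symmetric] le_add_diff_inverse)
      also have "\<dots> = emb \<pi> * ev y (G * F ^ (q ^ Suc n - Suc n))"
        unfolding G by (simp add: ev_mult ev_power f_def)
      finally show False using prime_dvd_of_power[OF \<pi>(1), of F "Suc n"] no unfolding f_def by blast
    qed
    obtain R where R: "is_place y R" "?A \<subseteq> R" "w \<notin> R"
      using ex_place_avoiding[OF A AK _ wK wA] EA by (auto simp: const_eq_emb)
    then have ER: "emb r \<in> R" for r using EA by blast
    then have "h \<in> R" using R(1) by (intro regular) (simp_all add: x_gen_eq_emb)
    then have "w \<in> R" unfolding hw[symmetric]
      by (intro valuation_ring.r(4)[OF place_valuation_ring[OF R(1)]] ER)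
    then show ?thesis using R(3) by simp
  qed
qed

definition bounded_pole :: "'a poly poly \<Rightarrow> nat \<Rightarrow> bool" where
  "bounded_pole F m \<longleftrightarrow> (\<forall>i j. coeff (coeff F j) i \<noteq> 0 \<longrightarrow> weight (i, j) \<le> m)"

lemma RR_space_eq: "RR_space y m = {ev y F | F. reduced F \<and> bounded_pole F m}"
proof (intro equalityI subsetI)
  fix h assume "h \<in> RR_space y m"
  then have h: "h \<in> K" "\<And>R. is_place y R \<Longrightarrow> R \<noteq> P_inf y \<Longrightarrow> h \<in> R" "h = 0 \<or> place_val (P_inf y) h \<ge> - int m"
    by (auto simp: RR_space_def)
  have "h \<in> R" if "is_place y R" "x_gen \<in> R" for R
    using h(2)[OF that(1)] that(2) P_inf(2) by auto
  then obtain F where F: "reduced F" "h = ev y F" using regular_imp_polynomial[OF h(1)] by blast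
  have "bounded_pole F m"
  proof (cases "F = 0")
    case True
    then show ?thesis by (simp add: bounded_pole_def)
  next
    case False
    then have "h \<noteq> 0" using F ev_eq_0_iff by simp
    then have "pole_order F \<le> m" using h(3) P.place_val_ev[OF F(1) False] F(2) by simp
    then show ?thesis using pole_order_le_iff[OF False] by (simp add: bounded_pole_def)
  qed
  then show "h \<in> {ev y F | F. reduced F \<and> bounded_pole F m}" using F by blast
next
  fix h assume "h \<in> {ev y F | F. reduced F \<and> bounded_pole F m}"
  then obtain F where F: "reduced F" "bounded_pole F m" "h = ev y F" by blast
  have "h \<in> R" if place: "is_place y R" "R \<noteq> P_inf y" for R
  proof -
    interpret valuation_ring K R by (rule place_valuation_ring) fact
    have xy: "x_gen \<in> R" "y \<in> R" using P_inf_unique[OF place] by auto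
    have c: "const c \<in> R" for c using place(1) by (auto simp: is_place_def)
    show ?thesis unfolding F(3) ev_monomials
      by (rule r(8)) (auto intro!: r(4,7) xy c)
  qed
  moreover have "h = 0 \<or> place_val (P_inf y) h \<ge> - int m"
  proof (cases "F = 0")
    case False
    then have "pole_order F \<le> m" using F(2) pole_order_le_iff by (simp add: bounded_pole_def)
    then show ?thesis using P.place_val_ev[OF F(1) False] F(3) by simp
  qed (simp add: F(3))
  moreover have "h \<in> K" unfolding F(3) by (rule ev_in_function_field)
  ultimately show "h \<in> RR_space y m" unfolding RR_space_def by blast
qed

end

section \<open>Values at the rational points\<close>

definition pt :: "'a::field poly poly \<Rightarrow> 'a \<times> 'a \<Rightarrow> 'a" where
  "pt A P = poly (map_poly (\<lambda>r. poly r (fst P)) A) (snd P)"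

lemma eval2_pt: "eval2 id A a b = pt A (a, b)"
  by (simp add: eval2_def pt_def)

lemma pt_add: "pt (A + B) P = pt A P + pt B P" and pt_mult: "pt (A * B) P = pt A P * pt B P"
  unfolding pt_def by (rule poly_map_poly_hom; simp)+

lemma pt_pCons: "pt (pCons r A) P = poly r (fst P) + snd P * pt A P"
  by (simp add: pt_def map_poly_pCons)

lemma pt_0 [simp]: "pt 0 P = 0" and pt_1 [simp]: "pt 1 P = 1"
  by (simp_all add: pt_def)

lemma pt_smult: "pt (smult r A) P = poly r (fst P) * pt A P"
  using pt_mult[of "[:r:]" A P] by (simp add: pt_pCons)

lemma pt_uminus: "pt (- A) P = - pt A P"
  using pt_smult[of "-1" A P] by simp

lemma pt_diff: "pt (A - B) P = pt A P - pt B P"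
  using pt_add[of A "- B" P] by (simp add: pt_uminus)

lemma pt_prod: "pt (\<Prod>i\<in>I. f i) P = (\<Prod>i\<in>I. pt (f i) P)"
  by (induction I rule: infinite_finite_induct) (simp_all add: pt_mult)

context curve
begin

text \<open>A polynomial that vanishes at the generic point is a multiple of the equation of the curve.
  Hence the values of a function do not depend on the way it is written.\<close>

lemma pt_eq_0:
  assumes "ev y A = 0" and P: "P \<in> affine_points q k"
  shows "pt A P = 0"
proof -
  obtain F G where FG: "reduced F" "A = curve_poly * G + F" using ex_reduced by blast
  have "ev y F = 0" using assms(1) by (simp add: FG(2) ev_add ev_mult ev_curve_poly)
  then have "F = 0" using ev_eq_0_iff FG(1) by blast
  moreover have "pt curve_poly P = 0"
  proof -
    have "poly Hx a = H_poly q k a" for a by (simp add: Hx_def H_poly_def algebra_simps)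
    then show ?thesis using P
      by (auto simp: curve_poly_def pt_diff pt_pCons affine_points_def on_B_def algebra_simps)
         (simp add: pt_def map_poly_monom poly_monom)
  qed
  ultimately show ?thesis by (simp add: FG(2) pt_mult)
qed

lemma pt_cong: "ev y A = ev y B \<Longrightarrow> P \<in> affine_points q k \<Longrightarrow> pt A P = pt B P"
  using pt_eq_0[of "A - B" P] by (simp add: ev_diff pt_diff)

lemma value_at_ev:
  assumes P: "P \<in> affine_points q k"
  shows "value_at y (ev y F) P = pt F P"
proof -
  obtain a b where ab: "P = (a, b)" by (cases P)
  have "value_at y (ev y F) (a, b) = pt F (a, b)"
    unfolding value_at_def prod.case eval2_generic eval2_pt
  proof (rule the_equality)
    show "\<exists>A B. ev y B \<noteq> 0 \<and> ev y F = ev y A / ev y B \<and> pt B (a, b) \<noteq> 0 \<and> pt F (a, b) = pt A (a, b) / pt B (a, b)"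
      by (intro exI[of _ F] exI[of _ 1]) simp
    fix c assume "\<exists>A B. ev y B \<noteq> 0 \<and> ev y F = ev y A / ev y B \<and> pt B (a, b) \<noteq> 0 \<and> c = pt A (a, b) / pt B (a, b)"
    then obtain A B where AB: "ev y B \<noteq> 0" "ev y F = ev y A / ev y B" "pt B (a, b) \<noteq> 0" "c = pt A (a, b) / pt B (a, b)"
      by blast
    have "ev y (F * B) = ev y A" using AB(1,2) by (simp add: ev_mult)
    then have "pt F (a, b) * pt B (a, b) = pt A (a, b)" using pt_cong P ab by (metis pt_mult)
    then have "c * pt B (a, b) = pt F (a, b) * pt B (a, b)" using AB(3,4) by simp
    then show "c = pt F (a, b)" using AB(3) by simp
  qed
  then show ?thesis by (simp add: ab)
qed

section \<open>The spaces of polynomials with bounded pole order\<close>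

definition L_space :: "nat \<Rightarrow> 'a poly poly set" where
  "L_space m = {F. reduced F \<and> bounded_pole F m}"

definition of_coeffs :: "(nat \<times> nat) set \<Rightarrow> (nat \<times> nat \<Rightarrow> 'a) \<Rightarrow> 'a poly poly" where
  "of_coeffs I c = (\<Sum>(i, j)\<in>I. monom (monom (c (i, j)) i) j)"

lemma coeff_of_coeffs:
  assumes "finite I"
  shows "coeff (coeff (of_coeffs I c) j) i = (if (i, j) \<in> I then c (i, j) else 0)"
proof -
  have "coeff (coeff (of_coeffs I c) j) i = (\<Sum>m\<in>I. if m = (i, j) then c m else 0)"
    unfolding of_coeffs_def coeff_sum by (rule sum.cong) (auto split: if_splits)
  then show ?thesis using assms by (simp add: sum.delta)
qed

lemma reduced_of_coeffs:
  assumes "finite I" "I \<subseteq> {(i, j). j < q}"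
  shows "reduced (of_coeffs I c)"
  unfolding reduced_def
proof (rule degree_lessI)
  show "of_coeffs I c \<noteq> 0 \<or> q > 0" using q_gt_1 by simp
  show "\<forall>j\<ge>q. coeff (of_coeffs I c) j = 0"
    using assms by (auto intro!: poly_eqI simp: coeff_of_coeffs)
qed

lemma L_space_subspace:
  shows "0 \<in> L_space m" and "F \<in> L_space m \<Longrightarrow> G \<in> L_space m \<Longrightarrow> F + G \<in> L_space m"
    and "F \<in> L_space m \<Longrightarrow> smult [:c:] F \<in> L_space m"
    and "F \<in> L_space m \<Longrightarrow> G \<in> L_space m \<Longrightarrow> F - G \<in> L_space m"
proof -
  show "0 \<in> L_space m" using q_gt_1 by (simp add: L_space_def reduced_def bounded_pole_def)
  show "F \<in> L_space m \<Longrightarrow> G \<in> L_space m \<Longrightarrow> F + G \<in> L_space m"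
    by (auto simp: L_space_def reduced_def bounded_pole_def degree_add_less) (metis add.right_neutral)
  show "F \<in> L_space m \<Longrightarrow> smult [:c:] F \<in> L_space m"
    using reduced_smult by (auto simp: L_space_def bounded_pole_def)
  show "F \<in> L_space m \<Longrightarrow> G \<in> L_space m \<Longrightarrow> F - G \<in> L_space m"
    using reduced_diff by (auto simp: L_space_def bounded_pole_def) (metis diff_zero)
qed

lemma L_space_iff_pole_order:
  "reduced F \<Longrightarrow> F \<noteq> 0 \<Longrightarrow> F \<in> L_space m \<longleftrightarrow> pole_order F \<le> m"
  using pole_order_le_iff by (simp add: L_space_def bounded_pole_def)

text \<open>By \<open>ev_t\<close>, the generic value of a reduced polynomial is a unit times a power of the uniformizer
  \<open>t\<close>, and the exponents add up.\<close>

lemma pole_order_mult: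
  assumes F: "reduced F" "F \<noteq> 0" and G: "reduced G" "G \<noteq> 0" and H: "reduced H" "ev y H = ev y F * ev y G"
  shows "H \<noteq> 0" and "pole_order H = pole_order F + pole_order G"
proof -
  show H0: "H \<noteq> 0" using H(2) ev_eq_0_iff F G by auto
  define u where "u = ev y F * P.t ^ pole_order F * (ev y G * P.t ^ pole_order G)"
  have u: "u \<in> P.units" unfolding u_def by (intro P.unit_mult P.ev_t F G)
  have "ev y H * P.t ^ pole_order H = P.t powi (int (pole_order H) - int (pole_order F + pole_order G)) * u"
    using P.t_nonzero by (simp add: u_def H(2) power_int_diff power_add power_int_add field_simps)
  then have "P.t powi (int (pole_order H) - int (pole_order F + pole_order G))
      = ev y H * P.t ^ pole_order H * inverse u"
    using P.unitD(2)[OF u] by simp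
  also have "\<dots> \<in> P.units" by (intro P.unit_mult P.unit_inverse u P.ev_t H(1) H0)
  finally show "pole_order H = pole_order F + pole_order G" using P.t_power_unit_iff by simp
qed

lemma L_space_mult:
  assumes "F \<in> L_space a" "G \<in> L_space b"
  shows "\<exists>H\<in>L_space (a + b). ev y H = ev y F * ev y G"
proof (cases "F = 0 \<or> G = 0")
  case True
  then show ?thesis using L_space_subspace(1) by (intro bexI[of _ 0]) auto
next
  case False
  obtain H where H: "reduced H" "ev y (F * G) = ev y H" using ex_reduced_ev by blast
  have "H \<noteq> 0" "pole_order H = pole_order F + pole_order G"
    using pole_order_mult[of F G H] assms False H by (auto simp: L_space_def ev_mult)
  then have "H \<in> L_space (a + b)"
    using L_space_iff_pole_order[of F a] L_space_iff_pole_order[of G b] L_space_iff_pole_order[OF H(1)] assms False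
    by (simp add: L_space_def)
  then show ?thesis using H(2) by (intro bexI[of _ H]) (auto simp: ev_mult)
qed

lemma pole_order_attained:
  assumes "reduced F" "F \<noteq> 0"
  obtains i j where "j < q" "coeff (coeff F j) i \<noteq> 0" "weight (i, j) = pole_order F"
proof -
  have "pole_order F \<in> weight ` monomials F"
    unfolding pole_order_def using finite_monomials monomials_empty_iff assms by (intro Max_in) auto
  then obtain i j where ij: "(i, j) \<in> monomials F" "weight (i, j) = pole_order F" by auto
  then show thesis using that[of j i] reduced_monomials[OF assms(1)] by (auto simp: monomials_def)
qed

text \<open>Two reduced polynomials of the same pole order have the same leading monomial, because distinct
  monomials have distinct weights.\<close>

lemma cancel_leading_monomial:
  assumes F: "F \<in> L_space (Suc n)" and G: "reduced G" "G \<noteq> 0" "pole_order G = Suc n"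
  shows "\<exists>c. F - smult [:c:] G \<in> L_space n"
proof -
  obtain i j where ij: "j < q" "coeff (coeff G j) i \<noteq> 0" "weight (i, j) = Suc n"
    using pole_order_attained[OF G(1,2)] G(3) by metis
  define c where "c = coeff (coeff F j) i / coeff (coeff G j) i"
  define E where "E = F - smult [:c:] G"
  have GL: "G \<in> L_space (Suc n)" using L_space_iff_pole_order G by simp
  have E: "E \<in> L_space (Suc n)" unfolding E_def by (intro L_space_subspace F GL)
  have "weight (i', j') \<le> n" if nz: "coeff (coeff E j') i' \<noteq> 0" for i' j'
  proof -
    have le: "weight (i', j') \<le> Suc n" using E nz by (simp add: L_space_def bounded_pole_def)
    have "(i', j') \<in> {(i, j). j < q}"
      using reduced_monomials[of E] E nz by (auto simp: L_space_def monomials_def)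
    moreover have "(i', j') \<noteq> (i, j)" using nz ij(2) by (auto simp: E_def c_def)
    ultimately have "weight (i', j') \<noteq> weight (i, j)"
      using weight_inj ij(1) by (auto dest: inj_onD)
    then show ?thesis using le ij(3) by simp
  qed
  then have "E \<in> L_space n" using E by (simp add: L_space_def bounded_pole_def)
  then show ?thesis unfolding E_def by blast
qed

subsection \<open>The semigroup of pole orders\<close>

definition pole_orders :: "nat set" where
  "pole_orders = weight ` {(i, j). j < q}"

definition monomials_in :: "nat set \<Rightarrow> (nat \<times> nat) set" where
  "monomials_in W = {(i, j). j < q \<and> weight (i, j) \<in> W}"

lemma bij_monomials_in: "bij_betw weight (monomials_in W) (pole_orders \<inter> W)"
  unfolding bij_betw_def monomials_in_def pole_orders_def
  by (intro conjI inj_on_subset[OF weight_inj]) auto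

lemma finite_monomials_in: "finite W \<Longrightarrow> finite (monomials_in W)"
  using bij_betw_finite[OF bij_monomials_in, of W] by simp

lemma card_monomials_in: "card (monomials_in W) = card (pole_orders \<inter> W)"
  by (rule bij_betw_same_card[OF bij_monomials_in])

text \<open>Every integer is \<open>q i + (q^k + 1) j\<close> for unique integers \<open>i\<close> and \<open>0 \<le> j < q\<close>; it is a pole order
  if and only if \<open>i \<ge> 0\<close>. Replacing \<open>(i, j)\<close> by \<open>(- 1 - i, q - 1 - j)\<close> shows that the semigroup is
  symmetric.\<close>

lemma pole_orders_iff: "a \<in> pole_orders \<longleftrightarrow> (q ^ k + 1) * (a mod q) \<le> a"
proof
  have qk: "q ^ k = q * q ^ (k - 1)" using k_pos by (cases k) auto
  {
    assume "a \<in> pole_orders"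
    then obtain i j where ij: "j < q" "a = weight (i, j)" by (auto simp: pole_orders_def)
    have "a = j + q * (i + q ^ (k - 1) * j)" by (simp add: ij(2) weight_def qk algebra_simps)
    then have "a mod q = j" using ij(1) by simp
    then show "(q ^ k + 1) * (a mod q) \<le> a" using ij(2) by (simp add: weight_def)
  }
  assume le: "(q ^ k + 1) * (a mod q) \<le> a"
  define j where "j = a mod q"
  have "a = q * (a div q) + j" by (simp add: j_def)
  moreover have "(q ^ k + 1) * j = q * (q ^ (k - 1) * j) + j" by (simp add: qk algebra_simps)
  ultimately have eq: "a - (q ^ k + 1) * j = q * (a div q - q ^ (k - 1) * j)"
    by (metis add_diff_cancel_right diff_mult_distrib2)
  have "a = weight (a div q - q ^ (k - 1) * j, j)"
    using eq le by (simp add: weight_def j_def)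
  moreover have "j < q" using q_gt_1 by (simp add: j_def)
  ultimately show "a \<in> pole_orders" by (auto simp: pole_orders_def)
qed

lemma pole_orders_symmetric:
  assumes "a < (q - 1) * q ^ k"
  shows "a \<in> pole_orders \<longleftrightarrow> (q - 1) * q ^ k - 1 - a \<notin> pole_orders"
proof -
  define a' where "a' = (q - 1) * q ^ k - 1 - a"
  define j where "j = a mod q"
  define i where "i = int (a div q) - int (q ^ (k - 1)) * int j"
  have qk: "q ^ k = q * q ^ (k - 1)" using k_pos by (cases k) auto
  have j: "j < q" using q_gt_1 by (simp add: j_def)
  have a: "int a = int q * i + int (q ^ k + 1) * int j"
  proof -
    have "int a = int q * int (a div q) + int j"
      by (metis j_def div_mult_mod_eq mult.commute of_nat_add of_nat_mult)
    then show ?thesis by (simp add: i_def qk algebra_simps)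
  qed
  have a': "int a' = int (q - 1) * int (q ^ k) - 1 - int a" using assms by (simp add: a'_def of_nat_diff)
  have a'2: "int a' = int q * (- 1 - i) + int (q ^ k + 1) * int (q - 1 - j)"
  proof -
    have e: "int (q - 1) = int q - 1" "int (q - 1 - j) = int q - 1 - int j" using j by auto
    show ?thesis unfolding a' a e by (simp add: algebra_simps)
  qed
  have "a' mod q = q - 1 - j"
  proof -
    have "int a' = int (q - 1 - j) + int q * (- 1 - i + int (q ^ (k - 1)) * int (q - 1 - j))"
      unfolding a'2 by (simp add: qk algebra_simps)
    then have "int a' mod int q = int (q - 1 - j) mod int q" by (metis mod_mult_self2)
    also have "\<dots> = int (q - 1 - j)" using q_gt_1 by (intro mod_pos_pos_trivial) auto
    finally show ?thesis by (simp flip: of_nat_mod)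
  qed
  then have "a' \<in> pole_orders \<longleftrightarrow> int (q ^ k + 1) * int (q - 1 - j) \<le> int a'"
    by (simp only: pole_orders_iff of_nat_mult[symmetric] of_nat_le_iff)
  also have "\<dots> \<longleftrightarrow> - 1 - i \<ge> 0" unfolding a'2 using q_gt_1 by (simp add: zero_le_mult_iff)
  finally have A: "a' \<in> pole_orders \<longleftrightarrow> i < 0" by linarith
  have "a \<in> pole_orders \<longleftrightarrow> int (q ^ k + 1) * int j \<le> int a"
    by (simp only: pole_orders_iff j_def of_nat_mult[symmetric] of_nat_le_iff)
  also have "\<dots> \<longleftrightarrow> i \<ge> 0" unfolding a using q_gt_1 by (simp add: zero_le_mult_iff)
  finally show ?thesis using A unfolding a'_def by linarith
qed

lemma pole_orders_large:
  assumes "(q - 1) * q ^ k \<le> a"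
  shows "a \<in> pole_orders"
proof -
  define j where "j = a mod q"
  have qk: "q ^ k = q * q ^ (k - 1)" using k_pos by (cases k) auto
  have "j < q" using q_gt_1 by (simp add: j_def)
  then have "j \<le> q - 1" by simp
  then have "q ^ k * j \<le> q ^ k * (q - 1)" by (rule mult_le_mono2)
  also have "\<dots> \<le> a" using assms by (simp only: mult.commute)
  finally have le: "q * (q ^ (k - 1) * j) \<le> a" unfolding qk by (simp only: mult.assoc)
  then have "q ^ (k - 1) * j \<le> a div q" using q_gt_1 by (simp add: less_eq_div_iff_mult_less_eq mult.commute)
  then have "q * (q ^ (k - 1) * j) \<le> q * (a div q)" by simp
  then have "q ^ k * j + j \<le> q * (a div q) + a mod q" unfolding qk j_def mult.assoc by (rule add_le_mono1)
  also have "\<dots> = a" by (rule mult_div_mod_eq)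
  finally show ?thesis unfolding pole_orders_iff j_def[symmetric] by (simp add: algebra_simps)
qed

text \<open>By symmetry, half of the numbers below \<open>2g\<close> are pole orders, and all numbers from \<open>2g\<close> on are.\<close>

lemma card_pole_orders:
  assumes g: "2 * g = (q - 1) * q ^ k" and M: "2 * g \<le> M + 1"
  shows "card (pole_orders \<inter> {..M}) + g = M + 1"
proof -
  define g2 where "g2 = (q - 1) * q ^ k"
  have sym: "g2 - Suc a \<in> pole_orders \<longleftrightarrow> a \<notin> pole_orders" if "a < g2" for a
    using pole_orders_symmetric[of a] that by (simp only: g2_def diff_diff_left plus_1_eq_Suc) blast
  have "card (pole_orders \<inter> {..<g2}) = card ({..<g2} - pole_orders)"
    by (rule bij_betw_same_card[of "\<lambda>a. g2 - Suc a"], rule bij_betwI[of _ _ _ "\<lambda>a. g2 - Suc a"])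
       (auto simp: sym)
  moreover have "card (pole_orders \<inter> {..<g2}) + card ({..<g2} - pole_orders) = g2"
    using card_Int_Diff[of "{..<g2}" pole_orders] by (simp add: Int_commute)
  ultimately have low: "card (pole_orders \<inter> {..<g2}) = g" using g by (simp add: g2_def)
  have "pole_orders \<inter> {..M} = (pole_orders \<inter> {..<g2}) \<union> {g2..M}"
    using pole_orders_large M g by (auto simp: g2_def)
  moreover have "card ((pole_orders \<inter> {..<g2}) \<union> {g2..M}) = card (pole_orders \<inter> {..<g2}) + card {g2..M}"
    by (rule card_Un_disjoint) auto
  ultimately have "card (pole_orders \<inter> {..M}) = g + card {g2..M}" using low by simp
  then show ?thesis using M g by (simp add: g2_def)
qed

lemma card_L_space:
  fixes g :: nat
  assumes "2 * g = (q - 1) * q ^ k" and "2 * g \<le> m + 1"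
  shows "card (L_space m) = CARD('a) ^ (m + 1 - g)"
proof -
  let ?I = "monomials_in {..m}"
  have fin: "finite ?I" by (rule finite_monomials_in) simp
  have sub: "?I \<subseteq> {(i, j). j < q}" by (auto simp: monomials_in_def)
  have "bij_betw (of_coeffs ?I) (?I \<rightarrow>\<^sub>E UNIV) (L_space m)"
  proof (rule bij_betw_imageI)
    show "inj_on (of_coeffs ?I) (?I \<rightarrow>\<^sub>E UNIV)"
    proof (rule inj_onI)
      fix c d assume c: "c \<in> ?I \<rightarrow>\<^sub>E UNIV" "d \<in> ?I \<rightarrow>\<^sub>E UNIV" and eq: "of_coeffs ?I c = of_coeffs ?I d"
      have "c (i, j) = d (i, j)" if "(i, j) \<in> ?I" for i j
        using coeff_of_coeffs[OF fin, of c j i] coeff_of_coeffs[OF fin, of d j i] eq that by simp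
      then show "c = d" using c by (intro PiE_ext[of c ?I "\<lambda>_. UNIV" d]) auto
    qed
    show "of_coeffs ?I ` (?I \<rightarrow>\<^sub>E UNIV) = L_space m"
    proof (intro equalityI subsetI)
      fix F assume "F \<in> of_coeffs ?I ` (?I \<rightarrow>\<^sub>E UNIV)"
      then show "F \<in> L_space m"
        using reduced_of_coeffs[OF fin sub]
        by (auto simp: L_space_def bounded_pole_def coeff_of_coeffs[OF fin] split: if_splits)
           (simp add: monomials_in_def)
    next
      fix F assume F: "F \<in> L_space m"
      let ?c = "restrict (\<lambda>(i, j). coeff (coeff F j) i) ?I"
      have "coeff (coeff (of_coeffs ?I ?c) j) i = coeff (coeff F j) i" for i j
      proof (cases "(i, j) \<in> ?I")
        case False
        have "coeff (coeff F j) i = 0"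
        proof (rule ccontr)
          assume "coeff (coeff F j) i \<noteq> 0"
          then have "(i, j) \<in> ?I" using F reduced_monomials[of F]
            by (auto simp: L_space_def bounded_pole_def monomials_in_def monomials_def)
          with False show False by simp
        qed
        then show ?thesis using False by (simp add: coeff_of_coeffs[OF fin])
      qed (simp add: coeff_of_coeffs[OF fin])
      then have "of_coeffs ?I ?c = F" by (simp add: poly_eq_iff)
      then show "F \<in> of_coeffs ?I ` (?I \<rightarrow>\<^sub>E UNIV)" by (intro image_eqI[of _ _ ?c]) auto
    qed
  qed
  then have "card (L_space m) = card (?I \<rightarrow>\<^sub>E (UNIV :: 'a set))" by (simp add: bij_betw_same_card)
  also have "\<dots> = CARD('a) ^ card ?I" using fin by (simp add: card_PiE)
  also have "card ?I = m + 1 - g" using card_pole_orders[OF assms] card_monomials_in[of "{..m}"] by simp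
  finally show ?thesis .
qed

end

section \<open>Power sums\<close>

text \<open>The power sum of exponent \<open>l\<close> over a set that is stable under its nonzero elements vanishes
  unless every nonzero element is an \<open>l\<close>-th root of unity, for which there are too many of them.\<close>

lemma power_sum_eq_0:
  fixes S :: "'a::field set"
  assumes "finite S" and char: "of_nat (card S) = (0 :: 'a)"
    and bij: "\<And>u. u \<in> S \<Longrightarrow> u \<noteq> 0 \<Longrightarrow> bij_betw (\<lambda>c. u * c) S S" and l: "l + 1 < card S"
  shows "(\<Sum>c\<in>S. c ^ l) = 0"
proof (cases "l = 0")
  case True
  then show ?thesis using char by simp
next
  case False
  let ?P = "monom 1 l - 1 :: 'a poly"
  have "coeff ?P l = 1" using False by simp
  then have nz: "?P \<noteq> 0" by (metis coeff_0 zero_neq_one)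
  have "degree ?P \<le> l" by (intro degree_diff_le) (auto simp: degree_monom_eq)
  then have le: "card {c. poly ?P c = 0} \<le> l" using card_poly_roots_bound[OF nz] by linarith
  have "\<not> S - {0} \<subseteq> {c. poly ?P c = 0}"
  proof
    assume "S - {0} \<subseteq> {c. poly ?P c = 0}"
    then have "card (S - {0}) \<le> card {c. poly ?P c = 0}" using poly_roots_finite[OF nz] by (intro card_mono)
    then have "card (S - {0}) \<le> l" using le by simp
    moreover have "card S \<le> card (insert 0 (S - {0}))" using \<open>finite S\<close> by (intro card_mono) auto
    moreover have "card (insert 0 (S - {0})) = Suc (card (S - {0}))"
      by (rule card_insert_disjoint) (use \<open>finite S\<close> in auto)
    ultimately show False using l by linarith
  qed
  then obtain u where u: "u \<in> S" "u \<noteq> 0" "u ^ l \<noteq> 1" by (auto simp: poly_monom)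
  show ?thesis by (rule sum_eq_0_if_rescaled[OF bij[OF u(1,2)] _ u(3)]) (simp add: power_mult_distrib)
qed

lemma sum_poly_eq_0:
  fixes P :: "'a::{field,finite} poly"
  assumes "degree P + 1 < CARD('a)"
  shows "(\<Sum>a\<in>UNIV. poly P a) = 0"
proof -
  have *: "(\<Sum>a\<in>UNIV. a ^ i) = (0 :: 'a)" if "i \<le> degree P" for i
  proof (rule power_sum_eq_0)
    show "bij_betw (\<lambda>c. u * c) UNIV UNIV" if "u \<noteq> 0" for u :: 'a
      by (rule bij_betwI[of _ _ _ "\<lambda>c. c / u"]) (use that in auto)
  qed (use that assms of_nat_card_eq_0 in auto)
  have "(\<Sum>a\<in>UNIV. poly P a) = (\<Sum>i\<le>degree P. coeff P i * (\<Sum>a\<in>UNIV. a ^ i))"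
    unfolding poly_altdef by (subst sum.swap) (simp add: sum_distrib_left)
  then show ?thesis using * by simp
qed

section \<open>The abscissas of the rational points\<close>

text \<open>The finite field enters through its type only, which is therefore a parameter of the locale. The
  number \<open>s\<close> is the exponent of \<open>q\<close> as a power of the characteristic.\<close>

locale rational_points =
  fixes q k s :: nat and a_type :: "'a::{field,finite} itself"
  assumes q_power: "q = CHAR('a) ^ s" and s_pos: "s > 0" and k_pos: "k > 0"
    and card: "CARD('a) = q ^ (2 * k)" and char_2k: "\<not> CHAR('a) dvd 2 * k"
begin

lemma q_gt_1: "q > 1"
  unfolding q_power using prime_CHAR_finite[where 'a='a] s_pos prime_gt_1_nat by (intro one_less_power) auto

abbreviation "d \<equiv> q ^ (k - 1) * (q ^ k + 1)"

lemma qk: "q ^ k = q * q ^ (k - 1)" using k_pos by (cases k) auto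

lemma q_2k: "q ^ (2 * k) = q ^ k * q ^ k"
  by (simp add: mult_2 power_add)

lemma q_d: "q * d = q ^ (2 * k) + q ^ k"
proof -
  have "q * d = q ^ k * (q ^ k + 1)" by (simp only: qk mult.assoc)
  also have "\<dots> = q ^ (2 * k) + q ^ k" by (simp add: q_2k distrib_left)
  finally show ?thesis .
qed

lemma frobenius: "(u + v :: 'a) ^ (q ^ i) = u ^ (q ^ i) + v ^ (q ^ i)"
  by (rule freshmans_dream'[OF prime_CHAR_finite, of _ "s * i"]) (simp add: q_power power_mult)

lemma frobenius_poly: "(u + v :: 'a poly) ^ (q ^ i) = u ^ (q ^ i) + v ^ (q ^ i)"
  by (rule freshmans_dream'[of _ "s * i"]) (use prime_CHAR_finite[where 'a='a] in \<open>simp_all add: q_power power_mult\<close>)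

lemma frobenius_minus: "(u - v :: 'a) ^ (q ^ i) = u ^ (q ^ i) - v ^ (q ^ i)"
  using frobenius[of "u - v" v i] by simp

lemma frobenius_sum: "(\<Sum>j\<in>I. f j :: 'a) ^ q = (\<Sum>j\<in>I. f j ^ q)"
  using q_gt_1 by (induction I rule: infinite_finite_induct) (simp_all add: frobenius[of _ _ 1, simplified])

lemma frobenius_poly_sum: "(\<Sum>j\<in>I. f j :: 'a poly) ^ q = (\<Sum>j\<in>I. f j ^ q)"
  using q_gt_1 by (induction I rule: infinite_finite_induct) (simp_all add: frobenius_poly[of _ _ 1, simplified])

lemma power_card: "(a :: 'a) ^ (q ^ (2 * k)) = a"
  using finite_field_power_card[of a] by (simp add: card)

lemma of_nat_power: "(of_nat n :: 'a) ^ (q ^ i) = of_nat n"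
  using q_gt_1 by (induction n) (simp_all add: frobenius)

lemma two_nonzero: "(2 :: 'a) \<noteq> 0"
proof
  assume "(2 :: 'a) = 0"
  then have "of_nat 2 = (0 :: 'a)" by simp
  then have "CHAR('a) dvd 2" using of_nat_eq_0_iff_char_dvd by blast
  then show False using char_2k by simp
qed

lemma two_power: "(2 :: 'a) ^ (q ^ i) = 2"
  using of_nat_power[of 2 i] by simp

lemma half_power: "(1 / 2 :: 'a) ^ (q ^ i) = 1 / 2"
  using two_power[of i] by (simp add: power_divide)

subsection \<open>Trace and solvability\<close>

definition Fq :: "'a set" where
  "Fq = {c. c ^ q = c}"

text \<open>The Artin-Schreier map: the points above \<open>x = a\<close> are the preimages of \<open>H(a)\<close>.\<close>

definition AS :: "'a \<Rightarrow> 'a" where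
  "AS b = b ^ q - b"

text \<open>The trace to the field of \<open>q\<close> elements.\<close>

definition Tr :: "'a \<Rightarrow> 'a" where
  "Tr z = (\<Sum>i<2*k. z ^ (q ^ i))"

lemma Tr_add: "Tr (u + v) = Tr u + Tr v"
  by (simp add: Tr_def frobenius sum.distrib)

lemma Tr_power: "Tr z ^ q = Tr z"
proof -
  have "Tr z ^ q + z = (\<Sum>i<2*k. z ^ (q ^ Suc i)) + z ^ (q ^ 0)"
    by (simp add: Tr_def frobenius_sum mult.commute flip: power_mult)
  also have "\<dots> = (\<Sum>i<Suc (2*k). z ^ (q ^ i))" by (subst sum.lessThan_Suc_shift) simp
  also have "\<dots> = Tr z + z" by (simp add: Tr_def power_card)
  finally show ?thesis by simp
qed

lemma Tr_AS: "Tr (AS b) = 0"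
proof -
  have "Tr (b ^ q) = Tr b ^ q" by (simp add: Tr_def frobenius_sum mult.commute flip: power_mult)
  moreover have "Tr (b ^ q) = Tr (AS b) + Tr b" using Tr_add[of "AS b" b] by (simp add: AS_def)
  ultimately show ?thesis using Tr_power[of b] by simp
qed

lemma card_Tr_kernel: "card {z. Tr z = 0} \<le> q ^ (2 * k - 1)"
proof -
  define P :: "'a poly" where "P = (\<Sum>i<2*k. monom 1 (q ^ i))"
  have "coeff P (q ^ (2 * k - 1)) = (\<Sum>i<2*k. if i = 2 * k - 1 then 1 else 0)"
    unfolding P_def coeff_sum by (rule sum.cong) (use q_gt_1 in \<open>auto simp: power_inject_exp\<close>)
  also have "\<dots> = 1" using k_pos by (simp add: sum.delta)
  finally have nz: "P \<noteq> 0" by auto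
  have "degree P \<le> q ^ (2 * k - 1)"
    unfolding P_def using q_gt_1
    by (intro degree_sum_le) (auto simp: degree_monom_eq intro!: power_increasing)
  moreover have "{z. Tr z = 0} = {z. poly P z = 0}" by (simp add: P_def Tr_def poly_sum poly_monom)
  ultimately show ?thesis using card_poly_roots_bound[OF nz] by simp
qed

lemma AS_fibre: "{b. AS b = AS b0} = (\<lambda>c. b0 + c) ` Fq"
proof -
  have "AS b = AS b0 \<longleftrightarrow> b - b0 \<in> Fq" for b
  proof -
    have "AS b - AS b0 = (b - b0) ^ q - (b - b0)"
      using frobenius_minus[of b b0 1] by (simp add: AS_def)
    then show ?thesis unfolding Fq_def mem_Collect_eq by (metis right_minus_eq)
  qed
  then have "{b. AS b = AS b0} = {b. b - b0 \<in> Fq}" by simp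
  also have "\<dots> = (\<lambda>c. b0 + c) ` Fq"
    by (auto intro!: image_eqI[of _ _ "_ - b0"])
  finally show ?thesis .
qed

text \<open>The Artin-Schreier map takes values in the kernel of the trace, which has at most \<open>q^(2k-1)\<close>
  elements, and its own kernel \<open>Fq\<close> has at most \<open>q\<close> elements. As the product of the sizes of its
  image and its kernel is \<open>q^(2k)\<close>, all inequalities are equalities.\<close>

lemma Fq_card: "card Fq = q" and AS_range: "range AS = {z. Tr z = 0}"
proof -
  let ?P = "monom 1 q - monom 1 1 :: 'a poly"
  have "coeff ?P q = 1" using q_gt_1 by simp
  then have nz: "?P \<noteq> 0" by (metis coeff_0 zero_neq_one)
  have "degree ?P \<le> q" using q_gt_1 by (intro degree_diff_le) (auto simp: degree_monom_eq)
  moreover have "Fq = {c. poly ?P c = 0}" by (auto simp: Fq_def poly_monom)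
  then have "card Fq \<le> degree ?P" using card_poly_roots_bound[OF nz] by (simp only:)
  ultimately have le: "card Fq \<le> q" by linarith
  have sub: "range AS \<subseteq> {z. Tr z = 0}" using Tr_AS by auto
  have "CARD('a) = (\<Sum>z\<in>range AS. card {b \<in> UNIV. AS b = z})"
    using sum.image_gen[of "UNIV :: 'a set" "\<lambda>_. 1 :: nat" AS] by simp
  also have "\<dots> = (\<Sum>z\<in>range AS. card Fq)"
  proof (rule sum.cong)
    fix z assume "z \<in> range AS"
    then obtain b0 where "z = AS b0" by blast
    then show "card {b \<in> UNIV. AS b = z} = card Fq" using AS_fibre[of b0] by (simp add: card_image)
  qed simp
  finally have prod: "q ^ (2 * k) = card (range AS) * card Fq" by (simp add: card)
  have "card (range AS) \<le> card {z. Tr z = 0}" by (rule card_mono[OF _ sub]) simp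
  then have le2: "card (range AS) \<le> q ^ (2 * k - 1)" using card_Tr_kernel by linarith
  have qq: "q ^ (2 * k) = q ^ (2 * k - 1) * q" using power_minus_mult[of "2 * k" q] k_pos by simp
  have pos: "q ^ (2 * k - 1) > 0" using q_gt_1 by simp
  show Fq: "card Fq = q"
  proof (rule antisym[OF le])
    have "q ^ (2 * k - 1) * q \<le> q ^ (2 * k - 1) * card Fq"
      using prod qq mult_le_mono1[OF le2, of "card Fq"] by simp
    then show "q \<le> card Fq" using pos by (simp only: mult_le_cancel1)
  qed
  have "card (range AS) = q ^ (2 * k - 1)" using prod qq q_gt_1 unfolding Fq by simp
  then show "range AS = {z. Tr z = 0}" using card_Tr_kernel by (intro card_seteq[OF _ sub]) auto
qed

text \<open>Expand by the binomial theorem: among the exponents below \<open>q\<close>, only \<open>q - 1\<close> has a nonzero power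
  sum over \<open>Fq\<close>.\<close>

lemma fibre_power_sum:
  shows "j + 1 < q \<Longrightarrow> (\<Sum>c\<in>Fq. (b + c) ^ j) = 0"
    and "(\<Sum>c\<in>Fq. (b + c) ^ (q - 1)) = (\<Sum>c\<in>Fq. c ^ (q - 1))"
proof -
  have z: "(\<Sum>c\<in>Fq. c ^ l) = 0" if "l + 1 < q" for l
  proof (rule power_sum_eq_0)
    show "of_nat (card Fq) = (0 :: 'a)"
      unfolding Fq_card of_nat_eq_0_iff_char_dvd unfolding q_power using s_pos by (simp add: dvd_power)
    fix u assume u: "u \<in> Fq" "u \<noteq> 0"
    show "bij_betw (\<lambda>c. u * c) Fq Fq"
      by (rule bij_betwI[of _ _ _ "\<lambda>c. c / u"])
         (use u in \<open>auto simp: Fq_def power_mult_distrib power_divide\<close>)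
  qed (use that in \<open>simp_all add: Fq_card\<close>)
  have e: "(\<Sum>c\<in>Fq. (b + c) ^ j) = (\<Sum>l\<le>j. of_nat (j choose l) * b ^ (j - l) * (\<Sum>c\<in>Fq. c ^ l))" for j
  proof -
    have "(\<Sum>c\<in>Fq. (b + c) ^ j) = (\<Sum>c\<in>Fq. \<Sum>l\<le>j. of_nat (j choose l) * c ^ l * b ^ (j - l))"
      by (simp add: binomial_ring add.commute[of b])
    also have "\<dots> = (\<Sum>l\<le>j. of_nat (j choose l) * b ^ (j - l) * (\<Sum>c\<in>Fq. c ^ l))"
      by (subst sum.swap) (simp add: sum_distrib_left mult_ac)
    finally show ?thesis .
  qed
  show "(\<Sum>c\<in>Fq. (b + c) ^ j) = 0" if "j + 1 < q"
    unfolding e using that z by (intro sum.neutral) auto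
  have "{..q - 1} = insert (q - 1) {..<q - 1}" by auto
  then have "(\<Sum>c\<in>Fq. (b + c) ^ (q - 1)) = (\<Sum>c\<in>Fq. c ^ (q - 1))
      + (\<Sum>l<q - 1. of_nat (q - 1 choose l) * b ^ (q - 1 - l) * (\<Sum>c\<in>Fq. c ^ l))"
    unfolding e by simp
  also have "(\<Sum>l<q - 1. of_nat (q - 1 choose l) * b ^ (q - 1 - l) * (\<Sum>c\<in>Fq. c ^ l)) = 0"
    by (intro sum.neutral) (use z in auto)
  finally show "(\<Sum>c\<in>Fq. (b + c) ^ (q - 1)) = (\<Sum>c\<in>Fq. c ^ (q - 1))" by simp
qed

subsection \<open>The zeros of the trace polynomial\<close>

text \<open>The polynomial of degree \<open>d\<close> that represents the function \<open>Tr (H(x))\<close>.\<close>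

definition tau :: "'a poly" where
  "tau = (\<Sum>j<k. monom 2 (q ^ j * (q ^ k + 1))) + (\<Sum>j<2*k. monom 1 (q ^ j))"

definition Z :: "'a set" where
  "Z = {a. poly tau a = 0}"

text \<open>The first summand of \<open>H(x)\<close> is a norm, which lies in the field of \<open>q^k\<close> elements; so each of the
  first \<open>k\<close> terms of its trace occurs twice.\<close>

lemma poly_tau: "poly tau a = Tr (H_poly q k a)"
proof -
  define c where "c = a ^ (q ^ k + 1)"
  have ck: "c ^ (q ^ k) = c"
  proof -
    have e: "(q ^ k + 1) * q ^ k = q ^ (2 * k) + q ^ k" by (simp add: q_2k)
    have "c ^ (q ^ k) = a ^ ((q ^ k + 1) * q ^ k)" unfolding c_def by (simp only: power_mult)
    also have "\<dots> = a ^ (q ^ (2 * k)) * a ^ (q ^ k)" by (simp only: e power_add)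
    finally have "c ^ (q ^ k) = a ^ (q ^ (2 * k)) * a ^ (q ^ k)" .
    then show ?thesis by (simp add: c_def power_card)
  qed
  have "(\<Sum>i<2*k. c ^ (q ^ i)) = (\<Sum>i<k. c ^ (q ^ i)) + (\<Sum>i<k. c ^ (q ^ (k + i)))"
    using sum.nat_group[of "\<lambda>i. c ^ (q ^ i)" k 2]
    by (simp add: mult_2 sum.lessThan_Suc lessThan_Suc_atMost[symmetric] numeral_2_eq_2)
       (simp add: sum.atLeastLessThan_concat[symmetric, of 0 k "k + k"] lessThan_atLeast0 sum.shift_bounds_nat_ivl[of _ 0 k k, simplified] add.commute)
  also have "(\<Sum>i<k. c ^ (q ^ (k + i))) = (\<Sum>i<k. c ^ (q ^ i))"
  proof (rule sum.cong)
    fix i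
    have "c ^ (q ^ (k + i)) = (c ^ (q ^ k)) ^ (q ^ i)" by (simp add: power_add power_mult)
    then show "c ^ (q ^ (k + i)) = c ^ (q ^ i)" by (simp add: ck)
  qed simp
  finally have "Tr c = (\<Sum>i<k. 2 * c ^ (q ^ i))" by (simp add: Tr_def sum.distrib[symmetric])
  also have "\<dots> = (\<Sum>i<k. 2 * a ^ (q ^ i * (q ^ k + 1)))"
    unfolding c_def power_mult[symmetric] by (simp only: mult.commute)
  finally have Tr_c: "Tr c = (\<Sum>i<k. 2 * a ^ (q ^ i * (q ^ k + 1)))" .
  have "poly tau a = Tr c + Tr a"
    unfolding tau_def Tr_c by (simp only: poly_add poly_sum poly_monom Tr_def mult_1)
  then show ?thesis by (simp only: H_poly_def c_def Tr_add)
qed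

lemma exponent_less: "j < 2 * k \<Longrightarrow> q ^ j < d"
proof -
  assume "j < 2 * k"
  then have "q ^ j \<le> q ^ (2 * k - 1)" using q_gt_1 by (intro power_increasing) auto
  also have "q ^ (2 * k - 1) = q ^ (k - 1) * q ^ k" using k_pos by (simp add: mult_2 flip: power_add)
  also have "\<dots> < d" using q_gt_1 by simp
  finally show ?thesis .
qed

lemma degree_tau_le: "degree tau \<le> d"
proof -
  have "degree (\<Sum>j<k. monom (2 :: 'a) (q ^ j * (q ^ k + 1))) \<le> d"
  proof (rule degree_sum_le)
    fix j assume "j \<in> {..<k}"
    then have "q ^ j \<le> q ^ (k - 1)" using q_gt_1 by (intro power_increasing) auto
    then have "q ^ j * (q ^ k + 1) \<le> d" by (rule mult_le_mono1)
    then show "degree (monom (2 :: 'a) (q ^ j * (q ^ k + 1))) \<le> d"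
      using degree_monom_le order_trans by blast
  qed simp
  moreover have "degree (\<Sum>j<2*k. monom (1 :: 'a) (q ^ j)) \<le> d"
    by (rule degree_sum_le) (use exponent_less in \<open>auto simp: degree_monom_eq less_imp_le\<close>)
  ultimately show ?thesis unfolding tau_def by (rule degree_add_le)
qed

lemma coeff_tau: "coeff tau d = 2"
proof -
  have "coeff (\<Sum>j<k. monom (2 :: 'a) (q ^ j * (q ^ k + 1))) d = (\<Sum>j<k. if j = k - 1 then 2 else 0)"
    unfolding coeff_sum
  proof (rule sum.cong)
    fix j
    have "q ^ j * (q ^ k + 1) = d \<longleftrightarrow> q ^ j = q ^ (k - 1)" unfolding mult_cancel2 by simp
    then have "q ^ j * (q ^ k + 1) = d \<longleftrightarrow> j = k - 1" using q_gt_1 by (simp only: power_inject_exp)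
    then show "coeff (monom (2 :: 'a) (q ^ j * (q ^ k + 1))) d = (if j = k - 1 then 2 else 0)" by simp
  qed simp
  moreover have "coeff (\<Sum>j<2*k. monom (1 :: 'a) (q ^ j)) d = 0"
    unfolding coeff_sum by (rule sum.neutral) (use exponent_less in fastforce)
  ultimately show ?thesis unfolding tau_def coeff_add using k_pos by (simp add: sum.delta)
qed

lemma degree_tau: "degree tau = d" and tau_nonzero: "tau \<noteq> 0"
proof -
  have nz: "coeff tau d \<noteq> 0" using coeff_tau two_nonzero by simp
  show "degree tau = d" using degree_tau_le le_degree[OF nz] by (rule antisym)
  show "tau \<noteq> 0" using nz by auto
qed

lemma tau_power: "poly tau a ^ q = poly tau a"
  by (simp add: poly_tau Tr_power)

text \<open>Over the field of \<open>q^(2k)\<close> elements the function \<open>tau\<close> takes values in the field of \<open>q\<close>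
  elements, so \<open>x^(q^(2k)) - x\<close> divides \<open>tau^q - tau\<close>; the cofactor has the single root \<open>-1/2\<close>.\<close>

lemma tau_identity:
  "tau * (tau ^ (q - 1) - 1) = (monom 1 (q ^ (2 * k)) - monom 1 1)
      * smult 2 ([:1 / 2, 1:] ^ (q ^ k))"
proof -
  define f where "f j = (monom 2 (q ^ j * (q ^ k + 1)) :: 'a poly)" for j
  define h where "h j = (monom 1 (q ^ j) :: 'a poly)" for j
  have tau: "tau = (\<Sum>j<k. f j) + (\<Sum>j<2*k. h j)" by (simp add: tau_def f_def h_def)
  have 2: "(2 :: 'a) ^ q = 2" using two_power[of 1] by simp
  have "f j ^ q = f (Suc j)" "h j ^ q = h (Suc j)" for j
    by (simp_all add: f_def h_def monom_power 2 mult_ac)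
  then have "tau ^ q = (\<Sum>j<k. f (Suc j)) + (\<Sum>j<2*k. h (Suc j))"
    unfolding tau using frobenius_poly[of _ _ 1] by (simp add: frobenius_poly_sum)
  then have "tau ^ q - tau = (\<Sum>j<k. f (Suc j) - f j) + (\<Sum>j<2*k. h (Suc j) - h j)"
    unfolding tau by (simp add: sum_subtractf)
  also have "\<dots> = (f k - f 0) + (h (2 * k) - h 0)" by (simp only: sum_lessThan_telescope)
  also have "\<dots> = (monom 1 (q ^ (2 * k)) - monom 1 1) * (monom 2 (q ^ k) + 1)"
  proof -
    have e: "q ^ k * (q ^ k + 1) = q ^ (2 * k) + q ^ k" by (simp add: q_2k distrib_left)
    have "f k = monom 1 (q ^ (2 * k)) * monom 2 (q ^ k)"
      unfolding f_def e by (simp add: mult_monom)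
    moreover have "f 0 = monom 1 1 * monom 2 (q ^ k)"
      by (simp add: f_def mult_monom)
    ultimately show ?thesis by (simp add: h_def algebra_simps)
  qed
  also have "monom 2 (q ^ k) + 1 = smult 2 ([:1 / 2, 1 :: 'a:] ^ (q ^ k))"
  proof -
    have "[:1 / 2, 1 :: 'a:] = [:1 / 2:] + monom 1 1" by (simp add: monom_altdef)
    then have "[:1 / 2, 1 :: 'a:] ^ (q ^ k) = [:1 / 2:] ^ (q ^ k) + monom 1 1 ^ (q ^ k)"
      by (simp only: frobenius_poly)
    also have "[:1 / 2 :: 'a:] ^ (q ^ k) = [:(1 / 2) ^ (q ^ k):]" by (simp add: poly_const_pow)
    finally show ?thesis using two_nonzero by (simp add: half_power monom_power smult_add_right smult_monom one_pCons)
  qed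
  also have "tau ^ q - tau = tau * (tau ^ (q - 1) - 1)"
    using q_gt_1 by (cases q) (simp_all add: algebra_simps)
  finally show ?thesis .
qed

text \<open>The value is \<open>- k / 2\<close>, the trace of \<open>H(-1/2) = - 1/4\<close>.\<close>

lemma tau_minus_half: "poly tau (- (1 / 2)) \<noteq> 0"
proof -
  have odd: "odd (q ^ k)"
  proof -
    have "odd CHAR('a)"
      using prime_CHAR_finite[where 'a='a] char_2k prime_odd_nat prime_ge_2_nat by (metis dvd_mult2 dvd_refl primes_dvd_imp_eq two_is_prime_nat)
    then show ?thesis by (simp add: q_power)
  qed
  have "(- (1 / 2) :: 'a) ^ (q ^ k) = - (1 / 2)" using odd half_power[of k] by (simp add: power_minus_odd)
  then have e: "H_poly q k (- (1 / 2) :: 'a) = 1 / 2 * (1 / 2) - 1 / 2" by (simp add: H_poly_def)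
  \<comment> \<open>Splitting \<open>1/2\<close> into two quarters avoids the numeral \<open>4\<close>.\<close>
  define h :: 'a where "h = 1 / 2 * (1 / 2)"
  have "(1 / 2 :: 'a) = 1 / 2 * (1 / 2 + 1 / 2)" using two_nonzero by simp
  then have h: "(1 / 2 :: 'a) = h + h" unfolding distrib_left h_def .
  have "1 / 2 * (1 / 2) - 1 / 2 = h - (h + h)" unfolding h_def[symmetric] using h by (simp only:)
  then have "H_poly q k (- (1 / 2) :: 'a) = h - (h + h)" using e by (simp only:)
  then have H: "H_poly q k (- (1 / 2) :: 'a) = - (1 / 2) * (1 / 2)" by (simp add: h_def)
  have oddi: "odd (q ^ i)" for i using odd k_pos by (cases "i = 0") auto
  have "(- (1 / 2) * (1 / 2) :: 'a) ^ (q ^ i) = - (1 / 2) * (1 / 2)" for i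
    by (simp only: power_mult_distrib power_minus_odd[OF oddi] half_power)
  then have "Tr (- (1 / 2) * (1 / 2)) = of_nat (2 * k) * (- (1 / 2) * (1 / 2))" by (simp add: Tr_def)
  moreover have "of_nat (2 * k) \<noteq> (0 :: 'a)" using char_2k of_nat_eq_0_iff_char_dvd by blast
  moreover have "(1 / 2 :: 'a) \<noteq> 0" using two_nonzero by simp
  ultimately show ?thesis unfolding poly_tau H by (metis mult_eq_0_iff neg_equal_0_iff_equal)
qed

text \<open>In \<open>tau_identity\<close>, the root \<open>-1/2\<close> of multiplicity \<open>q^k + 1\<close> belongs to the second factor \<open>\<sigma>\<close> on
  the left, as it is no root of \<open>tau\<close>. This leaves too few roots of \<open>\<sigma>\<close>: every element of the
  field is a root of \<open>tau\<close> or of \<open>\<sigma>\<close>, so \<open>tau\<close> has at least \<open>d\<close> roots.\<close>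

lemma card_Z: "card Z = d"
proof (rule antisym)
  show "card Z \<le> d" using card_poly_roots_bound[OF tau_nonzero] by (simp add: Z_def degree_tau)
  let ?\<sigma> = "tau ^ (q - 1) - 1"
  let ?w = "monom 1 (q ^ (2 * k)) - monom 1 1 :: 'a poly"
  define l where "l = [:1 / 2, 1 :: 'a:]"
  have l: "l = [:- (- (1 / 2)), 1:]" by (simp add: l_def)
  have roots: "poly tau a = 0 \<or> poly ?\<sigma> a = 0" for a
  proof -
    have "poly (tau * ?\<sigma>) a = 0" unfolding tau_identity by (simp add: poly_monom power_card)
    then show ?thesis by simp
  qed
  have d1: "d > 1"
  proof -
    have "q ^ (k - 1) \<ge> 1" "q ^ k + 1 > 1" using q_gt_1 by auto
    then show ?thesis by (metis One_nat_def Suc_leI less_le_trans mult_le_mono1 mult_1 )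
  qed
  have deg\<sigma>: "degree ?\<sigma> = (q - 1) * d"
  proof -
    have "degree (tau ^ (q - 1)) = (q - 1) * d" using tau_nonzero by (simp add: degree_power_eq degree_tau)
    moreover have "(q - 1) * d > 0" using q_gt_1 d1 by simp
    ultimately show ?thesis unfolding diff_conv_add_uminus by (subst degree_add_eq_left) simp_all
  qed
  have \<sigma>0: "?\<sigma> \<noteq> 0"
  proof
    assume "?\<sigma> = 0"
    then have "(q - 1) * d = 0" using deg\<sigma> by simp
    then show False using q_gt_1 d1 by simp
  qed
  have "l ^ (q ^ k + 1) dvd ?w * smult 2 (l ^ (q ^ k))"
  proof -
    have "l dvd ?w" unfolding l poly_eq_0_iff_dvd[symmetric] by (simp add: poly_monom power_card)
    moreover have "l ^ (q ^ k) dvd smult 2 (l ^ (q ^ k))" by (rule dvd_smult) simp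
    ultimately have "l * l ^ (q ^ k) dvd ?w * smult 2 (l ^ (q ^ k))" by (rule mult_dvd_mono)
    then show ?thesis by simp
  qed
  then have dvd: "l ^ (q ^ k + 1) dvd tau * ?\<sigma>" unfolding tau_identity l_def .
  have "l ^ (q ^ k + 1) dvd ?\<sigma>"
  proof -
    have nz: "tau * ?\<sigma> \<noteq> 0" using tau_nonzero \<sigma>0 by simp
    have "q ^ k + 1 \<le> order (- (1 / 2)) (tau * ?\<sigma>)" using dvd nz unfolding l order_divides by blast
    also have "\<dots> = order (- (1 / 2)) tau + order (- (1 / 2)) ?\<sigma>" by (rule order_mult[OF nz])
    also have "order (- (1 / 2)) tau = 0" using tau_minus_half by (simp add: order_root)
    finally have "q ^ k + 1 \<le> order (- (1 / 2)) ?\<sigma>" by simp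
    then have "[:- (- (1 / 2)), 1:] ^ (q ^ k + 1) dvd ?\<sigma>" using order_divides by blast
    then show ?thesis by (simp only: l)
  qed
  then obtain \<rho> where \<rho>: "?\<sigma> = l ^ (q ^ k + 1) * \<rho>" by (rule dvdE)
  have \<rho>0: "\<rho> \<noteq> 0" using \<sigma>0 \<rho> by auto
  have l0: "l \<noteq> 0" and l1: "degree l = 1" by (simp_all add: l_def)
  have "degree (l ^ (q ^ k + 1)) = q ^ k + 1" unfolding degree_power_eq[OF l0] l1 by simp
  moreover have "l ^ (q ^ k + 1) \<noteq> 0" using l0 by (rule power_not_zero)
  ultimately have "degree ?\<sigma> = (q ^ k + 1) + degree \<rho>"
    unfolding \<rho> using \<rho>0 degree_mult_eq[of "l ^ (q ^ k + 1)" \<rho>] by simp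
  then have deg\<rho>: "degree \<rho> + (q ^ k + 1) = (q - 1) * d" using deg\<sigma> by simp
  have "(UNIV :: 'a set) \<subseteq> Z \<union> ({- (1 / 2)} \<union> {a. poly \<rho> a = 0})"
  proof
    fix a :: 'a
    show "a \<in> Z \<union> ({- (1 / 2)} \<union> {a. poly \<rho> a = 0})"
    proof (cases "poly tau a = 0")
      case False
      then have "poly l a = 0 \<or> poly \<rho> a = 0" using roots[of a] unfolding \<rho> by auto
      then show ?thesis by (auto simp: l_def eq_neg_iff_add_eq_0 add.commute)
    qed (simp add: Z_def)
  qed
  then have "CARD('a) \<le> card (Z \<union> ({- (1 / 2)} \<union> {a. poly \<rho> a = 0}))" by (intro card_mono) auto
  also have "\<dots> \<le> card Z + (1 + card {a. poly \<rho> a = 0})"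
    by (intro order_trans[OF card_Un_le] add_mono) (auto intro: order_trans[OF card_Un_le])
  also have "\<dots> \<le> card Z + (1 + degree \<rho>)" using card_poly_roots_bound[OF \<rho>0] by simp
  finally have "q ^ (2 * k) + q ^ k \<le> card Z + (q - 1) * d" using deg\<rho> card by simp
  moreover have "q ^ (2 * k) + q ^ k = d + (q - 1) * d"
    using q_gt_1 q_d by (cases q) simp_all
  ultimately show "d \<le> card Z" by simp
qed

lemma affine_points_eq: "affine_points q k = (SIGMA a:Z. {b. AS b = H_poly q k a})"
proof -
  have "a \<in> Z" if "AS b = H_poly q k a" for a b
    using that[symmetric] by (simp add: Z_def poly_tau Tr_AS)
  then show ?thesis by (auto simp: affine_points_def on_B_def AS_def)
qed

lemma fibre_over_Z:
  assumes "a \<in> Z"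
  obtains b0 where "{b. AS b = H_poly q k a} = (\<lambda>c. b0 + c) ` Fq"
proof -
  have "H_poly q k a \<in> range AS" unfolding AS_range using assms by (simp add: Z_def poly_tau)
  then obtain b0 where b0: "H_poly q k a = AS b0" by blast
  show thesis by (rule that) (simp only: b0 AS_fibre)
qed

lemma card_fibre: "a \<in> Z \<Longrightarrow> card {b. AS b = H_poly q k a} = q"
  by (erule fibre_over_Z) (simp add: card_image Fq_card)

lemma card_affine_points: "card (affine_points q k :: ('a \<times> 'a) set) = q ^ (2 * k) + q ^ k"
  unfolding affine_points_eq using card_fibre
  by (subst card_SigmaI) (simp_all add: card_Z q_d[symmetric])

text \<open>The polynomial \<open>1 - tau^(q-1)\<close> is the indicator function of \<open>Z\<close>, and its product with \<open>r\<close> has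
  degree less than \<open>q^(2k) - 1\<close>.\<close>

lemma sum_Z_eq_0:
  assumes "degree r + q ^ k + 1 < d"
  shows "(\<Sum>a\<in>Z. poly r a) = 0"
proof -
  have "(\<Sum>a\<in>Z. poly r a) = (\<Sum>a\<in>UNIV. poly ((1 - tau ^ (q - 1)) * r) a)"
  proof -
    have "poly ((1 - tau ^ (q - 1)) * r) a = (if a \<in> Z then poly r a else 0)" for a
    proof (cases "a \<in> Z")
      case True
      then show ?thesis using q_gt_1 by (simp add: Z_def zero_power)
    next
      case False
      then have nz: "poly tau a \<noteq> 0" by (simp add: Z_def)
      have "poly tau a * poly tau a ^ (q - 1) = poly tau a" using tau_power[of a] q_gt_1 by (cases q) simp_all
      then have "poly tau a ^ (q - 1) = 1" using nz by simp
      then show ?thesis using False by simp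
    qed
    then show ?thesis by (simp add: sum.If_cases)
  qed
  also have "\<dots> = 0"
  proof (rule sum_poly_eq_0)
    have "degree (1 - tau ^ (q - 1)) \<le> (q - 1) * d"
      using tau_nonzero by (intro degree_diff_le) (auto simp: degree_power_eq degree_tau)
    then have "degree ((1 - tau ^ (q - 1)) * r) \<le> (q - 1) * d + degree r"
      using degree_mult_le[of "1 - tau ^ (q - 1)" r] by linarith
    moreover have "q ^ (2 * k) + q ^ k = d + (q - 1) * d"
      using q_gt_1 q_d by (cases q) simp_all
    ultimately show "degree ((1 - tau ^ (q - 1)) * r) + 1 < CARD('a)"
      using assms card by linarith
  qed
  finally show ?thesis .
qed

end

section \<open>The AG code and its dual\<close>

locale ag_code = curve q k s y + pts: rational_points q k s "TYPE('a)"
  for q k s :: nat and y :: "'a::{field,finite} ff" +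
  fixes D :: "('a \<times> 'a) list" and m g :: nat
  assumes distinct: "distinct D" and set_D: "set D = affine_points q k"
    and genus: "2 * g = (q - 1) * q ^ k" and m_large: "2 * g \<le> m + 1" and m_small: "2 * (m + 1) \<le> q ^ (2 * k)"
begin

definition N :: nat where "N = q ^ (2 * k) + q ^ k"

lemma length_D: "length D = N"
  using distinct_card[OF distinct] by (simp add: set_D pts.card_affine_points N_def)

lemma nth_D: "i < N \<Longrightarrow> D ! i \<in> affine_points q k"
  using set_D length_D nth_mem by metis

lemma pt_expand:
  assumes "reduced F"
  shows "pt F (a, b) = (\<Sum>j<q. poly (coeff F j) a * b ^ j)"
proof -
  have "pt F (a, b) = (\<Sum>j\<le>degree (map_poly (\<lambda>r. poly r a) F). poly (coeff F j) a * b ^ j)"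
    by (simp add: pt_def poly_altdef coeff_map_poly)
  also have "\<dots> = (\<Sum>j<q. poly (coeff F j) a * b ^ j)"
  proof (rule sum.mono_neutral_left)
    have "degree (map_poly (\<lambda>r. poly r a) F) < q"
      using assms map_poly_degree_leq[of "\<lambda>r. poly r a" F] by (simp add: reduced_def)
    then show "{..degree (map_poly (\<lambda>r. poly r a) F)} \<subseteq> {..<q}" by auto
    show "\<forall>j\<in>{..<q} - {..degree (map_poly (\<lambda>r. poly r a) F)}. poly (coeff F j) a * b ^ j = 0"
    proof
      fix j assume "j \<in> {..<q} - {..degree (map_poly (\<lambda>r. poly r a) F)}"
      then have "coeff (map_poly (\<lambda>r. poly r a) F) j = 0" by (intro coeff_eq_0) auto
      then show "poly (coeff F j) a * b ^ j = 0" by (simp add: coeff_map_poly)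
    qed
  qed simp
  finally show ?thesis .
qed

text \<open>Summation over the fibres leaves a multiple of the sum of the coefficient \<open>r\<close> of \<open>y^(q-1)\<close> over
  \<open>Z\<close>, and the bound on the pole order makes the degree of \<open>r\<close> small enough for the latter to
  vanish.\<close>

lemma sum_points_eq_0:
  assumes F: "F \<in> L_space M" and M: "M + 2 \<le> q ^ (2 * k)"
  shows "(\<Sum>P\<in>affine_points q k. pt F P) = 0"
proof -
  let ?fib = "\<lambda>a. {b. pts.AS b = H_poly q k a}"
  define r where "r = coeff F (q - 1)"
  define \<kappa> where "\<kappa> = (\<Sum>c\<in>pts.Fq. c ^ (q - 1))"
  have red: "reduced F" using F by (simp add: L_space_def)
  have fib: "(\<Sum>b\<in>?fib a. pt F (a, b)) = poly r a * \<kappa>" if a: "a \<in> pts.Z" for a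
  proof -
    obtain b0 where b0: "?fib a = (\<lambda>c. b0 + c) ` pts.Fq" using pts.fibre_over_Z[OF a] by blast
    have "(\<Sum>b\<in>?fib a. pt F (a, b)) = (\<Sum>c\<in>pts.Fq. pt F (a, b0 + c))"
      unfolding b0 by (subst sum.reindex) auto
    also have "\<dots> = (\<Sum>j<q. poly (coeff F j) a * (\<Sum>c\<in>pts.Fq. (b0 + c) ^ j))"
      unfolding pt_expand[OF red] by (subst sum.swap) (simp add: sum_distrib_left)
    also have "\<dots> = (\<Sum>j<q. if j = q - 1 then poly r a * \<kappa> else 0)"
    proof (rule sum.cong)
      fix j assume "j \<in> {..<q}"
      show "poly (coeff F j) a * (\<Sum>c\<in>pts.Fq. (b0 + c) ^ j) = (if j = q - 1 then poly r a * \<kappa> else 0)"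
      proof (cases "j = q - 1")
        case True
        show ?thesis unfolding True pts.fibre_power_sum(2) r_def \<kappa>_def by simp
      next
        case False
        then have "j + 1 < q" using \<open>j \<in> {..<q}\<close> by auto
        then show ?thesis using False by (simp add: pts.fibre_power_sum(1))
      qed
    qed simp
    also have "\<dots> = poly r a * \<kappa>" using q_gt_1 by (simp add: sum.delta)
    finally show ?thesis .
  qed
  have "(\<Sum>P\<in>affine_points q k. pt F P) = (\<Sum>a\<in>pts.Z. \<Sum>b\<in>?fib a. pt F (a, b))"
    unfolding pts.affine_points_eq by (subst sum.Sigma) (auto simp: case_prod_beta')
  also have "\<dots> = (\<Sum>a\<in>pts.Z. poly r a) * \<kappa>" by (simp add: fib sum_distrib_right)
  also have "(\<Sum>a\<in>pts.Z. poly r a) = 0"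
  proof (cases "r = 0")
    case False
    define l where "l = degree r"
    have "coeff (coeff F (q - 1)) l \<noteq> 0" using False by (simp add: r_def l_def)
    then have "weight (l, q - 1) \<le> M" using F by (auto simp: L_space_def bounded_pole_def)
    then have le: "q * l + (q ^ k + 1) * (q - 1) + 2 \<le> q ^ (2 * k)" using M by (simp add: weight_def)
    obtain q' where q': "q = Suc q'" using q_gt_1 by (cases q) auto
    have "(q ^ k + 1) * (q - 1) + q ^ k + 1 = q ^ k * q + q" unfolding q' by (simp add: algebra_simps)
    then have "q * l + q * q ^ k + q + 1 \<le> q ^ (2 * k) + q ^ k" using le by (simp add: mult.commute)
    then have "q * (l + q ^ k + 1) < q * pts.d" unfolding pts.q_d by (simp add: distrib_left)
    then have "l + q ^ k + 1 < pts.d" by (simp only: mult_less_cancel1)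
    then show ?thesis unfolding l_def by (rule pts.sum_Z_eq_0)
  qed simp
  finally show ?thesis by simp
qed

lemma m_less_N: "m < N"
  using m_small by (simp add: N_def)

text \<open>Above each \<open>a \<in> Z\<close> there are \<open>q\<close> points, more than the degree in \<open>y\<close>; so all coefficients vanish
  on \<open>Z\<close>, which has more elements than their degrees allow.\<close>

lemma vanishing_imp_0:
  assumes F: "F \<in> L_space m" and van: "\<And>P. P \<in> affine_points q k \<Longrightarrow> pt F P = 0"
  shows "F = 0"
proof -
  have red: "reduced F" using F by (simp add: L_space_def)
  have coeff0: "poly (coeff F j) a = 0" if a: "a \<in> pts.Z" for a j
  proof -
    define E where "E = map_poly (\<lambda>r. poly r a) F"
    have sub: "{b. pts.AS b = H_poly q k a} \<subseteq> {b. poly E b = 0}"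
      using van a unfolding pts.affine_points_eq by (auto simp: pt_def E_def)
    have "E = 0"
    proof (rule ccontr)
      assume E: "E \<noteq> 0"
      have "q = card {b. pts.AS b = H_poly q k a}" using pts.card_fibre[OF a] by simp
      also have "\<dots> \<le> card {b. poly E b = 0}" by (rule card_mono[OF _ sub]) simp
      also have "\<dots> \<le> degree E" by (rule card_poly_roots_bound[OF E])
      also have "\<dots> \<le> degree F" unfolding E_def by (rule map_poly_degree_leq)
      finally show False using red by (simp add: reduced_def)
    qed
    then have "coeff E j = 0" by simp
    then show ?thesis by (simp add: E_def coeff_map_poly)
  qed
  have "coeff F j = 0" for j
  proof (rule ccontr)
    assume nz: "coeff F j \<noteq> 0"
    let ?r = "coeff F j"
    have "coeff ?r (degree ?r) \<noteq> 0" using nz by simp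
    then have "weight (degree ?r, j) \<le> m" using F unfolding L_space_def bounded_pole_def by blast
    then have "q * degree ?r < N" using m_less_N by (simp add: weight_def)
    then have "q * degree ?r < q * pts.d" unfolding pts.q_d N_def .
    then have "degree ?r < pts.d" by (simp only: mult_less_cancel1)
    moreover have "card pts.Z \<le> card {a. poly ?r a = 0}" by (rule card_mono) (auto intro: coeff0)
    then have "pts.d \<le> degree ?r" using card_poly_roots_bound[OF nz] by (simp add: pts.card_Z)
    ultimately show False by simp
  qed
  then show ?thesis by (simp add: poly_eq_iff)
qed

definition codeword :: "'a poly poly \<Rightarrow> 'a vec" where
  "codeword F = vec_of_list (map (pt F) D)"

lemma AG_code_eq: "AG_code y D m = codeword ` L_space m"
proof -
  have c: "vec_of_list (map (value_at y (ev y F)) D) = codeword F" for F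
    unfolding codeword_def using value_at_ev set_D
    by (intro arg_cong[of _ _ vec_of_list] map_cong) auto
  have "AG_code y D m = (\<lambda>F. vec_of_list (map (value_at y (ev y F)) D)) ` L_space m"
    unfolding AG_code_def RR_space_eq L_space_def by blast
  then show ?thesis by (simp only: c)
qed

lemma codeword_carrier: "codeword F \<in> carrier_vec N"
  by (simp add: codeword_def carrier_dim_vec length_D)

lemma codeword_index: "i < N \<Longrightarrow> codeword F $ i = pt F (D ! i)"
  by (simp add: codeword_def length_D vec_of_list_index)

lemma linear_code_AG:
  assumes "CARD('a) = CHAR('a) ^ e"
  shows "linear_code N (AG_code y D m) e"
proof
  show "CARD('a) = CHAR('a) ^ e" by fact
  show "AG_code y D m \<subseteq> carrier_vec N" unfolding AG_code_eq using codeword_carrier by auto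
  have "codeword 0 = 0\<^sub>v N"
    using codeword_carrier[of 0] by (intro eq_vecI) (auto simp: codeword_index)
  then show "0\<^sub>v N \<in> AG_code y D m" unfolding AG_code_eq using L_space_subspace(1) by (metis imageI)
  fix u assume "u \<in> AG_code y D m"
  then obtain F where F: "F \<in> L_space m" "u = codeword F" by (auto simp: AG_code_eq)
  have "c \<cdot>\<^sub>v u = codeword (smult [:c:] F)" for c
    using codeword_carrier[of F] codeword_carrier[of "smult [:c:] F"]
    by (intro eq_vecI) (auto simp: F(2) codeword_index pt_smult)
  then show "c \<cdot>\<^sub>v u \<in> AG_code y D m" for c
    unfolding AG_code_eq using L_space_subspace(3)[OF F(1)] by (metis imageI)
  fix v assume "v \<in> AG_code y D m"
  then obtain G where G: "G \<in> L_space m" "v = codeword G" by (auto simp: AG_code_eq)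
  have "u + v = codeword (F + G)"
    using codeword_carrier[of F] codeword_carrier[of G] codeword_carrier[of "F + G"]
    by (intro eq_vecI) (auto simp: F(2) G(2) codeword_index pt_add)
  then show "u + v \<in> AG_code y D m"
    unfolding AG_code_eq using L_space_subspace(2)[OF F(1) G(1)] by (metis imageI)
qed

lemma card_AG: "card (AG_code y D m) = CARD('a) ^ (m + 1 - g)"
proof -
  have "inj_on codeword (L_space m)"
  proof (rule inj_onI)
    fix F G assume FG: "F \<in> L_space m" "G \<in> L_space m" "codeword F = codeword G"
    have "pt (F - G) P = 0" if "P \<in> affine_points q k" for P
    proof -
      have "P \<in> set D" using that set_D by simp
      then obtain i where i: "i < N" "D ! i = P" by (auto simp: in_set_conv_nth length_D)
      then have "pt F P = pt G P" using FG(3) codeword_index[of i F] codeword_index[of i G] by simp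
      then show ?thesis by (simp add: pt_diff)
    qed
    then have "F - G = 0" using vanishing_imp_0 L_space_subspace(4)[OF FG(1,2)] by blast
    then show "F = G" by simp
  qed
  then show ?thesis unfolding AG_code_eq using card_L_space[OF genus m_large] by (simp add: card_image)
qed

lemma scalar_prod_codeword:
  assumes "v \<in> carrier_vec N"
  shows "v \<bullet> codeword F = (\<Sum>i<N. v $ i * pt F (D ! i))"
  using codeword_carrier[of F] by (simp add: scalar_prod_def codeword_index lessThan_atLeast0)

lemma self_orthogonal_AG: "AG_code y D m \<subseteq> euclidean_dual N (AG_code y D m)"
proof -
  have "codeword F \<bullet> codeword G = 0" if FG: "F \<in> L_space m" "G \<in> L_space m" for F G
  proof -
    obtain H where H: "H \<in> L_space (m + m)" "ev y H = ev y F * ev y G" using L_space_mult FG by blast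
    have "codeword F \<bullet> codeword G = (\<Sum>i<N. pt F (D ! i) * pt G (D ! i))"
      using codeword_carrier[of F] by (simp add: scalar_prod_codeword codeword_index)
    also have "\<dots> = (\<Sum>i<length D. pt H (D ! i))"
      unfolding length_D
    proof (rule sum.cong)
      fix i assume "i \<in> {..<N}"
      then have "pt H (D ! i) = pt (F * G) (D ! i)" using H(2) nth_D by (intro pt_cong) (auto simp: ev_mult)
      then show "pt F (D ! i) * pt G (D ! i) = pt H (D ! i)" by (simp add: pt_mult)
    qed simp
    also have "\<dots> = (\<Sum>P\<in>set D. pt H P)"
      using sum.reindex_bij_betw[OF bij_betw_nth[OF distinct refl refl], of "pt H"] by simp
    also have "\<dots> = 0" unfolding set_D using H(1) m_small by (intro sum_points_eq_0[of _ "m + m"]) auto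
    finally show ?thesis .
  qed
  then show ?thesis unfolding AG_code_eq euclidean_dual_def using codeword_carrier by auto
qed

text \<open>The order bound of Feng and Rao. Let \<open>\<phi>\<close> be the linear form \<open>F \<mapsto> v \<bullet> codeword F\<close>, and let \<open>\<rho>\<close> be
  the least pole order up to which it does not vanish identically; then \<open>\<rho> > m\<close>, and \<open>\<phi>\<close> vanishes
  on no polynomial of pole order exactly \<open>\<rho>\<close>. Let \<open>W\<close> be the set of pole orders \<open>a\<close> such that \<open>\<rho> -
  a\<close> is a pole order too. Only \<open>2g\<close> numbers up to \<open>\<rho>\<close> can fail to be in \<open>W\<close>, one for each gap \<open>a\<close>
  and one for each gap \<open>\<rho> - a\<close>. The monomials with pole orders in \<open>W\<close> remain linearly independent
  when restricted to the support of \<open>v\<close>: if a combination \<open>F\<close> of pole order \<open>a\<close> vanished there, so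
  would its product with a monomial of pole order \<open>\<rho> - a\<close>, and \<open>\<phi>\<close> would vanish on a polynomial of
  pole order \<open>\<rho>\<close>. So the support has at least as many elements as \<open>W\<close>.\<close>

lemma dual_weight:
  assumes v: "v \<in> carrier_vec N" "v \<noteq> 0\<^sub>v N" and orth: "\<And>F. F \<in> L_space m \<Longrightarrow> v \<bullet> codeword F = 0"
  shows "m + 2 \<le> card {i. i < N \<and> v $ i \<noteq> 0} + 2 * g"
proof -
  define \<phi> where "\<phi> F = (\<Sum>i<N. v $ i * pt F (D ! i))" for F
  define S where "S = {i. i < N \<and> v $ i \<noteq> 0}"
  have finS: "finite S" by (simp add: S_def)
  have \<phi>_add: "\<phi> (F + G) = \<phi> F + \<phi> G" and \<phi>_smult: "\<phi> (smult [:c:] F) = c * \<phi> F" for F G c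
    by (simp_all add: \<phi>_def pt_add pt_smult sum.distrib sum_distrib_left distrib_left mult_ac)
  have \<phi>_cong: "\<phi> F = \<phi> G" if "ev y F = ev y G" for F G
    unfolding \<phi>_def using pt_cong[OF that nth_D] by (intro sum.cong) auto
  \<comment> \<open>Some polynomial separates a point of the support from the others.\<close>
  have "\<exists>n. \<exists>F\<in>L_space n. \<phi> F \<noteq> 0"
  proof -
    have "\<exists>i0<N. v $ i0 \<noteq> 0"
    proof (rule ccontr)
      assume "\<not> (\<exists>i0<N. v $ i0 \<noteq> 0)"
      then have "v = 0\<^sub>v N" using v(1) by (intro eq_vecI) auto
      then show False using v(2) by simp
    qed
    then obtain i0 where i0: "i0 < N" "v $ i0 \<noteq> 0" by blast
    obtain a0 b0 where P0: "D ! i0 = (a0, b0)" by fastforce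
    define A where "A = (\<Prod>a\<in>UNIV - {a0}. [:[:- a, 1:]:]) * (\<Prod>b\<in>UNIV - {b0}. [:[:- b:], 1:])"
    have A: "pt A (a, b) = (\<Prod>a'\<in>UNIV - {a0}. a - a') * (\<Prod>b'\<in>UNIV - {b0}. b - b')" for a b
      by (simp add: A_def pt_mult pt_prod pt_pCons)
    have nz: "pt A (a0, b0) \<noteq> 0" unfolding A by auto
    have z: "pt A (a, b) = 0" if "(a, b) \<noteq> (a0, b0)" for a b
      unfolding A using that by auto
    have "\<phi> A = (\<Sum>i<N. if i = i0 then v $ i0 * pt A (a0, b0) else 0)"
      unfolding \<phi>_def
    proof (rule sum.cong)
      fix i assume i: "i \<in> {..<N}"
      show "v $ i * pt A (D ! i) = (if i = i0 then v $ i0 * pt A (a0, b0) else 0)"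
      proof (cases "i = i0")
        case False
        then have "D ! i \<noteq> D ! i0" using i i0 distinct length_D nth_eq_iff_index_eq by (metis lessThan_iff)
        then have "pt A (D ! i) = 0" using z[of "fst (D ! i)" "snd (D ! i)"] P0 by simp
        then show ?thesis using False by simp
      qed (simp add: P0)
    qed simp
    then have "\<phi> A \<noteq> 0" using i0 nz by (simp add: sum.delta)
    moreover obtain F where F: "reduced F" "ev y A = ev y F" using ex_reduced_ev by blast
    moreover have "F \<in> L_space (pole_order F)"
      using L_space_iff_pole_order[OF F(1), of "pole_order F"] L_space_subspace(1) by (cases "F = 0") auto
    ultimately show ?thesis using \<phi>_cong[OF F(2)] by auto
  qed
  define \<rho> where "\<rho> = (LEAST n. \<exists>F\<in>L_space n. \<phi> F \<noteq> 0)"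
  have "\<exists>F\<in>L_space \<rho>. \<phi> F \<noteq> 0" unfolding \<rho>_def by (rule LeastI_ex) fact
  then obtain F0 where F0: "F0 \<in> L_space \<rho>" "\<phi> F0 \<noteq> 0" by blast
  have below: "\<phi> F = 0" if "F \<in> L_space n" "n < \<rho>" for F n
    using that not_less_Least[of n "\<lambda>n. \<exists>F\<in>L_space n. \<phi> F \<noteq> 0"] by (auto simp: \<rho>_def)
  have "\<phi> F = 0" if "F \<in> L_space n" "n \<le> m" for F n
  proof -
    have "F \<in> L_space m" using that by (auto simp: L_space_def bounded_pole_def intro: order_trans)
    then show ?thesis using orth scalar_prod_codeword[OF v(1)] by (simp add: \<phi>_def)
  qed
  then have \<rho>m: "\<rho> > m" using F0 by (meson not_le)
  then obtain \<rho>' where \<rho>': "\<rho> = Suc \<rho>'" by (cases \<rho>) auto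
  have top: "\<phi> H \<noteq> 0" if H: "reduced H" "H \<noteq> 0" "pole_order H = \<rho>" for H
  proof
    assume 0: "\<phi> H = 0"
    obtain c where c: "F0 - smult [:c:] H \<in> L_space \<rho>'"
      using cancel_leading_monomial[of F0 \<rho>' H] F0(1) H \<rho>' by auto
    have "\<phi> F0 = \<phi> (F0 - smult [:c:] H) + \<phi> (smult [:c:] H)"
      by (simp flip: \<phi>_add)
    also have "\<dots> = 0" using below[OF c] \<rho>' 0 \<phi>_smult by simp
    finally show False using F0 by simp
  qed
  define W where "W = {a. a \<le> \<rho> \<and> a \<in> pole_orders \<and> \<rho> - a \<in> pole_orders}"
  let ?I = "monomials_in W"
  have finW: "finite W" by (rule finite_subset[of _ "{..\<rho>}"]) (auto simp: W_def)
  have finI: "finite ?I" by (rule finite_monomials_in[OF finW])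
  have subI: "?I \<subseteq> {(i, j). j < q}" by (auto simp: monomials_in_def)
  have cardI: "card ?I = card W"
    unfolding card_monomials_in by (rule arg_cong[of _ _ card]) (auto simp: W_def)
  have indep: "F = 0" if F: "reduced F" "monomials F \<subseteq> ?I" and van: "\<And>i. i \<in> S \<Longrightarrow> pt F (D ! i) = 0" for F
  proof (rule ccontr)
    assume nz: "F \<noteq> 0"
    obtain i j where ij: "j < q" "coeff (coeff F j) i \<noteq> 0" "weight (i, j) = pole_order F"
      using pole_order_attained[OF F(1) nz] by blast
    then have "pole_order F \<in> W" using F(2) by (auto simp: monomials_def monomials_in_def)
    then have le: "pole_order F \<le> \<rho>" and "\<rho> - pole_order F \<in> pole_orders" by (auto simp: W_def)
    then obtain i' j' where ij': "j' < q" "weight (i', j') = \<rho> - pole_order F" by (auto simp: pole_orders_def)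
    define G where "G = of_coeffs {(i', j')} (\<lambda>_. 1)"
    have G: "reduced G" unfolding G_def using ij' by (intro reduced_of_coeffs) auto
    have cG: "coeff (coeff G b) a = (if (a, b) = (i', j') then 1 else 0)" for a b
      unfolding G_def by (subst coeff_of_coeffs) auto
    have mG: "monomials G = {(i', j')}" by (auto simp: monomials_def cG)
    have G0: "G \<noteq> 0" using mG monomials_empty_iff[of G] by auto
    have pG: "pole_order G = \<rho> - pole_order F" by (simp add: pole_order_def mG ij')
    obtain H where H: "reduced H" "ev y (F * G) = ev y H" using ex_reduced_ev by blast
    have "H \<noteq> 0" "pole_order H = pole_order F + pole_order G"
      using pole_order_mult[OF F(1) nz G G0 H(1)] H(2) by (simp_all add: ev_mult)
    then have "\<phi> H \<noteq> 0" using top[OF H(1)] pG le by simp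
    moreover have "\<phi> H = \<phi> (F * G)" using \<phi>_cong[OF H(2)] by simp
    moreover have "\<phi> (F * G) = 0"
      unfolding \<phi>_def
    proof (rule sum.neutral, rule ballI)
      fix i assume "i \<in> {..<N}"
      then show "v $ i * pt (F * G) (D ! i) = 0" using van[of i] by (cases "v $ i = 0") (auto simp: S_def pt_mult)
    qed
    ultimately show False by simp
  qed
  have "card (?I \<rightarrow>\<^sub>E (UNIV :: 'a set)) \<le> card (S \<rightarrow>\<^sub>E (UNIV :: 'a set))"
  proof (rule card_inj_on_le[of "\<lambda>c. restrict (\<lambda>i. pt (of_coeffs ?I c) (D ! i)) S"])
    show "inj_on (\<lambda>c. restrict (\<lambda>i. pt (of_coeffs ?I c) (D ! i)) S) (?I \<rightarrow>\<^sub>E (UNIV :: 'a set))"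
    proof (rule inj_onI)
      fix c d assume cd: "c \<in> ?I \<rightarrow>\<^sub>E (UNIV :: 'a set)" "d \<in> ?I \<rightarrow>\<^sub>E (UNIV :: 'a set)"
        and eq: "restrict (\<lambda>i. pt (of_coeffs ?I c) (D ! i)) S = restrict (\<lambda>i. pt (of_coeffs ?I d) (D ! i)) S"
      let ?F = "of_coeffs ?I c - of_coeffs ?I d"
      have cf: "coeff (coeff ?F j) i = (if (i, j) \<in> ?I then c (i, j) - d (i, j) else 0)" for i j
        by (simp add: coeff_of_coeffs[OF finI])
      have "?F = 0"
      proof (rule indep)
        show "reduced ?F" by (intro reduced_diff reduced_of_coeffs finI subI)
        show "monomials ?F \<subseteq> ?I" unfolding monomials_def cf by (auto split: if_splits)
        fix i assume "i \<in> S"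
        then show "pt ?F (D ! i) = 0" using fun_cong[OF eq, of i] by (simp add: pt_diff)
      qed
      then have "c (i, j) = d (i, j)" if "(i, j) \<in> ?I" for i j using cf[of j i] that by simp
      then show "c = d" using cd by (intro PiE_ext[of c ?I "\<lambda>_. UNIV" d]) auto
    qed
    show "finite (S \<rightarrow>\<^sub>E (UNIV :: 'a set))" using finS by (intro finite_PiE) auto
  qed auto
  then have "CARD('a) ^ card W \<le> CARD('a) ^ card S" using finI finS by (simp add: card_PiE cardI)
  then have WS: "card W \<le> card S" using card_gt_1[where 'a='a] by simp
  have "\<rho> + 1 \<le> card W + 2 * g"
  proof -
    let ?gaps = "{..\<rho>} - pole_orders"
    have "card (pole_orders \<inter> {..\<rho>}) + g = \<rho> + 1" by (rule card_pole_orders[OF genus]) (use m_large \<rho>m in simp)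
    moreover have "card ({..\<rho>} \<inter> pole_orders) + card ?gaps = card {..\<rho>}" using card_Int_Diff[of "{..\<rho>}" pole_orders] by simp
    ultimately have gaps: "card ?gaps = g" by (simp add: Int_commute)
    have "{..\<rho>} \<subseteq> W \<union> (?gaps \<union> (\<lambda>a. \<rho> - a) ` ?gaps)"
    proof
      fix a assume a: "a \<in> {..\<rho>}"
      show "a \<in> W \<union> (?gaps \<union> (\<lambda>a. \<rho> - a) ` ?gaps)"
      proof (cases "\<rho> - a \<in> pole_orders")
        case True
        then show ?thesis using a by (auto simp: W_def)
      next
        case False
        then have "a \<in> (\<lambda>a. \<rho> - a) ` ?gaps" using a by (intro image_eqI[of _ _ "\<rho> - a"]) auto
        then show ?thesis by blast
      qed
    qed
    then have "card {..\<rho>} \<le> card (W \<union> (?gaps \<union> (\<lambda>a. \<rho> - a) ` ?gaps))" using finW by (intro card_mono) auto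
    also have "\<dots> \<le> card W + (card ?gaps + card ((\<lambda>a. \<rho> - a) ` ?gaps))"
      by (intro order_trans[OF card_Un_le] add_mono card_Un_le order_refl)
    also have "\<dots> \<le> card W + (g + g)" using gaps card_image_le[of ?gaps "\<lambda>a. \<rho> - a"] by simp
    finally show ?thesis by simp
  qed
  then show ?thesis using WS \<rho>m by (simp add: S_def)
qed

theorem quantum_code_AG:
  assumes card: "CARD('a) = CHAR('a) ^ e"
  shows "\<exists>V. obtained_from V N (AG_code y D m) \<and> quantum_code V N (N - 2 * (m + 1 - g)) (m + 2 - 2 * g)"
proof -
  interpret self_orthogonal_code N "AG_code y D m" e
    by (intro self_orthogonal_code.intro self_orthogonal_code_axioms.intro linear_code_AG card self_orthogonal_AG)
  have dist: "m + 2 - 2 * g \<le> card {i. i < N \<and> v $ i \<noteq> 0}" if "v \<in> dual" "v \<noteq> 0\<^sub>v N" for v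
  proof -
    have "v \<bullet> codeword F = 0" if "F \<in> L_space m" for F
      using \<open>v \<in> dual\<close> that by (auto simp: euclidean_dual_def AG_code_eq)
    then have "m + 2 \<le> card {i. i < N \<and> v $ i \<noteq> 0} + 2 * g"
      using dual_weight dual_carrier that by blast
    then show ?thesis by simp
  qed
  show ?thesis using quantum_code_from_self_orthogonal[OF card_AG dist] by blast
qed

end

theorem theorem7p6:
  fixes p e q k n g m :: nat
    and D :: "('a::{field,finite} \<times> 'a) list"
    and y :: "'a ff"
  assumes "prime p" and "e > 0" and "q = p ^ e"
    and "k > 0" and "gcd p (2 * k) = 1" and "n = 2 * k"
    and "CARD('a) = q ^ n"
    and "real g = (real q - 1) * real q ^ k / 2"
    and "2 * int g - 2 < int m" and "m < q ^ n + q ^ k"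
    and "2 * (m + 1) \<le> q ^ n"
    and "on_B q k x_gen y"
    and "distinct D" and "set D = affine_points q k"
  shows "\<exists>V :: 'a state set.
      obtained_from V (q ^ n + q ^ k) (AG_code y D m) \<and>
      quantum_code V
        (q ^ n + q ^ k)
        (nat (int (q ^ n) + int (q ^ k) - 2 * int m + 2 * int g - 2))
        (nat (int m - (int q - 1) * int q ^ k + 2))"
proof -
  have card: "CARD('a) = p ^ (e * n)" using assms(3,7) by (simp add: power_mult)
  have char: "CHAR('a) = p" by (rule CHAR_eq_prime[OF assms(1) card])
  have q1: "q > 1" unfolding assms(3) using assms(1,2) prime_gt_1_nat by (intro one_less_power) auto
  have "real (2 * g) = real ((q - 1) * q ^ k)" using assms(8) q1 by (simp add: of_nat_diff)
  then have genus: "2 * g = (q - 1) * q ^ k" by (simp only: of_nat_eq_iff)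
  have coprime: "\<not> p dvd 2 * k"
  proof
    assume "p dvd 2 * k"
    then have "p dvd gcd p (2 * k)" by simp
    then show False using assms(1,5) by (simp add: prime_nat_iff)
  qed
  interpret ag_code q k e y D m g
    by unfold_locales (use assms card char genus coprime in \<open>auto simp: power_mult\<close>)
  have N: "N = q ^ n + q ^ k" by (simp add: N_def assms(6))
  have le: "2 * g \<le> m + 1" by (rule m_large)
  have K: "N - 2 * (m + 1 - g) = nat (int (q ^ n) + int (q ^ k) - 2 * int m + 2 * int g - 2)"
    using le m_small unfolding N assms(6) by linarith
  have "int (2 * g) = (int q - 1) * int q ^ k" unfolding genus using q1 by (simp add: of_nat_diff)
  then have d: "m + 2 - 2 * g = nat (int m - (int q - 1) * int q ^ k + 2)" by simp
  have "CARD('a) = CHAR('a) ^ (e * n)" using card char by simp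
  from quantum_code_AG[OF this] show ?thesis unfolding K d unfolding N .
qed

end
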